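(* Suppose $h_1,\dots,h_m\in C(\mathbb R_+)$ are increasing real-valued functions with $h_j(0)\le0$, each satisfying $$\lim_{t\to\infty}\frac{h_j(t)}t=\infty\quad\text{and}\quad\limsup_{t\to\infty}\frac{h_j(t+1)}{h_j(t)}<\infty,$$ such that for some integer $1\le l\le m$ $$\lim_{t\to\infty}\frac{h_j(t)}{\sqrt{h_{j+1}(t)}}=0\quad\text{for all }1\le j\le l-1$$ and $$\limsup_{t\to\infty}\frac{\int_M^th_j(s)\,ds}{\int_M^{t-1}h_{j+1}(s)\,ds}<\frac12\quad\text{for all }l+1\le j\le m-1,$$ where $M:=\max_{l+1\le j\le m}\{h_j^{-1}(0)\}$. Let $(g_1,\dots,g_m):=(f_{h_1},\dots,f_{h_l},e^{f_{h_{l+1}}},\dots,e^{f_{h_m}})$. Then: (i) the $g_j$ are nonpolynomial entire functions of class $\mathscr C$ with $\rho_{g_1}\le\cdots\le\rho_{g_m}$, and for $j\in\{1,\dots,m-1\}$, $$\lim_{r\to\infty}\frac{m_{g_j}(r)-m_{g_j}\left(\frac re\right)}{\sqrt{m_{g_{j+1}}(r)-m_{g_{j+1}}\left(\frac re\right)}}=0\ \text{ if }\rho_{g_{j+1}}<\infty,\qquad\limsup_{r\to\infty}\frac{\ln m_{g_j}(r)}{\ln m_{g_{j+1}}\left(\frac re\right)}<\frac12\ \text{ if }\rho_{g_j}=\infty;$$ (ii) consequently, for $f=(g_1,\dots,g_m):\mathbb C\to\mathbb C^m$ the graph $\Gamma_f\subset\mathbb C^{m+1}$ admits the Bernstein type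 inequality of exponent $\mu(k):=k^{2^m+\varepsilon(k)}$, $k\in\mathbb Z_+$, for some $\varepsilon:\mathbb Z_+\to\mathbb R_+$ decreasing to zero. Here $\varepsilon=0$ if $l=m$.
   Context: $\mathbb R_+=[0,\infty)$, $\mathbb Z_+=\{0,1,2,\dots\}$. "Increasing" for the $h_j$ means strictly increasing, and $h^{-1}:[h(0),\infty)\to[0,\infty)$ is the inverse of $h$. For such $h$, $f_h$ denotes an entire function $f_h(z)=\sum_{j=0}^\infty c_jz^j$ on $\mathbb C$ with $\ln|c_j|=-\int_0^jh^{-1}(s)\,ds$, $j\in\mathbb Z_+$ (the arguments of the $c_j$ are arbitrary). For an entire function $f$ on $\mathbb C^n$: $M_f(r):=\sup_{\|z\|<r}|f(z)|$ ($\|\cdot\|$ the Euclidean norm), $m_f(r):=\ln M_f(r)$, the order is $\rho_f:=\limsup_{r\to\infty}\frac{\ln m_f(r)}{\ln r}$, and $\phi_f(t):=m_f(e^t)$, $t\in\mathbb R$. Class $\mathscr C$ consists of the nonpolynomial entire functions $f$ satisfying one of the following: (I) $\rho_f<\infty$ and $\limsup_{t\to\infty}\frac{\phi_f(t+1)-\phi_f(t)}{\phi_f(t)-\phi_f(t-1)}<\infty$; (II) $\rho_f=\infty$ and $\lim_{t\to\infty}t^2\left(\frac1{\ln\psi(t)}\right)'=0$ (limit over the points where $\psi'$ exists) for some convex increasing $\psi\in C(\mathbb R)$ with $\lim_{t\to\infty}\frac{\ln\psi(t)}{\ln\phi_f(t)}=1$. The graph $\Gamma_f=\{(z,f(z)):z\in\mathbb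 C\}\subset\mathbb C^{m+1}$ of a holomorphic map $f:\mathbb C\to\mathbb C^m$ admits the Bernstein type inequality of exponent $\mu:\mathbb Z_+\to\mathbb R_+$ if for each $r>0$ there is a nonnegative constant $C(r)$ such that for all holomorphic polynomials $p$ on $\mathbb C^{m+1}$, $\max_{|z|\le er}|p(z,f(z))|\le C(r)^{\mu(\deg p)}\max_{|z|\le r}|p(z,f(z))|$. *)

theory Defs
  imports "HOL-Complex_Analysis.Complex_Analysis" "HOL-Library.Poly_Mapping"
begin

definition max_modulus :: "(complex \<Rightarrow> complex) \<Rightarrow> real \<Rightarrow> real" where
  "max_modulus f r = (SUP z\<in>ball 0 r. cmod (f z))"

definition log_max_modulus :: "(complex \<Rightarrow> complex) \<Rightarrow> real \<Rightarrow> real" where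
  "log_max_modulus f r = ln (max_modulus f r)"

definition growth_order :: "(complex \<Rightarrow> complex) \<Rightarrow> ereal" where
  "growth_order f = Limsup at_top (\<lambda>r. ereal (ln (log_max_modulus f r) / ln r))"

definition growth_phi :: "(complex \<Rightarrow> complex) \<Rightarrow> real \<Rightarrow> real" where
  "growth_phi f t = log_max_modulus f (exp t)"

definition nonpolynomial_entire :: "(complex \<Rightarrow> complex) \<Rightarrow> bool" where
  "nonpolynomial_entire f \<longleftrightarrow>
     f holomorphic_on UNIV \<and> \<not> (\<exists>p :: complex poly. \<forall>z. f z = poly p z)"

definition class_C_finite :: "(complex \<Rightarrow> complex) \<Rightarrow> bool" where
  "class_C_finite f \<longleftrightarrow>
     growth_order f < \<infinity> \<and>
     Limsup at_top (\<lambda>t. ereal ((growth_phi f (t + 1) - growth_phi f t) /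
                               (growth_phi f t - growth_phi f (t - 1)))) < \<infinity>"

text \<open>
  The limit involving the derivative is taken along the points at which \<open>\<psi>\<close> is differentiable,
  that is, all but countably many points, since \<open>\<psi>\<close> is convex.
\<close>

definition class_C_infinite :: "(complex \<Rightarrow> complex) \<Rightarrow> bool" where
  "class_C_infinite f \<longleftrightarrow>
     growth_order f = \<infinity> \<and>
     (\<exists>\<psi> :: real \<Rightarrow> real.
        continuous_on UNIV \<psi> \<and> convex_on UNIV \<psi> \<and> strict_mono \<psi> \<and>
        ((\<lambda>t. ln (\<psi> t) / ln (growth_phi f t)) \<longlongrightarrow> 1) at_top \<and>
        ((\<lambda>t. t\<^sup>2 * deriv (\<lambda>s. 1 / ln (\<psi> s)) t) \<longlongrightarrow> 0)
          (inf at_top (principal {t. \<psi> differentiable (at t)})))"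

definition class_C :: "(complex \<Rightarrow> complex) set" where
  "class_C = {f. nonpolynomial_entire f \<and> (class_C_finite f \<or> class_C_infinite f)}"

definition half_line_inv :: "(real \<Rightarrow> real) \<Rightarrow> real \<Rightarrow> real" where
  "half_line_inv h = the_inv_into {0..} h"

text \<open>
  The arguments of the coefficients are arbitrary, so \<open>f\<^sub>h\<close> is a predicate rather than a function
  of \<open>h\<close>. Since \<open>ln 0 = 0\<close> in HOL, the coefficients have to be required to be nonzero.
\<close>

definition is_f\<^sub>h :: "(real \<Rightarrow> real) \<Rightarrow> (complex \<Rightarrow> complex) \<Rightarrow> bool" where
  "is_f\<^sub>h h f \<longleftrightarrow>
     (\<exists>c :: nat \<Rightarrow> complex.
        (\<forall>n. c n \<noteq> 0 \<and> ln (cmod (c n)) = - integral {0..real n} (half_line_inv h)) \<and>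
        (\<forall>z. (\<lambda>n. c n * z ^ n) sums f z))"

text \<open>
  A complex polynomial in the variables \<open>x\<^sub>0, \<dots>, x\<^sub>m\<close> is a finitely supported map from exponent
  vectors to coefficients, where the exponent vectors are supported in \<open>{0..m}\<close>.
\<close>

type_synonym multi_poly = "(nat \<Rightarrow>\<^sub>0 nat) \<Rightarrow>\<^sub>0 complex"

definition polys_upto :: "nat \<Rightarrow> multi_poly set" where
  "polys_upto m = {p. \<forall>\<alpha>\<in>Poly_Mapping.keys p. Poly_Mapping.keys \<alpha> \<subseteq> {0..m}}"

definition eval_poly :: "multi_poly \<Rightarrow> (nat \<Rightarrow> complex) \<Rightarrow> complex" where
  "eval_poly p x =
     (\<Sum>\<alpha>\<in>Poly_Mapping.keys p.
        Poly_Mapping.lookup p \<alpha> *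
        (\<Prod>i\<in>Poly_Mapping.keys \<alpha>. x i ^ Poly_Mapping.lookup \<alpha> i))"

text \<open>The total degree; the zero polynomial gets degree 0.\<close>

definition poly_deg :: "multi_poly \<Rightarrow> nat" where
  "poly_deg p =
     Max (insert 0 ((\<lambda>\<alpha>. \<Sum>i\<in>Poly_Mapping.keys \<alpha>. Poly_Mapping.lookup \<alpha> i) `
                    Poly_Mapping.keys p))"

text \<open>
  A map into \<open>\<complex>\<^sup>m\<close> is given by its components \<open>f 1, \<dots>, f m\<close>; coordinate 0 of a point of the graph
  is the variable \<open>z\<close> itself.
\<close>

definition graph_point :: "(nat \<Rightarrow> complex \<Rightarrow> complex) \<Rightarrow> complex \<Rightarrow> nat \<Rightarrow> complex" where
  "graph_point f z i = (if i = 0 then z else f i z)"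

text \<open>
  In HOL, \<open>0 powr 0 = 0\<close>. This does not affect the notion, as any constant \<open>C \<ge> 0\<close> may be replaced
  by \<open>max C 1\<close>.
\<close>

definition graph_admits_Bernstein ::
    "nat \<Rightarrow> (nat \<Rightarrow> complex \<Rightarrow> complex) \<Rightarrow> (nat \<Rightarrow> real) \<Rightarrow> bool" where
  "graph_admits_Bernstein m f \<mu> \<longleftrightarrow>
     (\<forall>j\<in>{1..m}. f j holomorphic_on UNIV) \<and>
     (\<forall>k. \<mu> k \<ge> 0) \<and>
     (\<forall>r>0. \<exists>C\<ge>0. \<forall>p\<in>polys_upto m.
        (SUP z\<in>cball 0 (exp 1 * r). cmod (eval_poly p (graph_point f z)))
          \<le> C powr \<mu> (poly_deg p) *
             (SUP z\<in>cball 0 r. cmod (eval_poly p (graph_point f z))))"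

end

theory Submission imports Defs begin

text \<open>
  Let \<open>\<psi>\<close> be the primitive of \<open>h\<close> that vanishes at the zero of \<open>h\<close>. It is the Legendre transform of
  \<open>x \<mapsto> \<integral>\<^sub>0\<^sup>x h\<^sup>-\<^sup>1\<close>, so \<open>exp (\<psi> t)\<close> is, up to a factor \<open>exp (o (h t))\<close>, the maximal term of \<open>f\<^sub>h\<close> on
  the circle of radius \<open>exp t\<close>, hence also its maximum modulus there and, by Borel and Caratheodory, the maximum
  of its real part. This reduces part (i) to estimates of \<open>h\<close> and \<open>\<psi>\<close>.

  For part (ii) write a polynomial on the graph as \<open>P = \<Sum>\<^sub>i a\<^sub>i g\<^sup>i\<close> with \<open>g\<close> the fastest growing function
  and \<open>a\<^sub>i\<close> polynomials in the slower ones. As a polynomial in \<open>w\<close>, the difference \<open>\<Sum>\<^sub>i a\<^sub>i w\<^sup>i - P\<close> is divisible by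
  \<open>w - g\<close>. On a radius where \<open>ln M\<^sub>g\<close> grows faster than all \<open>ln \<bar>a\<^sub>i\<bar>\<close> can, this forces the \<open>a\<^sub>i\<close> to
  be bounded by \<open>P\<close>, and so \<open>P\<close> cannot grow faster than the \<open>a\<^sub>i\<close> and \<open>g\<^sup>k\<close> together. Since \<open>ln M\<^sub>P\<close> is convex
  in \<open>ln r\<close>, a bound of its slope at a large radius holds at all smaller ones, which yields an induction
  on the number of functions. The growth conditions make the radii chosen for the successive functions
  decrease. The argument gives the exponent \<open>2^m\<close> without the correction \<open>\<epsilon>\<close>.
\<close>
section \<open>Growth of the maximum modulus\<close>


text \<open>The obstacle is a conflict about radii: at its radius the new function \<open>g\<close>
  has to outgrow the coefficients, whose slopes are under control only below the radius of the
  preceding step. If these slopes are of order k^e, then the increment of \<open>ln M_g\<close> over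
  a bounded distance has to be of order k^e if \<open>g = F\<close>, and of a somewhat larger power
  if \<open>g = exp F\<close>. The slope of \<open>P\<close> is then k times as large. For e = 2^j,
  j > 0, both cases stay below k^(2^(j+1)), so each step doubles the exponent, and the doubled level
  has to be reached at a smaller radius than the preceding one. This is what the growth conditions
  provide. That h_j^2 is o(h_(j+1)) matches the squaring of the levels of h, and the constant 1/2
  matches the doubling of the levels of \<psi>, which are multiples of ln k. Between the last
  \<open>F\<close> and the first \<open>exp F\<close>, it is enough that h grows at most
  exponentially while the next \<psi> grows more than quadratically.\<close>

definition max_cball :: "(complex \<Rightarrow> complex) \<Rightarrow> real \<Rightarrow> real" where
  "max_cball f r = (SUP z\<in>cball 0 r. cmod (f z))"

lemma bdd_above_cmod_cball:
  fixes f :: "complex \<Rightarrow> complex"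
  assumes "continuous_on UNIV f"
  shows "bdd_above ((\<lambda>z. cmod (f z)) ` cball 0 r)"
proof -
  have "compact ((\<lambda>z. cmod (f z)) ` cball 0 r)"
    by (intro compact_continuous_image continuous_intros continuous_on_subset[OF assms]) auto
  then show ?thesis
    by (rule bounded_imp_bdd_above[OF compact_imp_bounded])
qed

lemma cmod_le_max_cball:
  assumes "continuous_on UNIV f" "cmod z \<le> r"
  shows "cmod (f z) \<le> max_cball f r"
  unfolding max_cball_def using assms by (intro cSUP_upper bdd_above_cmod_cball) auto

lemma max_cball_le:
  assumes "0 \<le> r" "\<And>z. cmod z \<le> r \<Longrightarrow> cmod (f z) \<le> B"
  shows "max_cball f r \<le> B"
  unfolding max_cball_def using assms by (intro cSUP_least) auto

lemma max_cball_attained: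
  assumes "continuous_on UNIV f" "0 \<le> r"
  obtains z where "cmod z \<le> r" "cmod (f z) = max_cball f r"
proof -
  have "\<exists>z\<in>cball 0 r. \<forall>y\<in>cball 0 r. cmod (f y) \<le> cmod (f z)"
    using assms by (intro continuous_attains_sup continuous_intros continuous_on_subset[OF assms(1)]) auto
  then obtain z where z: "cmod z \<le> r" "\<And>y. cmod y \<le> r \<Longrightarrow> cmod (f y) \<le> cmod (f z)" by auto
  have "cmod (f z) = max_cball f r"
    using z assms by (intro antisym cmod_le_max_cball max_cball_le)
  with z that show ?thesis by blast
qed

lemma max_cball_nonneg:
  assumes "continuous_on UNIV f" "0 \<le> r"
  shows "0 \<le> max_cball f r"
  using cmod_le_max_cball[OF assms(1), of 0 r] assms(2) norm_ge_zero[of "f 0"] by (simp del: norm_ge_zero)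

lemma max_cball_mono:
  assumes "continuous_on UNIV f" "0 \<le> r" "r \<le> s"
  shows "max_cball f r \<le> max_cball f s"
  using assms by (intro max_cball_le cmod_le_max_cball) auto

text \<open>By continuity a bound on the open disc extends to its closure. Closed discs are used
  throughout since the maximum is attained there and the Bernstein inequality is stated with
  them.\<close>

lemma max_modulus_eq_max_cball:
  assumes "continuous_on UNIV f" "r > 0"
  shows "max_modulus f r = max_cball f r"
proof (rule antisym)
  show "max_modulus f r \<le> max_cball f r"
    unfolding max_modulus_def using assms by (intro cSUP_least cmod_le_max_cball) auto
  have bdd: "bdd_above ((\<lambda>z. cmod (f z)) ` ball 0 r)"
    by (rule bdd_above_mono[OF bdd_above_cmod_cball[OF assms(1), of r]]) auto
  have *: "cmod (f z) \<le> max_modulus f r" if "z \<in> closure (ball 0 r)" for z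
  proof (rule continuous_le_on_closure[OF _ that])
    show "continuous_on (closure (ball 0 r)) (\<lambda>z. cmod (f z))"
      by (intro continuous_intros continuous_on_subset[OF assms(1)]) auto
    show "cmod (f z) \<le> max_modulus f r" if "z \<in> ball 0 r" for z
      unfolding max_modulus_def using that bdd by (intro cSUP_upper) auto
  qed
  show "max_cball f r \<le> max_modulus f r"
    using assms by (intro max_cball_le *) auto
qed

lemma max_modulus_sphere:
  assumes "f holomorphic_on UNIV" "R > 0" "\<And>z. cmod z = R \<Longrightarrow> cmod (f z) \<le> B" "cmod z \<le> R"
  shows "cmod (f z) \<le> B"
proof (rule maximum_modulus_frontier[of f "cball 0 R" B z])
  show "f holomorphic_on interior (cball 0 R)"
    using assms(1) holomorphic_on_subset by blast
  show "continuous_on (closure (cball 0 R)) f"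
    using assms(1) holomorphic_on_imp_continuous_on continuous_on_subset by blast
qed (use assms in auto)

text \<open>The quotient \<open>f^q / z^n\<close> is the single-valued q-th power of
  \<open>f / z^(n/q)\<close>.\<close>

lemma annulus_max_modulus:
  assumes f: "f holomorphic_on UNIV" and r: "0 < r1" "r1 \<le> cmod z" "cmod z \<le> r2"
    and B1: "\<And>z. cmod z = r1 \<Longrightarrow> cmod (f z) ^ q / r1 ^ n \<le> B"
    and B2: "\<And>z. cmod z = r2 \<Longrightarrow> cmod (f z) ^ q / r2 ^ n \<le> B"
  shows "cmod (f z) ^ q / cmod z ^ n \<le> B"
proof -
  define S where "S = cball (0::complex) r2 - ball 0 r1"
  have S0: "0 \<notin> S" using r by (auto simp: S_def)
  have hol: "(\<lambda>z. f z ^ q / z ^ n) holomorphic_on S"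
    using S0 by (intro holomorphic_intros holomorphic_on_subset[OF f]) auto
  have cl: "closed S" unfolding S_def by (intro closed_Diff) auto
  \<comment> \<open>The open annulus is interior to \<open>S\<close>, so the frontier is contained
    in the two circles.\<close>
  have "{z. r1 < cmod z} \<inter> ball 0 r2 \<subseteq> interior S"
    by (rule interior_maximal) (auto simp: S_def intro!: open_Int open_Collect_less continuous_intros)
  then have fr: "cmod z = r1 \<or> cmod z = r2" if "z \<in> frontier S" for z
    using that cl unfolding frontier_def by (force simp: S_def)
  have "norm (f z ^ q / z ^ n) \<le> B"
  proof (rule maximum_modulus_frontier[of "\<lambda>z. f z ^ q / z ^ n" S B z])
    show "(\<lambda>z. f z ^ q / z ^ n) holomorphic_on interior S"
      using hol holomorphic_on_subset interior_subset by blast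
    show "continuous_on (closure S) (\<lambda>z. f z ^ q / z ^ n)"
      using hol cl by (simp add: holomorphic_on_imp_continuous_on)
    show "bounded S" unfolding S_def by (rule bounded_subset[of "cball 0 r2"]) auto
    show "norm (f z ^ q / z ^ n) \<le> B" if "z \<in> frontier S" for z
      using fr[OF that] B1[of z] B2[of z] by (auto simp: norm_divide norm_power)
  qed (use r in \<open>auto simp: S_def\<close>)
  then show ?thesis by (simp add: norm_divide norm_power)
qed

text \<open>Hadamard's three circles theorem, in the form that the maximum modulus times
  \<open>exp (- \<beta> * t)\<close> has no interior peak. A rational \<beta> avoids branches of
  powers of z.\<close>

lemma three_circles_rational:
  assumes f: "f holomorphic_on UNIV" and t: "t1 \<le> t" "t \<le> t2" and q: "q > 0"
    and \<beta>: "\<beta> = real n / real q"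
  shows "max_cball f (exp t) * exp (- \<beta> * t) \<le>
         max (max_cball f (exp t1) * exp (- \<beta> * t1)) (max_cball f (exp t2) * exp (- \<beta> * t2))"
    (is "_ \<le> ?B")
proof -
  have cont: "continuous_on UNIV f" using f holomorphic_on_imp_continuous_on by blast
  have e: "exp x ^ n = exp (\<beta> * x) ^ q" for x
    using q by (simp add: \<beta> exp_of_nat_mult[symmetric] field_simps)
  have B0: "0 \<le> ?B" using max_cball_nonneg[OF cont, of "exp t1"] by (simp add: le_max_iff_disj)
  have main: "cmod (f z) \<le> ?B * exp (\<beta> * t)" if z: "cmod z = exp t" for z
  proof -
    have b: "cmod (f w) ^ q / exp x ^ n \<le> ?B ^ q" if "cmod w = exp x" "x = t1 \<or> x = t2" for w x
    proof -
      have "cmod (f w) \<le> max_cball f (exp x)" using that cont by (intro cmod_le_max_cball) auto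
      then have "cmod (f w) * exp (- \<beta> * x) \<le> ?B" using that
        by (metis (no_types, lifting) exp_ge_zero le_max_iff_disj mult_right_mono)
      then have "(cmod (f w) * exp (- \<beta> * x)) ^ q \<le> ?B ^ q" by (intro power_mono) auto
      then show ?thesis by (simp add: e power_mult_distrib exp_minus field_simps)
    qed
    have "cmod (f z) ^ q / cmod z ^ n \<le> ?B ^ q"
      by (rule annulus_max_modulus[OF f, of "exp t1" z "exp t2"]) (use t z b in auto)
    then have "(cmod (f z) * exp (- \<beta> * t)) ^ q \<le> ?B ^ q"
      by (simp add: z e power_mult_distrib exp_minus field_simps)
    then have "cmod (f z) * exp (- \<beta> * t) \<le> ?B" using B0 q by (simp add: power_mono_iff)
    then show ?thesis by (simp add: exp_minus field_simps)
  qed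
  have "max_cball f (exp t) \<le> ?B * exp (\<beta> * t)"
    by (intro max_cball_le max_modulus_sphere[OF f _ main]) auto
  then show ?thesis by (simp add: exp_minus field_simps)
qed

text \<open>Monotonicity of the slopes of the function \<open>t \<mapsto> ln (max_cball f (exp t))\<close>, which is convex
  by the three circles theorem.\<close>

lemma max_cball_growth_antimono:
  assumes f: "f holomorphic_on UNIV" and X: "0 \<le> X" and su: "s < u"
    and le: "max_cball f (exp u) \<le> exp (X * (u - s)) * max_cball f (exp s)"
    and t: "t \<le> t'" "t' \<le> s"
  shows "max_cball f (exp t') \<le> exp (X * (t' - t)) * max_cball f (exp t)"
proof (cases "t = t'")
  case False
  have cont: "continuous_on UNIV f" using f holomorphic_on_imp_continuous_on by blast
  define M where "M t = max_cball f (exp t)" for t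
  have M0: "0 \<le> M t" for t unfolding M_def by (intro max_cball_nonneg cont) auto
  have Mm: "t \<le> t' \<Longrightarrow> M t \<le> M t'" for t t' unfolding M_def by (intro max_cball_mono cont) auto
  show ?thesis
  proof (cases "M s = 0")
    case True
    then have "M t' = 0" using Mm[OF t(2)] M0[of t'] by simp
    then show ?thesis using M0[of t] by (simp add: M_def)
  next
    case False
    then have Ms: "M s > 0" using M0[of s] by simp
    \<comment> \<open>A slope above \<open>X\<close> makes the hypothesis strict and may be taken
      rational; it tends to \<open>X\<close> afterwards.\<close>
    have rat: "M t' \<le> exp (\<beta> * (t' - t)) * M t" if \<beta>: "\<beta> > X" "\<beta> \<in> \<rat>" for \<beta>
    proof -
      have "\<beta> > 0" using \<beta> X by simp
      then obtain n q where nq: "q \<noteq> 0" "\<beta> = real n / real q"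
        using Rats_abs_nat_div_natE[OF \<beta>(2)] by (metis abs_of_pos)
      define N where "N x = M x * exp (- \<beta> * x)" for x
      have quasi: "N b \<le> max (N a) (N c)" if "a \<le> b" "b \<le> c" for a b c
        unfolding N_def M_def using three_circles_rational[OF f that _ nq(2)] nq(1) by simp
      have "M u < exp (\<beta> * (u - s)) * M s"
      proof -
        have "exp (X * (u - s)) * M s < exp (\<beta> * (u - s)) * M s"
          using Ms \<beta> su by simp
        with le show ?thesis by (simp add: M_def)
      qed
      then have "N u < N s" by (simp add: N_def field_simps exp_minus exp_diff right_diff_distrib)
      \<comment> \<open>Since \<open>N u < N s\<close>, quasiconvexity on t' \<le> s \<le> u gives N
        s \<le> N t', so \<open>N u < N t'\<close>, and on t \<le> t' \<le> u it then gives N t'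
        \<le> N t.\<close>
      then have "N t' \<le> N t"
        using quasi[of t t' u] quasi[of t' s u] t su by auto
      then show ?thesis by (simp add: N_def field_simps exp_minus exp_diff right_diff_distrib)
    qed
    have "M t' \<le> exp (X * (t' - t)) * M t"
    proof (rule field_le_epsilon)
      fix e :: real assume e: "e > 0"
      have "isCont (\<lambda>\<beta>. exp (\<beta> * (t' - t)) * M t) X" by (intro continuous_intros)
      then obtain d where d: "d > 0"
        "\<And>\<beta>. \<bar>\<beta> - X\<bar> < d \<Longrightarrow> \<bar>exp (\<beta> * (t' - t)) * M t - exp (X * (t' - t)) * M t\<bar> < e"
        using e unfolding continuous_at_eps_delta dist_real_def by meson
      obtain \<beta> where \<beta>: "\<beta> \<in> \<rat>" "X < \<beta>" "\<beta> < X + d"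
        using Rats_dense_in_real[of X "X + d"] d(1) by auto
      show "M t' \<le> exp (X * (t' - t)) * M t + e"
        using rat[OF \<beta>(2,1)] d(2)[of \<beta>] \<beta> by auto
    qed
    then show ?thesis by (simp add: M_def)
  qed
qed simp

section \<open>Harnack's inequality and quotients of entire functions\<close>


text \<open>The Cayley transform \<phi> sends the right half-plane to the disc and
  \<open>u 0\<close> to 0, so the Schwarz lemma applies. This is the common source of Harnack's
  inequality and of Borel and Caratheodory.\<close>

lemma schwarz_half_plane:
  assumes u: "u holomorphic_on ball 0 1" and pos: "\<And>z. cmod z < 1 \<Longrightarrow> Re (u z) > 0" and z: "cmod z < 1"
  shows "cmod (u z - u 0) \<le> cmod z * cmod (u z + cnj (u 0))"
proof -
  define \<phi> where "\<phi> z = (u z - u 0) / (u z + cnj (u 0))" for z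
  have p0: "Re (u 0) > 0" using pos[of 0] by simp
  have nz: "u z + cnj (u 0) \<noteq> 0" if "cmod z < 1" for z
    using pos[OF that] p0 by (auto simp: complex_eq_iff)
  have "cmod (\<phi> z) \<le> cmod z"
  proof (rule Schwarz_Lemma(1))
    show "\<phi> holomorphic_on ball 0 1"
      unfolding \<phi>_def using nz by (intro holomorphic_intros u) auto
    show "cmod (\<phi> z) < 1" if "cmod z < 1" for z
    proof -
      have "(Re (u z) - Re (u 0))\<^sup>2 < (Re (u z) + Re (u 0))\<^sup>2"
        using mult_pos_pos[OF pos[OF that] p0] by (simp add: power2_eq_square algebra_simps)
      then have "(cmod (u z - u 0))\<^sup>2 < (cmod (u z + cnj (u 0)))\<^sup>2"
        by (simp add: cmod_power2)
      then have "cmod (u z - u 0) < cmod (u z + cnj (u 0))"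
        by (rule power_less_imp_less_base) auto
      then show ?thesis using nz[OF that] by (simp add: \<phi>_def norm_divide)
    qed
  qed (use z in \<open>auto simp: \<phi>_def\<close>)
  then show ?thesis using nz[OF z] by (simp add: \<phi>_def norm_divide field_simps)
qed

lemma harnack_strict:
  assumes u: "u holomorphic_on ball 0 1" and pos: "\<And>z. cmod z < 1 \<Longrightarrow> Re (u z) > 0" and z: "cmod z \<le> s" "s < 1"
  shows "\<bar>Re (u z) - Re (u 0)\<bar> \<le> s * (Re (u z) + Re (u 0))"
proof -
  have s0: "0 \<le> s" using z norm_ge_zero[of z] by linarith
  have p: "Re (u 0) > 0" "Re (u z) > 0" using pos[of 0] pos[of z] z by auto
  define x a y where "x = Re (u z)" and "a = Re (u 0)" and "y = Im (u z) - Im (u 0)"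
  have "cmod (u z - u 0) \<le> cmod z * cmod (u z + cnj (u 0))"
    using z by (intro schwarz_half_plane u pos) auto
  also have "\<dots> \<le> s * cmod (u z + cnj (u 0))" using z by (intro mult_right_mono) auto
  finally have "(cmod (u z - u 0))\<^sup>2 \<le> (s * cmod (u z + cnj (u 0)))\<^sup>2" by (intro power_mono) auto
  then have "(x - a)\<^sup>2 + y\<^sup>2 \<le> s\<^sup>2 * ((x + a)\<^sup>2 + y\<^sup>2)"
    by (simp add: cmod_power2 power_mult_distrib x_def a_def y_def)
  moreover have "s\<^sup>2 * y\<^sup>2 \<le> 1 * y\<^sup>2"
    using s0 z by (intro mult_right_mono) (auto simp: power_le_one)
  ultimately have "(x - a)\<^sup>2 \<le> (s * (x + a))\<^sup>2"
    unfolding power_mult_distrib distrib_left[of "s\<^sup>2"] by linarith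
  then have "\<bar>x - a\<bar> \<le> \<bar>s * (x + a)\<bar>" by (simp add: abs_le_square_iff)
  then show ?thesis using p s0 by (simp add: x_def a_def)
qed

text \<open>Both points are compared with the centre, hence the square. Adding e > 0 to
  \<open>u\<close> makes its real part strictly positive.\<close>

lemma harnack:
  assumes u: "u holomorphic_on ball 0 1" and nonneg: "\<And>z. cmod z < 1 \<Longrightarrow> Re (u z) \<ge> 0"
    and s: "s < 1" and z: "cmod z \<le> s" "cmod w \<le> s"
  shows "Re (u z) \<le> ((1 + s) / (1 - s))\<^sup>2 * Re (u w)"
proof -
  have s0: "0 \<le> s" using z norm_ge_zero[of z] by linarith
  let ?K = "((1 + s) / (1 - s))\<^sup>2"
  have K: "?K > 0" using s s0 by auto
  have *: "Re (u z) + e \<le> ?K * (Re (u w) + e)" if e: "e > 0" for e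
  proof -
    define v where "v z = u z + of_real e" for z
    have v: "v holomorphic_on ball 0 1" unfolding v_def by (intro holomorphic_intros u)
    have pos: "Re (v z) > 0" if "cmod z < 1" for z using nonneg[OF that] e by (simp add: v_def)
    have 1: "\<bar>Re (v z) - Re (v 0)\<bar> \<le> s * (Re (v z) + Re (v 0))"
      "\<bar>Re (v w) - Re (v 0)\<bar> \<le> s * (Re (v w) + Re (v 0))"
      using harnack_strict[OF v pos _ s] z by auto
    have "(1 - s) * Re (v z) \<le> (1 + s) * Re (v 0)" "(1 - s) * Re (v 0) \<le> (1 + s) * Re (v w)"
      using 1 by (auto simp: abs_le_iff algebra_simps)
    then have "Re (v z) \<le> (1 + s) / (1 - s) * Re (v 0)" "Re (v 0) \<le> (1 + s) / (1 - s) * Re (v w)"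
      using s by (auto simp: field_simps)
    moreover have "(1 + s) / (1 - s) * Re (v 0) \<le> (1 + s) / (1 - s) * ((1 + s) / (1 - s) * Re (v w))"
      using calculation(2) s s0 by (intro mult_left_mono) auto
    ultimately have "Re (v z) \<le> (1 + s) / (1 - s) * ((1 + s) / (1 - s) * Re (v w))" by linarith
    then show ?thesis by (simp add: v_def power2_eq_square mult.assoc)
  qed
  show ?thesis
  proof (rule field_le_epsilon)
    fix e :: real assume e: "e > 0"
    have "Re (u z) + e / ?K \<le> ?K * (Re (u w) + e / ?K)" using e K by (intro *) auto
    moreover have "?K * (Re (u w) + e / ?K) = ?K * Re (u w) + e"
      using K by (metis distrib_left less_irrefl nonzero_mult_div_cancel_left times_divide_eq_right)
    moreover have "e / ?K > 0" using e K by simp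
    ultimately show "Re (u z) \<le> ?K * Re (u w) + e" by linarith
  qed
qed

text \<open>In \<open>schwarz_half_plane\<close> for the rescaled \<open>A + d - f\<close>, the
  right side contains the left one again with a factor s < 1, so the inequality can be solved for
  it.\<close>

lemma borel_caratheodory:
  assumes f: "f holomorphic_on UNIV" and R: "0 < r" "r < R" and A: "\<And>z. cmod z < R \<Longrightarrow> Re (f z) \<le> A"
    and z: "cmod z \<le> r"
  shows "cmod (f z - f 0) \<le> 2 * r / (R - r) * (A - Re (f 0))"
proof (rule field_le_epsilon)
  fix e :: real assume e: "e > 0"
  \<comment> \<open>Chosen so that \<open>d\<close> contributes exactly \<open>e\<close> to the
    final bound.\<close>
  define d where "d = e * (R - r) / (2 * r)"
  have d: "d > 0" using e R by (simp add: d_def)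
  define u where "u z = of_real (A + d) - f (of_real R * z)" for z
  define s where "s = r / R"
  have s: "0 < s" "s < 1" using R by (auto simp: s_def)
  have hol: "(\<lambda>z. f (of_real R * z)) holomorphic_on ball 0 1"
    by (rule holomorphic_on_compose_gen[OF _ f, unfolded o_def]) (auto intro!: holomorphic_intros)
  have u: "u holomorphic_on ball 0 1" unfolding u_def by (intro holomorphic_intros hol)
  have pos: "Re (u z) > 0" if "cmod z < 1" for z
    using A[of "of_real R * z"] that R d by (simp add: u_def norm_mult)
  define w where "w = z / of_real R"
  have w: "cmod w \<le> s" "of_real R * w = z"
    using z R by (auto simp: w_def s_def norm_divide field_simps)
  have "cmod (u w - u 0) \<le> cmod w * cmod (u w + cnj (u 0))"
    using w s by (intro schwarz_half_plane u pos) auto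
  also have "\<dots> \<le> s * (cmod (u w - u 0) + cmod (of_real (2 * Re (u 0))))"
  proof (intro mult_mono w)
    have "u w + cnj (u 0) = (u w - u 0) + of_real (2 * Re (u 0))"
      by (simp add: complex_eq_iff)
    then show "cmod (u w + cnj (u 0)) \<le> cmod (u w - u 0) + cmod (of_real (2 * Re (u 0)))"
      by (metis norm_triangle_ineq)
  qed (use s in auto)
  also have "cmod (of_real (2 * Re (u 0))) = 2 * Re (u 0)"
    using pos[of 0] by (simp only: norm_of_real) simp
  finally have "(1 - s) * cmod (u w - u 0) \<le> s * (2 * Re (u 0))"
    by (simp add: algebra_simps)
  then have "cmod (u w - u 0) \<le> s / (1 - s) * (2 * Re (u 0))"
    using s by (simp add: field_simps)
  also have "s / (1 - s) = r / (R - r)" using R by (simp add: s_def field_simps)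
  also have "cmod (u w - u 0) = cmod (f z - f 0)"
    using w(2) by (simp add: u_def norm_minus_commute)
  also have "Re (u 0) = A + d - Re (f 0)" by (simp add: u_def)
  also have "r / (R - r) * (2 * (A + d - Re (f 0))) = 2 * r / (R - r) * (A - Re (f 0)) + e"
    using R by (simp add: d_def field_simps)
  finally show "cmod (f z - f 0) \<le> 2 * r / (R - r) * (A - Re (f 0)) + e" .
qed

text \<open>Hence the Blaschke factor \<open>(z - a) / (1 - cnj a * z)\<close> has modulus 1 on the
  unit circle, and inside it stays below 1 by an explicit amount.\<close>

lemma blaschke_factor_identity:
  "(cmod (1 - cnj a * z))\<^sup>2 - (cmod (z - a))\<^sup>2 = (1 - (cmod a)\<^sup>2) * (1 - (cmod z)\<^sup>2)"
  unfolding cmod_power2 by (simp add: power2_eq_square algebra_simps)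

text \<open>The zero of \<phi> cancels the only pole, so the quotient is again entire and the
  division can be iterated. The product form covers \<open>z = a\<close> as well.\<close>

lemma divide_blaschke_factor:
  assumes \<phi>: "\<phi> holomorphic_on UNIV" and a: "\<phi> a = 0"
  obtains \<phi>' where "\<phi>' holomorphic_on UNIV" "\<And>z. \<phi>' z * (z - a) = \<phi> z * (1 - cnj a * z)"
proof -
  define g where "g z = (if z = a then deriv \<phi> a else (\<phi> z - \<phi> a) / (z - a))" for z
  have g: "g holomorphic_on UNIV" unfolding g_def using \<phi> by (intro pole_lemma_open) auto
  show ?thesis
  proof (rule that[of "\<lambda>z. g z * (1 - cnj a * z)"])
    show "(\<lambda>z. g z * (1 - cnj a * z)) holomorphic_on UNIV" by (intro holomorphic_intros g)
    show "g z * (1 - cnj a * z) * (z - a) = \<phi> z * (1 - cnj a * z)" for z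
      using a by (simp add: g_def)
  qed
qed

text \<open>The function \<open>- ln \<bar>\<phi>\<bar>\<close> is a positive superharmonic majorant of \<open>ln \<bar>F\<bar>\<close>, so that Harnack's
  inequality applies once the zeros of \<open>\<phi>\<close> are divided out. Every division by a Blaschke factor
  increases \<open>\<bar>\<phi> z0\<bar>\<close> by a fixed factor, and so there are finitely many of them.\<close>

lemma quotient_growth_bound:
  fixes r :: real
  assumes r: "0 < r" "r < 1"
  obtains c where "c > 0" "\<And>\<phi> F Y z0 z1. \<phi> holomorphic_on UNIV \<Longrightarrow> F holomorphic_on UNIV \<Longrightarrow>
     (\<And>z. cmod z \<le> 1 \<Longrightarrow> cmod (\<phi> z) \<le> Y) \<Longrightarrow> (\<And>z. cmod z \<le> 1 \<Longrightarrow> cmod (F z * \<phi> z) \<le> Y) \<Longrightarrow>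
     cmod z0 \<le> r \<Longrightarrow> cmod z1 \<le> r \<Longrightarrow> cmod (F z1) \<ge> 1 \<Longrightarrow>
     cmod (\<phi> z0) * cmod (F z1) powr c \<le> Y"
proof -
  \<comment> \<open>Zeros are removed from a disc larger than that of radius \<open>r\<close>, so
    that Harnack's inequality on it applies at relative distance s < 1 from the centre.\<close>
  define r' where "r' = (1 + r) / 2"
  have r': "r < r'" "0 < r'" "r' < 1" using r by (auto simp: r'_def)
  define s where "s = r / r'"
  have s: "0 < s" "s < 1" using r r' by (auto simp: s_def)
  define c where "c = 1 / ((1 + s) / (1 - s))\<^sup>2"
  have c: "c > 0" using s by (auto simp: c_def)
  \<comment> \<open>By \<open>blaschke_factor_identity\<close>, a bound on this disc for all
    Blaschke factors with zero in it; the 4 bounds the square of their denominators.\<close>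
  define q where "q = sqrt (1 - (1 - r'\<^sup>2)\<^sup>2 / 4)"
  have r'2: "0 < 1 - r'\<^sup>2" "1 - r'\<^sup>2 \<le> 1" using r' by (auto simp: power_less_one_iff)
  have r'4: "0 < (1 - r'\<^sup>2)\<^sup>2" "(1 - r'\<^sup>2)\<^sup>2 \<le> 1" using r'2 by (auto simp: power_le_one)
  have q: "0 < q" "q < 1" using r'4 by (auto simp: q_def)
  have q2: "q\<^sup>2 = 1 - (1 - r'\<^sup>2)\<^sup>2 / 4" using r'4 by (simp add: q_def)
  have bl: "cmod (z - a) \<le> q * cmod (1 - cnj a * z)" if "cmod z \<le> r'" "cmod a \<le> r'" for z a
  proof -
    have za: "(cmod z)\<^sup>2 \<le> r'\<^sup>2" "(cmod a)\<^sup>2 \<le> r'\<^sup>2" using that by (auto intro: power_mono)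
    have "cmod (1 - cnj a * z) \<le> 1 + cmod a * cmod z"
      using norm_triangle_ineq4[of 1 "cnj a * z"] by (simp add: norm_mult)
    also have "cmod a * cmod z \<le> 1 * 1" using that r' by (intro mult_mono) auto
    finally have "(cmod (1 - cnj a * z))\<^sup>2 \<le> 2\<^sup>2" by (intro power_mono) auto
    then have "(cmod (1 - cnj a * z))\<^sup>2 * ((1 - r'\<^sup>2)\<^sup>2 / 4) \<le> 4 * ((1 - r'\<^sup>2)\<^sup>2 / 4)"
      by (intro mult_right_mono) auto
    also have "\<dots> = (1 - r'\<^sup>2) * (1 - r'\<^sup>2)" by (simp add: power2_eq_square)
    also have "\<dots> \<le> (1 - (cmod a)\<^sup>2) * (1 - (cmod z)\<^sup>2)"
      using za r'2 by (intro mult_mono) auto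
    also have "\<dots> = (cmod (1 - cnj a * z))\<^sup>2 - (cmod (z - a))\<^sup>2" by (rule blaschke_factor_identity[symmetric])
    finally have "(cmod (z - a))\<^sup>2 \<le> (q * cmod (1 - cnj a * z))\<^sup>2"
      by (simp add: power_mult_distrib q2 algebra_simps)
    then show ?thesis by (rule power2_le_imp_le) (use q in simp)
  qed
  \<comment> \<open>The last premise counts the divisions: each one multiplies the modulus of
    \<open>\<phi> z0\<close> by at least \<open>1 / q\<close> while the bound \<open>Y\<close>
    persists, and for \<open>n = 0\<close> the premise contradicts that bound.\<close>
  have main: "cmod (\<phi> z0) * cmod (F z1) powr c \<le> Y"
    if "\<phi> holomorphic_on UNIV" "F holomorphic_on UNIV" "\<And>z. cmod z \<le> 1 \<Longrightarrow> cmod (\<phi> z) \<le> Y"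
      "\<And>z. cmod z \<le> 1 \<Longrightarrow> cmod (F z * \<phi> z) \<le> Y" "cmod z0 \<le> r" "cmod z1 \<le> r" "cmod (F z1) \<ge> 1"
      "Y < cmod (\<phi> z0) * (1 / q) ^ n" for \<phi> F Y z0 z1 n
    using that
  proof (induction n arbitrary: \<phi>)
    case 0
    have "cmod (\<phi> z0) \<le> Y" using "0.prems"(5) r by (intro "0.prems"(3)) simp
    moreover have "Y < cmod (\<phi> z0)" using "0.prems"(8) by simp
    ultimately show ?case by simp
  next
    case (Suc n)
    note hyps = Suc.prems
    have Y0: "0 \<le> Y" using hyps(3)[of 0] norm_ge_zero[of "\<phi> 0"] by (simp del: norm_ge_zero)
    show ?case
    proof (cases "\<exists>a. cmod a < r' \<and> \<phi> a = 0")
      case True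
      then obtain a where a: "cmod a < r'" "\<phi> a = 0" by blast
      show ?thesis
      proof (cases "z0 = a")
        case True
        then show ?thesis using a Y0 by simp
      next
        case False
        obtain \<phi>' where \<phi>': "\<phi>' holomorphic_on UNIV" "\<And>z. \<phi>' z * (z - a) = \<phi> z * (1 - cnj a * z)"
          using divide_blaschke_factor[OF hyps(1) a(2)] by blast
        have eq: "cmod (\<phi>' z) * cmod (z - a) = cmod (\<phi> z) * cmod (1 - cnj a * z)" for z
          using \<phi>'(2)[of z] by (metis norm_mult)
        \<comment> \<open>Division does not change moduli on the unit circle, from where the maximum
          principle carries both bounds by \<open>Y\<close> inside.\<close>
        have on_circle: "cmod (\<phi>' z) = cmod (\<phi> z)" if "cmod z = 1" for z
        proof -
          have "(cmod (1 - cnj a * z))\<^sup>2 = (cmod (z - a))\<^sup>2"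
            using blaschke_factor_identity[of a z] that by simp
          then have "cmod (1 - cnj a * z) = cmod (z - a)" by simp
          moreover have "z \<noteq> a" using that a r' by auto
          ultimately show ?thesis using eq[of z] by simp
        qed
        have b1: "cmod (\<phi>' z) \<le> Y" if "cmod z \<le> 1" for z
        proof (rule max_modulus_sphere[OF \<phi>'(1), of 1])
          show "cmod (\<phi>' w) \<le> Y" if "cmod w = 1" for w
            unfolding on_circle[OF that] using that by (intro hyps(3)) simp
        qed (use that in auto)
        have b2: "cmod (F z * \<phi>' z) \<le> Y" if "cmod z \<le> 1" for z
        proof (rule max_modulus_sphere[of "\<lambda>z. F z * \<phi>' z" 1])
          show "cmod (F w * \<phi>' w) \<le> Y" if "cmod w = 1" for w
            using hyps(4)[of w] on_circle[OF that] that by (simp add: norm_mult)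
        qed (use that hyps(2) \<phi>'(1) in \<open>auto intro!: holomorphic_intros\<close>)
        have "cmod (\<phi>' z0) * cmod (z0 - a) \<le> cmod (\<phi>' z0) * (q * cmod (1 - cnj a * z0))"
          using bl[of z0 a] a hyps(5) r' by (intro mult_left_mono) auto
        then have "cmod (\<phi> z0) * cmod (1 - cnj a * z0) \<le> (cmod (\<phi>' z0) * q) * cmod (1 - cnj a * z0)"
          by (simp add: eq mult_ac)
        moreover have "cmod (1 - cnj a * z0) > 0"
        proof -
          have "cmod (cnj a * z0) < 1 * 1" unfolding norm_mult
            using a hyps(5) r r' by (intro mult_strict_mono) auto
          then show ?thesis by auto
        qed
        ultimately have up: "cmod (\<phi> z0) \<le> cmod (\<phi>' z0) * q" by (metis mult_le_cancel_right not_less)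
        also have "\<dots> \<le> cmod (\<phi>' z0)" using q by (simp add: mult_left_le)
        finally have up': "cmod (\<phi> z0) \<le> cmod (\<phi>' z0)" .
        have "Y < cmod (\<phi>' z0) * q * (1 / q) ^ Suc n"
          by (rule less_le_trans[OF hyps(8)]) (use up q in \<open>intro mult_right_mono; simp\<close>)
        also have "\<dots> = cmod (\<phi>' z0) * (1 / q) ^ n" using q by simp
        finally have "cmod (\<phi>' z0) * cmod (F z1) powr c \<le> Y"
          using hyps by (intro Suc.IH \<phi>'(1) b1 b2) auto
        then show ?thesis using up' by (meson dual_order.trans mult_right_mono powr_ge_zero)
      qed
    next
      case False
      then have nz: "\<phi> z \<noteq> 0" if "cmod z < r'" for z using that by blast
      have Y: "Y > 0" using hyps(3)[of 0] nz[of 0] r' by (smt (verit) norm_zero zero_less_norm_iff)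
      \<comment> \<open>Without zeros, the negative logarithm of the modulus of \<phi>/Y is the real
        part of a holomorphic \<open>- u\<close>, and it is nonnegative. Harnack bounds its value at
        \<open>z1\<close> by \<open>1 / c\<close> times that at \<open>z0\<close>, and the bound on
        \<open>F * \<phi>\<close> makes the former a majorant of
        \<open>ln (cmod (F z1))\<close>.\<close>
      define \<psi> where "\<psi> z = \<phi> (of_real r' * z) / of_real Y" for z
      have inr: "cmod (of_real r' * z) < r'" if "cmod z < 1" for z using that r' by (simp add: norm_mult)
      have \<psi>h: "\<psi> holomorphic_on ball 0 1"
        unfolding \<psi>_def using Y
        by (intro holomorphic_intros holomorphic_on_compose_gen[OF _ hyps(1), unfolded o_def]) auto
      obtain u where u: "u holomorphic_on ball 0 1" "\<And>z. z \<in> ball 0 1 \<Longrightarrow> exp (u z) = \<psi> z"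
      proof (rule holomorphic_logarithm_exists[of "ball 0 1" \<psi> 0])
        show "\<psi> z \<noteq> 0" if "z \<in> ball 0 1" for z
          using nz[OF inr[of z]] that Y by (simp add: \<psi>_def)
      qed (use \<psi>h that in auto)
      have cu: "exp (Re (u z)) = cmod (\<psi> z)" if "cmod z < 1" for z
        using u(2)[of z] that by (simp add: norm_exp_eq_Re[symmetric])
      have nn: "Re (- u z) \<ge> 0" if "cmod z < 1" for z
      proof -
        have "cmod (\<psi> z) \<le> 1"
          using hyps(3)[of "of_real r' * z"] inr[OF that] r' Y by (simp add: \<psi>_def norm_divide)
        then show ?thesis using cu[OF that] by (metis exp_le_one_iff minus_complex.simps(1) neg_0_le_iff_le uminus_complex.simps(1))
      qed
      define w0 w1 where "w0 = z0 / of_real r'" and "w1 = z1 / of_real r'"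
      have w: "cmod w0 \<le> s" "cmod w1 \<le> s" using hyps(5,6) r' by (auto simp: w0_def w1_def s_def norm_divide divide_right_mono)
      then have w': "cmod w0 < 1" "cmod w1 < 1" using s by auto
      have \<psi>w: "cmod (\<psi> w0) = cmod (\<phi> z0) / Y" "cmod (\<psi> w1) = cmod (\<phi> z1) / Y"
        using r' Y by (auto simp: \<psi>_def w0_def w1_def norm_divide)
      have "Re (- u w1) \<le> ((1 + s) / (1 - s))\<^sup>2 * Re (- u w0)"
        by (rule harnack[of "\<lambda>z. - u z"]) (use u(1) nn s w in \<open>auto intro!: holomorphic_intros\<close>)
      then have "c * Re (- u w1) \<le> c * (((1 + s) / (1 - s))\<^sup>2 * Re (- u w0))"
        using c by (intro mult_left_mono) auto
      also have "\<dots> = Re (- u w0)" using s by (simp add: c_def)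
      finally have har: "Re (u w0) \<le> c * Re (u w1)" by simp
      have "cmod (F z1) * cmod (\<phi> z1) \<le> Y" using hyps(4)[of z1] hyps(6) r by (simp add: norm_mult)
      then have "cmod (F z1) * exp (Re (u w1)) \<le> 1" using Y by (simp add: cu w' \<psi>w field_simps)
      then have "ln (cmod (F z1) * exp (Re (u w1))) \<le> 0" using hyps(7)
        by (metis ln_le_zero_iff exp_gt_zero less_le_trans mult_pos_pos zero_less_one)
      moreover have "cmod (F z1) > 0" using hyps(7) by linarith
      ultimately have lnF: "ln (cmod (F z1)) + Re (u w1) \<le> 0" by (simp add: ln_mult)
      have "cmod (\<phi> z0) / Y * cmod (F z1) powr c = exp (Re (u w0)) * exp (c * ln (cmod (F z1)))"
        using \<open>cmod (F z1) > 0\<close> by (subst cu) (auto simp: \<psi>w w' powr_def)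
      also have "\<dots> = exp (Re (u w0) + c * ln (cmod (F z1)))" by (simp add: exp_add)
      also have "\<dots> \<le> exp (c * (ln (cmod (F z1)) + Re (u w1)))" using har by (simp add: algebra_simps)
      also have "\<dots> \<le> 1" using lnF c by (simp add: mult_nonneg_nonpos)
      finally show ?thesis using Y by (simp add: field_simps)
    qed
  qed
  show ?thesis
  proof (rule that[OF c])
    fix \<phi> F :: "complex \<Rightarrow> complex" and Y z0 z1
    assume hyps: "\<phi> holomorphic_on UNIV" "F holomorphic_on UNIV" "\<And>z. cmod z \<le> 1 \<Longrightarrow> cmod (\<phi> z) \<le> Y"
      "\<And>z. cmod z \<le> 1 \<Longrightarrow> cmod (F z * \<phi> z) \<le> Y" "cmod z0 \<le> r" "cmod z1 \<le> r" "cmod (F z1) \<ge> 1"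
    have Y0: "0 \<le> Y" using hyps(3)[of 0] norm_ge_zero[of "\<phi> 0"] by (simp del: norm_ge_zero)
    show "cmod (\<phi> z0) * cmod (F z1) powr c \<le> Y"
    proof (cases "\<phi> z0 = 0")
      case False
      then obtain n where "Y / cmod (\<phi> z0) < (1 / q) ^ n"
        using q real_arch_pow[of "1 / q" "Y / cmod (\<phi> z0)"] by auto
      then have "Y < cmod (\<phi> z0) * (1 / q) ^ n" using False by (simp add: field_simps)
      then show ?thesis using main[OF hyps] by blast
    qed (use Y0 in simp)
  qed
qed

section \<open>Polynomials on the graph of an entire function\<close>


text \<open>Polynomials in \<open>w\<close> that vanish at \<open>w = F z\<close> are the products \<open>(w - F z) * Q\<close>. Below, the
  \<open>G\<^sub>i\<close> are the coefficients of \<open>\<Sum>\<^sub>i b\<^sub>i w\<^sup>i - P\<close>, and the \<open>Q\<^sub>j\<close> those of its quotient by \<open>w - F z\<close>,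
  which has to be very small at \<open>z0\<close> by the previous lemma if \<open>F\<close> grows fast.\<close>

lemma graph_restriction_normalized:
  fixes r r0 :: real
  assumes r: "0 < r" "r < 1" and r0: "r0 \<le> r"
  obtains c where "c > 0" "\<And>b F k A B N d z0 z1 i0.
     F holomorphic_on UNIV \<Longrightarrow> (\<And>i. i \<le> k \<Longrightarrow> b i holomorphic_on UNIV) \<Longrightarrow>
     (\<And>z. cmod z \<le> r0 \<Longrightarrow> cmod (F z) \<le> 1) \<Longrightarrow> cmod z1 \<le> r \<Longrightarrow> cmod (F z1) = exp N \<Longrightarrow> N \<ge> 0 \<Longrightarrow>
     (\<And>i z. i \<le> k \<Longrightarrow> cmod z \<le> 1 \<Longrightarrow> cmod (b i z) \<le> exp d * A) \<Longrightarrow>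
     i0 \<le> k \<Longrightarrow> cmod z0 \<le> r0 \<Longrightarrow> cmod (b i0 z0) = A \<Longrightarrow>
     (\<And>z. cmod z \<le> 1 \<Longrightarrow> cmod (\<Sum>i\<le>k. b i z * F z ^ i) \<le> B) \<Longrightarrow>
     0 \<le> d \<Longrightarrow> c * N > d + ln (8 * (real k + 1)) \<Longrightarrow> A \<le> 2 * B"
proof -
  obtain c where c: "c > 0" and qg: "\<And>\<phi> F Y z0 z1. \<phi> holomorphic_on UNIV \<Longrightarrow> F holomorphic_on UNIV \<Longrightarrow>
     (\<And>z. cmod z \<le> 1 \<Longrightarrow> cmod (\<phi> z) \<le> Y) \<Longrightarrow> (\<And>z. cmod z \<le> 1 \<Longrightarrow> cmod (F z * \<phi> z) \<le> Y) \<Longrightarrow>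
     cmod z0 \<le> r \<Longrightarrow> cmod z1 \<le> r \<Longrightarrow> cmod (F z1) \<ge> 1 \<Longrightarrow>
     cmod (\<phi> z0) * cmod (F z1) powr c \<le> Y"
    using quotient_growth_bound[OF r] by metis
  show ?thesis
  proof (rule that[OF c])
    fix b :: "nat \<Rightarrow> complex \<Rightarrow> complex" and F k A B N and d :: real and z0 z1 i0
    assume F: "F holomorphic_on UNIV" and b: "\<And>i. i \<le> k \<Longrightarrow> b i holomorphic_on UNIV"
      and F1: "\<And>z. cmod z \<le> r0 \<Longrightarrow> cmod (F z) \<le> 1"
      and z1: "cmod z1 \<le> r" "cmod (F z1) = exp N" "N \<ge> 0"
      and bE: "\<And>i z. i \<le> k \<Longrightarrow> cmod z \<le> 1 \<Longrightarrow> cmod (b i z) \<le> exp d * A"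
      and z0: "i0 \<le> k" "cmod z0 \<le> r0" "cmod (b i0 z0) = A"
      and PB: "\<And>z. cmod z \<le> 1 \<Longrightarrow> cmod (\<Sum>i\<le>k. b i z * F z ^ i) \<le> B"
      and d: "0 \<le> d" and cN: "c * N > d + ln (8 * (real k + 1))"
    show "A \<le> 2 * B"
    proof (rule ccontr)
      assume "\<not> A \<le> 2 * B"
      then have AB: "2 * B < A" by simp
      have B0: "B \<ge> 0" by (rule order_trans[OF norm_ge_zero PB[of 0]]) simp
      then have A0: "A > 0" using AB by simp
      define Q where "Q j z = (\<Sum>i\<in>{Suc j..k}. b i z * F z ^ (i - Suc j))" for j z
      define P where "P z = (\<Sum>i\<le>k. b i z * F z ^ i)" for z
      have Qh: "Q j holomorphic_on UNIV" for j
        unfolding Q_def using b F by (intro holomorphic_intros) auto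
      have split: "P z = (\<Sum>i\<le>j. b i z * F z ^ i) + F z ^ Suc j * Q j z" if "j \<le> k" for j z
      proof -
        have "{..k} = {..j} \<union> {Suc j..k}" using that by auto
        then have "P z = (\<Sum>i\<le>j. b i z * F z ^ i) + (\<Sum>i\<in>{Suc j..k}. b i z * F z ^ i)"
          unfolding P_def by (simp only:) (rule sum.union_disjoint; auto)
        also have "(\<Sum>i\<in>{Suc j..k}. b i z * F z ^ i) = F z ^ Suc j * Q j z"
          unfolding Q_def sum_distrib_left
          by (rule sum.cong) (auto simp flip: power_add power_Suc)
        finally show ?thesis .
      qed
      define Y where "Y = 2 * (real k + 1) * (exp d * A)"
      have E: "A \<le> exp d * A" using A0 d by simp
      \<comment> \<open>Where \<open>F\<close> has modulus at most 1, the defining sum is bounded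
        term by term. Elsewhere \<open>split\<close> expresses \<open>Q j\<close> by
        \<open>P\<close> and the lower terms, divided by \<open>F ^ Suc j\<close>.\<close>
      have Y1: "cmod (Q j z) \<le> Y \<and> cmod (F z * Q j z) \<le> Y" if j: "j \<le> k" and z: "cmod z \<le> 1" for j z
      proof (cases "cmod (F z) \<le> 1")
        case True
        have "cmod (Q j z) \<le> (\<Sum>i\<in>{Suc j..k}. exp d * A)"
          unfolding Q_def
        proof (rule sum_norm_le)
          fix i assume i: "i \<in> {Suc j..k}"
          have "cmod (b i z) * cmod (F z) ^ (i - Suc j) \<le> (exp d * A) * 1"
            using i True bE[of i z] z A0 by (intro mult_mono) (auto simp: power_le_one)
          then show "cmod (b i z * F z ^ (i - Suc j)) \<le> exp d * A" by (simp add: norm_mult norm_power)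
        qed
        also have "\<dots> = real (k - j) * (exp d * A)" by simp
        also have "\<dots> \<le> Y"
          unfolding Y_def using A0 by (intro mult_right_mono) auto
        finally have 1: "cmod (Q j z) \<le> Y" .
        have "cmod (F z * Q j z) \<le> 1 * cmod (Q j z)"
          unfolding norm_mult using True by (intro mult_right_mono) auto
        with 1 show ?thesis by simp
      next
        case False
        then have F1: "cmod (F z) > 1" by simp
        have "cmod (F z) ^ Suc j * cmod (Q j z) = cmod (P z - (\<Sum>i\<le>j. b i z * F z ^ i))"
          by (simp only: split[OF j]) (simp add: norm_mult norm_power)
        also have "\<dots> \<le> cmod (P z) + (\<Sum>i\<le>j. cmod (b i z * F z ^ i))"
          by (rule order_trans[OF norm_triangle_ineq4]) (intro add_mono norm_sum order_refl)
        also have "\<dots> \<le> B * cmod (F z) ^ j + (\<Sum>i\<le>j. (exp d * A) * cmod (F z) ^ j)"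
        proof (intro add_mono sum_mono)
          have "cmod (P z) * 1 \<le> B * cmod (F z) ^ j"
            using PB[OF z] F1 B0 unfolding P_def[symmetric] by (intro mult_mono) auto
          then show "cmod (P z) \<le> B * cmod (F z) ^ j" by simp
          fix i assume "i \<in> {..j}"
          then show "cmod (b i z * F z ^ i) \<le> (exp d * A) * cmod (F z) ^ j"
            unfolding norm_mult norm_power using bE[of i z] j z A0 F1
            by (intro mult_mono power_increasing) auto
        qed
        also have "\<dots> = (B + (real j + 1) * (exp d * A)) * cmod (F z) ^ j"
          by (simp add: algebra_simps)
        finally have "cmod (F z) * cmod (Q j z) \<le> B + (real j + 1) * (exp d * A)"
        proof -
          assume "cmod (F z) ^ Suc j * cmod (Q j z) \<le> (B + (real j + 1) * (exp d * A)) * cmod (F z) ^ j"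
          then have "(cmod (F z) * cmod (Q j z)) * cmod (F z) ^ j \<le> (B + (real j + 1) * (exp d * A)) * cmod (F z) ^ j"
            by (simp add: mult_ac)
          moreover have "cmod (F z) ^ j > 0" using F1 by (intro zero_less_power) linarith
          ultimately show ?thesis by (metis mult_le_cancel_right not_less)
        qed
        also have "\<dots> \<le> (real k + 1) * (exp d * A) + (real k + 1) * (exp d * A)"
        proof (intro add_mono mult_right_mono)
          have "B \<le> 1 * (exp d * A)" using AB B0 E by linarith
          also have "\<dots> \<le> (real k + 1) * (exp d * A)" using A0 by (intro mult_right_mono) auto
          finally show "B \<le> (real k + 1) * (exp d * A)" .
        qed (use j A0 in auto)
        also have "\<dots> = Y" by (simp add: Y_def)
        finally have 2: "cmod (F z * Q j z) \<le> Y" by (simp add: norm_mult)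
        moreover have "1 * cmod (Q j z) \<le> cmod (F z) * cmod (Q j z)"
          using F1 by (intro mult_right_mono) auto
        ultimately show ?thesis by (simp add: norm_mult)
      qed
      \<comment> \<open>The coefficient \<open>b i0\<close> equals
        \<open>Q (i0 - 1) - F * Q i0\<close>, and \<open>F z0\<close> has modulus at most 1, so one
        of the two terms has at least half its size. For \<open>i0 = 0\<close> the part of the first
        term is played by \<open>P\<close>, which is smaller than \<open>A / 2\<close>.\<close>
      have "\<exists>j\<le>k. cmod (Q j z0) \<ge> A / 2"
      proof (cases i0)
        case 0
        have "A = cmod (P z0 - F z0 * Q 0 z0)" using split[of 0 z0] z0(3) 0 by simp
        also have "\<dots> \<le> cmod (P z0) + cmod (F z0) * cmod (Q 0 z0)"
          by (metis norm_mult norm_triangle_ineq4)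
        also have "\<dots> \<le> B + 1 * cmod (Q 0 z0)"
          using z0(2) r r0 F1[of z0] by (intro add_mono mult_right_mono PB[folded P_def]) auto
        finally show ?thesis using AB by (intro exI[of _ 0]) auto
      next
        case (Suc j)
        have "Q j z0 = b i0 z0 + F z0 * Q i0 z0"
        proof -
          have "{Suc j..k} = insert i0 {Suc i0..k}" using z0(1) Suc by auto
          then have "Q j z0 = b i0 z0 + (\<Sum>i\<in>{Suc i0..k}. b i z0 * F z0 ^ (i - Suc j))"
            unfolding Q_def by (simp add: Suc)
          also have "(\<Sum>i\<in>{Suc i0..k}. b i z0 * F z0 ^ (i - Suc j)) = F z0 * Q i0 z0"
            unfolding Q_def sum_distrib_left
          proof (rule sum.cong)
            fix i assume "i \<in> {Suc i0..k}"
            then have "i - Suc j = Suc (i - Suc i0)" using Suc by auto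
            then show "b i z0 * F z0 ^ (i - Suc j) = F z0 * (b i z0 * F z0 ^ (i - Suc i0))" by simp
          qed simp
          finally show ?thesis .
        qed
        then have "A = cmod (Q j z0 - F z0 * Q i0 z0)" using z0(3) by simp
        also have "\<dots> \<le> cmod (Q j z0) + cmod (F z0) * cmod (Q i0 z0)"
          by (metis norm_mult norm_triangle_ineq4)
        also have "cmod (F z0) * cmod (Q i0 z0) \<le> 1 * cmod (Q i0 z0)"
          using z0(2) F1[of z0] by (intro mult_right_mono) auto
        finally have "A / 2 \<le> cmod (Q j z0) \<or> A / 2 \<le> cmod (Q i0 z0)" by auto
        moreover have "j \<le> k" using z0(1) Suc by simp
        ultimately show ?thesis using z0(1) by blast
      qed
      then obtain j where j: "j \<le> k" "cmod (Q j z0) \<ge> A / 2" by blast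
      \<comment> \<open>A quotient coefficient of size \<open>A / 2\<close> at \<open>z0\<close>,
        together with the large value of \<open>F\<close> at \<open>z1\<close>, violates the common
        bound \<open>Y\<close>.\<close>
      have "cmod (Q j z0) * cmod (F z1) powr c \<le> Y"
        using Y1 j z0 z1 r0 by (intro qg Qh F) auto
      moreover have "A / 2 * exp (c * N) \<le> cmod (Q j z0) * cmod (F z1) powr c"
        using j(2) by (intro mult_mono) (auto simp: z1 powr_def A0)
      ultimately have "A / 2 * exp (c * N) \<le> Y" by linarith
      then have "A * exp (c * N) \<le> A * (4 * (real k + 1) * exp d)" by (simp add: Y_def algebra_simps)
      then have "exp (c * N) \<le> 4 * (real k + 1) * exp d" using A0 by (simp only: mult_le_cancel_left_pos)
      also have "\<dots> < 8 * (real k + 1) * exp d" by (intro mult_strict_right_mono) auto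
      also have "\<dots> = exp (d + ln (8 * (real k + 1)))" by (simp add: exp_add)
      finally show False using cN by simp
    qed
  qed
qed

lemma holomorphic_on_rescale:
  assumes "f holomorphic_on UNIV"
  shows "(\<lambda>z. f (c * z)) holomorphic_on UNIV"
  by (rule holomorphic_on_compose_gen[OF _ assms, unfolded o_def]) (auto intro!: holomorphic_intros)

lemma entire_imp_continuous: "f holomorphic_on UNIV \<Longrightarrow> continuous_on UNIV f"
  by (rule holomorphic_on_imp_continuous_on)

text \<open>Each radius has its purpose. At \<open>exp s\<close> the function and the coefficients
  are normalized, at \<open>exp (s + \<delta>)\<close> the function must have outgrown them,
  \<open>exp (s + 2 * \<delta>)\<close> is rescaled to the unit circle, on which \<open>P\<close> is
  bounded, and at \<open>exp (s + 3 * \<delta>)\<close> \<open>P\<close> is estimated by its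
  coefficients. The result bounds the growth of \<open>P\<close> across the last shell.\<close>

lemma graph_restriction:
  fixes \<delta> :: real
  assumes \<delta>: "\<delta> > 0"
  obtains c where "c > 0" "\<And>a f k d s.
     f holomorphic_on UNIV \<Longrightarrow> (\<And>i. i \<le> k \<Longrightarrow> a i holomorphic_on UNIV) \<Longrightarrow>
     max_cball f (exp s) > 0 \<Longrightarrow>
     (\<And>i. i \<le> k \<Longrightarrow> max_cball (a i) (exp (s + 3 * \<delta>)) \<le> exp d * max_cball (a i) (exp s)) \<Longrightarrow>
     0 \<le> d \<Longrightarrow>
     c * ln (max_cball f (exp (s + \<delta>)) / max_cball f (exp s)) > d + ln (8 * (real k + 1)) \<Longrightarrow>
     max_cball (\<lambda>z. \<Sum>i\<le>k. a i z * f z ^ i) (exp (s + 3 * \<delta>)) \<le>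
       2 * (real k + 1) * exp d * (max_cball f (exp (s + 3 * \<delta>)) / max_cball f (exp s)) ^ k *
       max_cball (\<lambda>z. \<Sum>i\<le>k. a i z * f z ^ i) (exp (s + 2 * \<delta>))"
proof -
  obtain c where c: "c > 0" and gr: "\<And>b F k A B N d z0 z1 i0.
     F holomorphic_on UNIV \<Longrightarrow> (\<And>i. i \<le> k \<Longrightarrow> b i holomorphic_on UNIV) \<Longrightarrow>
     (\<And>z. cmod z \<le> exp (- 2 * \<delta>) \<Longrightarrow> cmod (F z) \<le> 1) \<Longrightarrow> cmod z1 \<le> exp (- \<delta>) \<Longrightarrow>
     cmod (F z1) = exp N \<Longrightarrow> N \<ge> 0 \<Longrightarrow>
     (\<And>i z. i \<le> k \<Longrightarrow> cmod z \<le> 1 \<Longrightarrow> cmod (b i z) \<le> exp d * A) \<Longrightarrow>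
     i0 \<le> k \<Longrightarrow> cmod z0 \<le> exp (- 2 * \<delta>) \<Longrightarrow> cmod (b i0 z0) = A \<Longrightarrow>
     (\<And>z. cmod z \<le> 1 \<Longrightarrow> cmod (\<Sum>i\<le>k. b i z * F z ^ i) \<le> B) \<Longrightarrow>
     0 \<le> d \<Longrightarrow> c * N > d + ln (8 * (real k + 1)) \<Longrightarrow> A \<le> 2 * B"
  proof -
    have "0 < exp (- \<delta>)" "exp (- \<delta>) < 1" "exp (- 2 * \<delta>) \<le> exp (- \<delta>)" using \<delta> by auto
    then show thesis by (rule graph_restriction_normalized) (fact that)
  qed
  show ?thesis
  proof (rule that[OF c])
    fix a f k d s
    assume f: "f holomorphic_on UNIV" and a: "\<And>i. i \<le> k \<Longrightarrow> a i holomorphic_on UNIV"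
      and R0: "max_cball f (exp s) > 0"
      and ad: "\<And>i. i \<le> k \<Longrightarrow> max_cball (a i) (exp (s + 3 * \<delta>)) \<le> exp d * max_cball (a i) (exp s)"
      and d: "(0::real) \<le> d"
      and N: "c * ln (max_cball f (exp (s + \<delta>)) / max_cball f (exp s)) > d + ln (8 * (real k + 1))"
    define R where "R = max_cball f (exp s)"
    define \<rho> where "\<rho> = exp (s + 2 * \<delta>)"
    define P where "P z = (\<Sum>i\<le>k. a i z * f z ^ i)" for z
    have R: "R > 0" using R0 by (simp add: R_def)
    have \<rho>: "\<rho> > 0" "\<rho> * exp (- 2 * \<delta>) = exp s" "\<rho> * exp (- \<delta>) = exp (s + \<delta>)"
      by (auto simp: \<rho>_def simp flip: exp_add)
    define F where "F z = f (of_real \<rho> * z) / of_real R" for z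
    \<comment> \<open>The weights compensate for dividing \<open>f\<close> by its maximum
      \<open>R\<close>, so that \<open>P\<close> is unchanged.\<close>
    define b where "b i z = of_real (R ^ i) * a i (of_real \<rho> * z)" for i z
    have Fh: "F holomorphic_on UNIV"
      unfolding F_def using R by (intro holomorphic_intros holomorphic_on_rescale f) auto
    have bh: "b i holomorphic_on UNIV" if "i \<le> k" for i
      unfolding b_def by (intro holomorphic_intros holomorphic_on_rescale a that)
    have bF: "(\<Sum>i\<le>k. b i z * F z ^ i) = P (of_real \<rho> * z)" for z
      unfolding P_def b_def F_def using R by (intro sum.cong) (auto simp: power_divide)
    define A where "A = (MAX i\<in>{..k}. R ^ i * max_cball (a i) (exp s))"
    have Ale: "R ^ i * max_cball (a i) (exp s) \<le> A" if "i \<le> k" for i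
      unfolding A_def using that by (intro Max_ge) auto
    obtain i0 where i0: "i0 \<le> k" "A = R ^ i0 * max_cball (a i0) (exp s)"
    proof -
      have "A \<in> (\<lambda>i. R ^ i * max_cball (a i) (exp s)) ` {..k}"
        unfolding A_def by (intro Max_in) auto
      then show ?thesis using that by auto
    qed
    obtain z0 where z0: "cmod z0 \<le> exp s" "cmod (a i0 z0) = max_cball (a i0) (exp s)"
      using max_cball_attained[OF entire_imp_continuous[OF a[OF i0(1)]], of "exp s"] by auto
    obtain z1 where z1: "cmod z1 \<le> exp (s + \<delta>)" "cmod (f z1) = max_cball f (exp (s + \<delta>))"
      using max_cball_attained[OF entire_imp_continuous[OF f], of "exp (s + \<delta>)"] by auto
    have Rm: "R \<le> max_cball f (exp (s + \<delta>))"
      unfolding R_def using \<delta> by (intro max_cball_mono entire_imp_continuous f) auto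
    have A0: "0 \<le> A" using R max_cball_nonneg[OF entire_imp_continuous[OF a[OF i0(1)]], of "exp s"]
      by (simp add: i0(2))
    define B where "B = max_cball P \<rho>"
    have Ph: "P holomorphic_on UNIV" unfolding P_def using a f by (intro holomorphic_intros) auto
    have AB: "A \<le> 2 * B"
    proof (rule gr[OF Fh bh, where ?z1.0 = "z1 / of_real \<rho>" and ?z0.0 = "z0 / of_real \<rho>" and d = d and ?i0.0 = i0
             and N = "ln (max_cball f (exp (s + \<delta>)) / R)"])
      show "cmod (F z) \<le> 1" if "cmod z \<le> exp (- 2 * \<delta>)" for z
      proof -
        have "cmod (of_real \<rho> * z) \<le> \<rho> * exp (- 2 * \<delta>)" using that \<rho>(1) by (simp add: norm_mult)
        then have "cmod (f (of_real \<rho> * z)) \<le> R"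
          unfolding R_def \<rho>(2) by (intro cmod_le_max_cball entire_imp_continuous f)
        then show ?thesis using R by (simp add: F_def norm_divide)
      qed
      show "cmod (z1 / of_real \<rho>) \<le> exp (- \<delta>)"
      proof -
        have "cmod z1 \<le> \<rho> * exp (- \<delta>)" using z1(1) by (simp only: \<rho>(3))
        then show ?thesis using \<rho>(1) by (simp add: norm_divide pos_divide_le_eq mult.commute)
      qed
      show "cmod (F (z1 / of_real \<rho>)) = exp (ln (max_cball f (exp (s + \<delta>)) / R))"
        using \<rho>(1) R Rm z1(2) by (simp add: F_def norm_divide)
      show "ln (max_cball f (exp (s + \<delta>)) / R) \<ge> 0" using R Rm by simp
      show "cmod (b i z) \<le> exp d * A" if i: "i \<le> k" and z: "cmod z \<le> 1" for i z
      proof -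
        have "cmod (of_real \<rho> * z) \<le> \<rho> * 1" using z \<rho>(1) by (simp add: norm_mult)
        also have "\<dots> \<le> exp (s + 3 * \<delta>)" using \<delta> by (simp add: \<rho>_def)
        finally have "cmod (a i (of_real \<rho> * z)) \<le> max_cball (a i) (exp (s + 3 * \<delta>))"
          by (intro cmod_le_max_cball entire_imp_continuous a i)
        also have "\<dots> \<le> exp d * max_cball (a i) (exp s)" by (rule ad[OF i])
        finally have "R ^ i * cmod (a i (of_real \<rho> * z)) \<le> R ^ i * (exp d * max_cball (a i) (exp s))"
          using R by (intro mult_left_mono) auto
        also have "\<dots> = exp d * (R ^ i * max_cball (a i) (exp s))" by simp
        also have "\<dots> \<le> exp d * A" using Ale[OF i] by simp
        finally show ?thesis using R by (simp add: b_def norm_mult norm_power)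
      qed
      show "i0 \<le> k" by (rule i0(1))
      show "cmod (z0 / of_real \<rho>) \<le> exp (- 2 * \<delta>)"
        using z0(1) \<rho>(1) by (simp add: norm_divide field_simps flip: \<rho>(2))
      show "cmod (b i0 (z0 / of_real \<rho>)) = A"
        using \<rho>(1) R z0(2) i0(2) by (simp add: b_def norm_mult norm_power)
      show "cmod (\<Sum>i\<le>k. b i z * F z ^ i) \<le> B" if "cmod z \<le> 1" for z
        unfolding bF B_def using that \<rho>(1)
        by (intro cmod_le_max_cball entire_imp_continuous Ph) (simp add: norm_mult)
      show "0 \<le> d" by (rule d)
      show "c * ln (max_cball f (exp (s + \<delta>)) / R) > d + ln (8 * (real k + 1))" using N by (simp add: R_def)
    qed auto
    define K where "K = max_cball f (exp (s + 3 * \<delta>)) / R"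
    have K1: "K \<ge> 1"
    proof -
      have "R \<le> max_cball f (exp (s + 3 * \<delta>))"
        unfolding R_def using \<delta> by (intro max_cball_mono entire_imp_continuous f) auto
      then show ?thesis using R by (simp add: K_def)
    qed
    have "max_cball P (exp (s + 3 * \<delta>)) \<le> (real k + 1) * (exp d * A * K ^ k)"
    proof (rule max_cball_le)
      fix z assume z: "cmod z \<le> exp (s + 3 * \<delta>)"
      have "cmod (P z) \<le> (\<Sum>i\<le>k. exp d * A * K ^ k)"
        unfolding P_def
      proof (rule sum_norm_le)
        fix i assume i: "i \<in> {..k}"
        have fz: "cmod (f z) \<le> R * K"
          using cmod_le_max_cball[OF entire_imp_continuous[OF f] z] R by (simp add: K_def)
        have "cmod (a i z) \<le> max_cball (a i) (exp (s + 3 * \<delta>))"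
          using i by (intro cmod_le_max_cball entire_imp_continuous a z) auto
        also have "\<dots> \<le> exp d * max_cball (a i) (exp s)" using i by (intro ad) auto
        finally have "cmod (a i z) * cmod (f z) ^ i \<le> (exp d * max_cball (a i) (exp s)) * (R * K) ^ i"
          using fz max_cball_nonneg[OF entire_imp_continuous[OF a], of i "exp s"] i
          by (intro mult_mono power_mono) auto
        also have "\<dots> = exp d * (R ^ i * max_cball (a i) (exp s)) * K ^ i"
          by (simp add: power_mult_distrib)
        also have "\<dots> \<le> exp d * A * K ^ k"
          using Ale[of i] i K1 A0 R max_cball_nonneg[OF entire_imp_continuous[OF a], of i "exp s"]
          by (intro mult_mono power_increasing) auto
        finally show "cmod (a i z * f z ^ i) \<le> exp d * A * K ^ k" by (simp add: norm_mult norm_power)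
      qed
      then show "cmod (P z) \<le> (real k + 1) * (exp d * A * K ^ k)" by (simp add: algebra_simps)
    qed simp
    also have "\<dots> \<le> (real k + 1) * (exp d * (2 * B) * K ^ k)"
      using AB K1 by (intro mult_left_mono mult_right_mono) auto
    also have "\<dots> = 2 * (real k + 1) * exp d * K ^ k * B" by simp
    finally show "max_cball (\<lambda>z. \<Sum>i\<le>k. a i z * f z ^ i) (exp (s + 3 * \<delta>)) \<le>
       2 * (real k + 1) * exp d * (max_cball f (exp (s + 3 * \<delta>)) / max_cball f (exp s)) ^ k *
       max_cball (\<lambda>z. \<Sum>i\<le>k. a i z * f z ^ i) (exp (s + 2 * \<delta>))"
      unfolding P_def K_def B_def R_def \<rho>_def .
  qed
qed

section \<open>The Legendre transform of the coefficient sequence\<close>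


text \<open>The difference quotients at \<open>t\<close> lie between \<open>k t\<close> and
  \<open>k y\<close>, so continuity of \<open>k\<close> turns slope inequalities, which duality
  supplies directly, into a derivative.\<close>

lemma deriv_from_slopes:
  fixes f k :: "real \<Rightarrow> real"
  assumes S: "open S" "t \<in> S" and cont: "isCont k t"
    and slopes: "\<And>x y. x \<in> S \<Longrightarrow> y \<in> S \<Longrightarrow> x < y \<Longrightarrow> k x * (y - x) \<le> f y - f x"
      "\<And>x y. x \<in> S \<Longrightarrow> y \<in> S \<Longrightarrow> x < y \<Longrightarrow> f y - f x \<le> k y * (y - x)"
  shows "(f has_real_derivative k t) (at t)"
  unfolding has_field_derivative_iff
proof (rule tendsto_sandwich)
  have k: "(k \<longlongrightarrow> k t) (at t)" using cont by (simp add: isCont_def)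
  have ev: "\<forall>\<^sub>F y in at t. y \<in> S \<and> y \<noteq> t"
    using S by (simp add: eventually_conj eventually_at_in_open' eventually_neq_at_within)
  show "\<forall>\<^sub>F y in at t. min (k t) (k y) \<le> (f y - f t) / (y - t)"
    using ev
  proof eventually_elim
    case (elim y)
    then show ?case using slopes(1)[of t y] slopes(1)[of y t] S
      by (cases "t < y") (auto simp: field_simps min_le_iff_disj)
  qed
  show "\<forall>\<^sub>F y in at t. (f y - f t) / (y - t) \<le> max (k t) (k y)"
    using ev
  proof eventually_elim
    case (elim y)
    then show ?case using slopes(2)[of t y] slopes(2)[of y t] S
      by (cases "t < y") (auto simp: field_simps le_max_iff_disj)
  qed
  show "((\<lambda>y. min (k t) (k y)) \<longlongrightarrow> k t) (at t)"
    using tendsto_min[OF tendsto_const[of "k t"] k] by simp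
  show "((\<lambda>y. max (k t) (k y)) \<longlongrightarrow> k t) (at t)"
    using tendsto_max[OF tendsto_const[of "k t"] k] by simp
qed

locale growth_function =
  fixes h :: "real \<Rightarrow> real"
  assumes cont: "continuous_on {0..} h"
    and strict_mono: "strict_mono_on {0..} h"
    and le_0: "h 0 \<le> 0"
    and superlinear: "filterlim (\<lambda>t. h t / t) at_top at_top"
    and shift: "Limsup at_top (\<lambda>t. ereal (h (t + 1) / h t)) < \<infinity>"
begin

lemma mono: "0 \<le> s \<Longrightarrow> s \<le> t \<Longrightarrow> h s \<le> h t"
  using strict_mono_onD[OF strict_mono, of s t] by (cases "s = t") auto

lemma less: "0 \<le> s \<Longrightarrow> s < t \<Longrightarrow> h s < h t"
  using strict_mono_onD[OF strict_mono, of s t] by auto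

lemma inj: "inj_on h {0..}"
  using strict_mono by (rule strict_mono_on_imp_inj_on)

lemma eventually_ge_mult: "\<forall>\<^sub>F t in at_top. K * t \<le> h t"
proof -
  have "\<forall>\<^sub>F t in at_top. K \<le> h t / t" using superlinear by (simp add: filterlim_at_top)
  then show ?thesis using eventually_gt_at_top[of 0]
    by eventually_elim (simp add: field_simps)
qed

lemma at_top: "filterlim h at_top at_top"
  by (rule filterlim_at_top_mono[OF filterlim_ident]) (use eventually_ge_mult[of 1] in simp)

lemma surj: assumes "h 0 \<le> x" obtains t where "0 \<le> t" "h t = x"
proof -
  have "\<forall>\<^sub>F t in at_top. x \<le> h t" using at_top by (simp add: filterlim_at_top)
  then obtain b where b: "\<And>t. b \<le> t \<Longrightarrow> x \<le> h t" by (auto simp: eventually_at_top_linorder)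
  have "\<exists>t\<ge>0. t \<le> max 0 b \<and> h t = x"
    using assms b[of "max 0 b"] by (intro IVT' continuous_on_subset[OF cont]) auto
  then show ?thesis using that by auto
qed

abbreviation "hinv \<equiv> half_line_inv h"

lemma hinv_h [simp]: "0 \<le> t \<Longrightarrow> hinv (h t) = t"
  unfolding half_line_inv_def by (rule the_inv_into_f_f[OF inj]) simp

lemma hinv_nonneg: "0 \<le> x \<Longrightarrow> 0 \<le> hinv x" and h_hinv: "0 \<le> x \<Longrightarrow> h (hinv x) = x"
  using surj[of x] le_0 by (metis hinv_h order_trans)+

lemma hinv_mono: "0 \<le> x \<Longrightarrow> x \<le> y \<Longrightarrow> hinv x \<le> hinv y"
  by (smt (verit) h_hinv hinv_nonneg less)

definition W :: "real \<Rightarrow> real" where "W x = integral {0..x} hinv"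

definition \<tau> :: real where "\<tau> = hinv 0"

text \<open>The case of equality in Young's inequality. In this form all slope estimates follow from
  the monotonicity of \<open>h\<close> and its inverse, before anything is known about integrals of
  \<open>h\<close>.\<close>

definition \<psi> :: "real \<Rightarrow> real" where "\<psi> t = t * h t - W (h t)"

lemma hinv_integrable: "0 \<le> x \<Longrightarrow> hinv integrable_on {x..y}"
  by (intro integrable_on_mono_on mono_onI hinv_mono) auto

lemma W_diff: assumes "0 \<le> x" "x \<le> y"
  shows "hinv x * (y - x) \<le> W y - W x" "W y - W x \<le> hinv y * (y - x)"
proof -
  have eq: "W y - W x = integral {x..y} hinv"
    using Henstock_Kurzweil_Integration.integral_combine[OF assms hinv_integrable[OF order_refl]] by (simp add: W_def)
  have "integral {x..y} (\<lambda>_. hinv x) \<le> integral {x..y} hinv"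
    using assms by (intro integral_le hinv_integrable hinv_mono) auto
  then show "hinv x * (y - x) \<le> W y - W x" using assms by (simp add: eq mult.commute)
  have "integral {x..y} hinv \<le> integral {x..y} (\<lambda>_. hinv y)"
    using assms by (intro integral_le hinv_integrable hinv_mono) auto
  then show "W y - W x \<le> hinv y * (y - x)" using assms by (simp add: eq mult.commute)
qed

lemma \<tau>: "0 \<le> \<tau>" "h \<tau> = 0"
  by (auto simp: \<tau>_def hinv_nonneg h_hinv)

lemma h_nonneg: "\<tau> \<le> t \<Longrightarrow> 0 \<le> h t"
  using mono[of \<tau> t] \<tau> by simp

text \<open>Young's inequality: by \<open>W_diff\<close>, \<open>t\<close> is the slope of a
  supporting line of the convex function \<open>W\<close> at \<open>h t\<close>.\<close>

lemma legendre: assumes "0 \<le> x" "\<tau> \<le> t" shows "x * t - W x \<le> \<psi> t"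
proof -
  have "hinv (h t) = t" using assms \<tau> by simp
  then have "t * (x - h t) \<le> W x - W (h t)"
    using W_diff[of x "h t"] W_diff[of "h t" x] assms h_nonneg[of t]
    by (cases "x \<le> h t") (auto simp: algebra_simps)
  then show ?thesis by (simp add: \<psi>_def algebra_simps)
qed

text \<open>The slopes \<open>h s\<close> and \<open>h t\<close> are inserted into
  \<open>legendre\<close> at the respective other point.\<close>

lemma \<psi>_diff: assumes "\<tau> \<le> s" "s \<le> t"
  shows "h s * (t - s) \<le> \<psi> t - \<psi> s" "\<psi> t - \<psi> s \<le> h t * (t - s)"
  using legendre[of "h s" t] legendre[of "h t" s] h_nonneg[of s] h_nonneg[of t] assms
  by (auto simp: \<psi>_def algebra_simps)

lemma \<psi>_mono: "\<tau> \<le> s \<Longrightarrow> s \<le> t \<Longrightarrow> \<psi> s \<le> \<psi> t"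
  using \<psi>_diff(1)[of s t] h_nonneg[of s] by (smt (verit) mult_nonneg_nonneg)

lemma \<psi>_deriv: assumes "\<tau> < t" shows "(\<psi> has_real_derivative h t) (at t)"
proof (rule deriv_from_slopes[of "{\<tau><..}"])
  show "isCont h t"
    using cont assms \<tau> by (intro continuous_on_interior[OF cont]) auto
qed (use assms \<psi>_diff in auto)

text \<open>The Lipschitz bound includes the endpoint \<tau>, which \<open>\<psi>_deriv\<close> does
  not reach.\<close>

lemma \<psi>_continuous: "continuous_on {\<tau>..b} \<psi>"
proof (cases "\<tau> \<le> b")
  case True
  have "(h b)-lipschitz_on {\<tau>..b} \<psi>"
  proof (rule lipschitz_onI)
    have key: "\<bar>\<psi> y - \<psi> x\<bar> \<le> h b * \<bar>y - x\<bar>" if "\<tau> \<le> x" "x \<le> y" "y \<le> b" for x y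
    proof -
      have "h y * (y - x) \<le> h b * (y - x)"
        using that \<tau> by (intro mult_right_mono mono) auto
      then show ?thesis using \<psi>_diff[of x y] \<psi>_mono[of x y] that by auto
    qed
    then show "dist (\<psi> x) (\<psi> y) \<le> h b * dist x y" if "x \<in> {\<tau>..b}" "y \<in> {\<tau>..b}" for x y
      using key[of x y] key[of y x] that by (cases "x \<le> y") (auto simp: dist_real_def abs_minus_commute)
  qed (use True h_nonneg in simp)
  then show ?thesis by (rule lipschitz_on_continuous_on)
qed simp

text \<open>This translates the hypothesis on integrals of the h_j into one on \<psi>.\<close>

lemma integral_h: assumes "\<tau> \<le> a" "a \<le> b" shows "integral {a..b} h = \<psi> b - \<psi> a"
proof -
  have "(h has_integral \<psi> b - \<psi> a) {a..b}"
    using assms(2)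
  proof (rule fundamental_theorem_of_calculus_interior)
    show "continuous_on {a..b} \<psi>" using assms by (intro continuous_on_subset[OF \<psi>_continuous]) auto
    show "(\<psi> has_vector_derivative h x) (at x)" if "x \<in> {a<..<b}" for x
      using \<psi>_deriv[of x] that assms by (simp add: has_real_derivative_iff_has_vector_derivative)
  qed
  then show ?thesis by (rule integral_unique)
qed

lemma shift_bound:
  obtains C where "C \<ge> 1" "\<forall>\<^sub>F t in at_top. h (t + 1) \<le> C * h t"
proof -
  obtain C where C: "Limsup at_top (\<lambda>t. ereal (h (t + 1) / h t)) < ereal C"
    using shift less_PInf_Ex_of_nat by (metis ereal_less_PInfty less_ereal.simps(4) real_of_ereal.cases ereal_dense2)
  have pos: "\<forall>\<^sub>F t in at_top. 0 < h t" using at_top by (simp add: filterlim_at_top_dense)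
  have "\<forall>\<^sub>F t in at_top. ereal (h (t + 1) / h t) < ereal C" using C by (rule Limsup_lessD)
  then have "\<forall>\<^sub>F t in at_top. h (t + 1) \<le> max C 1 * h t"
    using pos
  proof eventually_elim
    case (elim t)
    then have "h (t + 1) \<le> C * h t" by (simp add: field_simps)
    also have "\<dots> \<le> max C 1 * h t" using elim by (intro mult_right_mono) auto
    finally show ?case .
  qed
  then show ?thesis using that[of "max C 1"] by simp
qed

end



lemma eventually_at_top_shift:
  fixes c :: real
  assumes "\<forall>\<^sub>F t in at_top. P t"
  shows "\<forall>\<^sub>F t in at_top. P (t + c)"
proof -
  have "filterlim (\<lambda>t. t + c) at_top at_top"
    using filterlim_tendsto_add_at_top[OF tendsto_const[of c] filterlim_ident] by (simp add: add.commute)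
  then show ?thesis using assms by (rule eventually_compose_filterlim[rotated])
qed

section \<open>Approximation of \<psi> up to o(h)\<close>

context growth_function
begin

lemma eventually_ge: "\<forall>\<^sub>F t in at_top. K \<le> h t"
  using at_top by (simp add: filterlim_at_top)

lemma eventually_gt_0: "\<forall>\<^sub>F t in at_top. 0 < h t"
  using at_top by (simp add: filterlim_at_top_dense)

lemma shift_bound_two_sided:
  obtains C where "C \<ge> 1" "\<forall>\<^sub>F t in at_top. h (t + real n) \<le> C * h t" "\<forall>\<^sub>F t in at_top. h t \<le> C * h (t - real n)"
proof -
  obtain D where D: "D \<ge> 1" "\<forall>\<^sub>F t in at_top. h (t + 1) \<le> D * h t" by (rule shift_bound)
  have 1: "\<forall>\<^sub>F t in at_top. h (t + real n) \<le> D ^ n * h t"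
  proof (induction n)
    case (Suc n)
    have "\<forall>\<^sub>F t in at_top. h (t + real n + 1) \<le> D * h (t + real n)"
      using eventually_at_top_shift[OF D(2), of "real n"] by (simp add: add_ac)
    then show ?case using Suc.IH
    proof eventually_elim
      case (elim t)
      have "D * h (t + real n) \<le> D * (D ^ n * h t)" using elim D(1) by (intro mult_left_mono) auto
      then show ?case using elim(1) by (simp add: add_ac mult_ac)
    qed
  qed simp
  have 2: "\<forall>\<^sub>F t in at_top. h t \<le> D ^ n * h (t - real n)"
    using eventually_at_top_shift[OF 1, of "- real n"] by simp
  show ?thesis using that[OF _ 1 2] D(1) by simp
qed

lemma \<psi>_\<tau>: "\<psi> \<tau> = 0"
  by (simp add: \<psi>_def \<tau> W_def)

lemma \<psi>_nonneg: "\<tau> \<le> t \<Longrightarrow> 0 \<le> \<psi> t"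
  using \<psi>_mono[of \<tau> t] \<psi>_\<tau> by simp

text \<open>The last unit interval alone contributes \<open>h (t - 1)\<close> to
  \<open>\<psi> t\<close>, and a unit shift costs \<open>h\<close> only a constant factor.\<close>

lemma h_le_\<psi>: obtains C where "C \<ge> 1" "\<forall>\<^sub>F t in at_top. h t \<le> C * \<psi> t"
proof -
  obtain C where C: "C \<ge> 1" "\<forall>\<^sub>F t in at_top. h t \<le> C * h (t - real 1)"
    using shift_bound_two_sided by metis
  have "\<forall>\<^sub>F t in at_top. h t \<le> C * \<psi> t"
    using C(2) eventually_ge_at_top[of "\<tau> + 1"]
  proof eventually_elim
    case (elim t)
    have "h (t - 1) \<le> \<psi> t" using \<psi>_diff(1)[of "t - 1" t] \<psi>_nonneg[of "t - 1"] elim by simp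
    then have "C * h (t - 1) \<le> C * \<psi> t" using C(1) by (intro mult_left_mono) auto
    then show ?case using elim by simp
  qed
  then show ?thesis using that C(1) by blast
qed

text \<open>On the interval from \<open>t / 2\<close> to \<open>t\<close>, whose length is
  \<open>t / 2\<close>, \<open>h\<close> exceeds every multiple of \<open>t\<close>.\<close>

lemma \<psi>_superquadratic: "\<forall>\<^sub>F t in at_top. K * t\<^sup>2 \<le> \<psi> t"
proof -
  have "filterlim (\<lambda>t::real. t / 2) at_top at_top"
    using filterlim_tendsto_pos_mult_at_top[OF tendsto_const _ filterlim_ident, of "1/2"] by simp
  then have "\<forall>\<^sub>F t in at_top. (4 * K) * (t / 2) \<le> h (t / 2)"
    using eventually_ge_mult by (rule eventually_compose_filterlim[rotated])
  then show ?thesis using eventually_ge_at_top[of "2 * \<tau>"] eventually_ge_at_top[of 0]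
  proof eventually_elim
    case (elim t)
    have "K * t\<^sup>2 = (4 * K) * (t / 2) * (t / 2)" by (simp add: power2_eq_square)
    also have "\<dots> \<le> h (t / 2) * (t / 2)" using elim by (intro mult_right_mono) auto
    also have "\<dots> = h (t / 2) * (t - t / 2)" by simp
    also have "\<dots> \<le> \<psi> t - \<psi> (t / 2)" using elim by (intro \<psi>_diff) auto
    also have "\<dots> \<le> \<psi> t" using \<psi>_nonneg[of "t / 2"] elim by simp
    finally show ?case .
  qed
qed

lemma \<psi>_at_top: "filterlim \<psi> at_top at_top"
  unfolding filterlim_at_top
proof
  fix Z :: real
  show "\<forall>\<^sub>F t in at_top. Z \<le> \<psi> t"
    using \<psi>_superquadratic[of "\<bar>Z\<bar>"] eventually_ge_at_top[of 1]
  proof eventually_elim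
    case (elim t)
    have "\<bar>Z\<bar> * 1 \<le> \<bar>Z\<bar> * t\<^sup>2" using elim by (intro mult_left_mono) (auto simp: one_le_power)
    then show ?case using elim by linarith
  qed
qed

lemma eventually_\<psi>_gt_0: "\<forall>\<^sub>F t in at_top. 0 < \<psi> t"
  using \<psi>_at_top by (simp add: filterlim_at_top_dense)

text \<open>As \<open>\<psi>\<close> increases by at least \<open>h t\<close> from \<open>t\<close> to \<open>t + 1\<close>, an error of \<open>o(h)\<close> does not affect the order
  of magnitude of such increments.\<close>

definition approx_\<psi> :: "(real \<Rightarrow> real) \<Rightarrow> bool" where
  "approx_\<psi> L \<longleftrightarrow> (\<forall>\<eta>>0. \<forall>\<^sub>F t in at_top. \<bar>L t - \<psi> t\<bar> \<le> \<eta> * h t)"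

lemma approx_\<psi>D: "approx_\<psi> L \<Longrightarrow> \<eta> > 0 \<Longrightarrow> \<forall>\<^sub>F t in at_top. \<bar>L t - \<psi> t\<bar> \<le> \<eta> * h t"
  by (simp add: approx_\<psi>_def)

lemma approx_\<psi>_increment_ge:
  assumes L: "approx_\<psi> L" and \<delta>: "0 < \<delta>" "\<delta> \<le> 1"
  shows "\<forall>\<^sub>F t in at_top. \<delta> / 2 * h t \<le> L (t + \<delta>) - L t"
proof -
  obtain C where C: "C \<ge> 1" "\<forall>\<^sub>F t in at_top. h (t + real 1) \<le> C * h t"
    using shift_bound_two_sided by metis
  \<comment> \<open>Makes the errors at \<open>t\<close> and at \<open>t + \<delta>\<close> at most
    \<open>\<delta> / 4 * h t\<close> each, half of the guaranteed increment of \<psi> in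
    total.\<close>
  define \<eta> where "\<eta> = \<delta> / (4 * C)"
  have \<eta>: "\<eta> > 0" "\<eta> * C = \<delta> / 4" "\<eta> \<le> \<delta> / 4" using C \<delta> by (auto simp: \<eta>_def field_simps)
  have ev: "\<forall>\<^sub>F t in at_top. \<bar>L t - \<psi> t\<bar> \<le> \<eta> * h t" by (rule approx_\<psi>D[OF L \<eta>(1)])
  show ?thesis
    using ev eventually_at_top_shift[OF ev, of \<delta>] C(2) eventually_gt_0 eventually_ge_at_top[of \<tau>]
  proof eventually_elim
    case (elim t)
    have "\<eta> * h (t + \<delta>) \<le> \<eta> * (C * h t)"
      using mono[of "t + \<delta>" "t + 1"] elim \<delta> \<tau> \<eta> by (intro mult_left_mono) auto
    also have "\<dots> = \<delta> / 4 * h t" using \<eta>(2) by (metis mult.assoc)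
    finally have 1: "\<eta> * h (t + \<delta>) \<le> \<delta> / 4 * h t" .
    have 2: "\<eta> * h t \<le> \<delta> / 4 * h t" using \<eta>(3) elim by (intro mult_right_mono) auto
    have "\<delta> * h t \<le> \<psi> (t + \<delta>) - \<psi> t" using \<psi>_diff(1)[of t "t + \<delta>"] elim \<delta> by (simp add: mult.commute)
    then show ?case using elim(1,2) 1 2 by linarith
  qed
qed

lemma approx_\<psi>_increment_le:
  assumes L: "approx_\<psi> L"
  obtains K where "K > 0" "\<forall>\<^sub>F t in at_top. L (t + real n) - L t \<le> K * h t"
proof -
  obtain C where C: "C \<ge> 1" "\<forall>\<^sub>F t in at_top. h (t + real n) \<le> C * h t"
    using shift_bound_two_sided by metis
  have ev: "\<forall>\<^sub>F t in at_top. \<bar>L t - \<psi> t\<bar> \<le> 1 * h t" by (rule approx_\<psi>D[OF L]) simp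
  have "\<forall>\<^sub>F t in at_top. L (t + real n) - L t \<le> (real n * C + C + 1) * h t"
    using ev eventually_at_top_shift[OF ev, of "real n"] C(2) eventually_gt_0 eventually_ge_at_top[of \<tau>]
  proof eventually_elim
    case (elim t)
    have "\<psi> (t + real n) - \<psi> t \<le> h (t + real n) * real n"
      using \<psi>_diff(2)[of t "t + real n"] elim by simp
    also have "\<dots> \<le> (C * h t) * real n" using elim by (intro mult_right_mono) auto
    finally show ?case using elim(1,2,3) by (simp add: algebra_simps abs_le_iff)
  qed
  moreover have "real n * C + C + 1 > 0" using C(1) by (intro add_nonneg_pos add_nonneg_nonneg mult_nonneg_nonneg) auto
  ultimately show ?thesis using that by blast
qed

lemma approx_\<psi>_relative:
  assumes L: "approx_\<psi> L" and e: "e > 0"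
  shows "\<forall>\<^sub>F t in at_top. \<bar>L t - \<psi> t\<bar> \<le> e * \<psi> t"
proof -
  obtain C where C: "C \<ge> 1" "\<forall>\<^sub>F t in at_top. h t \<le> C * \<psi> t" by (rule h_le_\<psi>)
  have ev: "\<forall>\<^sub>F t in at_top. \<bar>L t - \<psi> t\<bar> \<le> (e / C) * h t" using C e by (intro approx_\<psi>D[OF L]) auto
  show ?thesis using ev C(2)
  proof eventually_elim
    case (elim t)
    have "(e / C) * h t \<le> (e / C) * (C * \<psi> t)" using elim C e by (intro mult_left_mono) auto
    then show ?case using elim C by simp
  qed
qed

lemma approx_\<psi>_ratio:
  assumes L: "approx_\<psi> L"
  shows "((\<lambda>t. L t / \<psi> t) \<longlongrightarrow> 1) at_top"
proof (rule tendstoI)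
  fix e :: real assume e: "e > 0"
  have "\<forall>\<^sub>F t in at_top. \<bar>L t - \<psi> t\<bar> \<le> e / 2 * \<psi> t" using e by (intro approx_\<psi>_relative L) simp
  then show "\<forall>\<^sub>F t in at_top. dist (L t / \<psi> t) 1 < e"
    using eventually_\<psi>_gt_0
  proof eventually_elim
    case (elim t)
    have "dist (L t / \<psi> t) 1 = \<bar>L t - \<psi> t\<bar> / \<psi> t"
    proof -
      have "L t / \<psi> t - 1 = (L t - \<psi> t) / \<psi> t" using elim by (simp add: diff_divide_distrib)
      then show ?thesis using elim by (simp add: dist_real_def)
    qed
    also have "\<dots> \<le> e / 2" using elim by (simp add: field_simps)
    finally show ?case using e by simp
  qed
qed

lemma approx_\<psi>_superlinear:
  assumes L: "approx_\<psi> L"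
  shows "\<forall>\<^sub>F t in at_top. K * t \<le> L t"
proof -
  have "\<forall>\<^sub>F t in at_top. \<bar>L t - \<psi> t\<bar> \<le> 1 / 2 * \<psi> t" by (intro approx_\<psi>_relative L) simp
  then show ?thesis using \<psi>_superquadratic[of "2 * \<bar>K\<bar>"] eventually_ge_at_top[of 1]
  proof eventually_elim
    case (elim t)
    have "K * t \<le> \<bar>K\<bar> * t" using elim by (intro mult_right_mono) auto
    also have "\<dots> \<le> \<bar>K\<bar> * t\<^sup>2" using elim by (intro mult_left_mono) (auto simp: self_le_power)
    finally have "K * t \<le> \<bar>K\<bar> * t\<^sup>2" .
    moreover have "2 * (\<bar>K\<bar> * t\<^sup>2) \<le> \<psi> t" using elim by (simp add: mult_ac)
    ultimately show ?case using elim(1) by linarith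
  qed
qed

text \<open>A shift of the argument by \<eta> changes \<psi> by at most a constant times
  \<open>\<eta> * h t\<close>, and linear terms are o(h). Hence estimates that lose a little of the
  radius and a power of it are precise enough.\<close>

lemma approx_\<psi>I:
  assumes upper: "\<And>\<eta>. 0 < \<eta> \<Longrightarrow> \<eta> < 1 \<Longrightarrow> \<exists>K. \<forall>\<^sub>F t in at_top. L t \<le> \<psi> (t + \<eta>) + K * (1 + t)"
    and lower: "\<And>\<eta>. 0 < \<eta> \<Longrightarrow> \<eta> < 1 \<Longrightarrow> \<exists>K. \<forall>\<^sub>F t in at_top. \<psi> (t - \<eta>) - K * (1 + t) \<le> L t"
  shows "approx_\<psi> L"
  unfolding approx_\<psi>_def
proof (intro allI impI)
  fix e :: real assume e: "e > 0"
  obtain C where C: "C \<ge> 1" "\<forall>\<^sub>F t in at_top. h (t + real 1) \<le> C * h t"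
    using shift_bound_two_sided by metis
  \<comment> \<open>Half of \<open>e\<close> pays for the shift by \<eta> in either direction, the
    other half for the linear term.\<close>
  define \<eta> where "\<eta> = min (1 / 2) (e / (2 * C))"
  have \<eta>: "0 < \<eta>" "\<eta> < 1" using C e by (auto simp: \<eta>_def)
  have \<eta>C: "\<eta> * C \<le> e / 2" "\<eta> \<le> e / 2"
  proof -
    have "\<eta> * C \<le> e / (2 * C) * C" using C by (intro mult_right_mono) (auto simp: \<eta>_def)
    then show "\<eta> * C \<le> e / 2" using C by simp
    have "\<eta> * 1 \<le> \<eta> * C" using C \<eta> by (intro mult_left_mono) auto
    with \<open>\<eta> * C \<le> e / 2\<close> show "\<eta> \<le> e / 2" by simp
  qed
  obtain K1 where K1: "\<forall>\<^sub>F t in at_top. L t \<le> \<psi> (t + \<eta>) + K1 * (1 + t)" using upper[OF \<eta>] by blast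
  obtain K2 where K2: "\<forall>\<^sub>F t in at_top. \<psi> (t - \<eta>) - K2 * (1 + t) \<le> L t" using lower[OF \<eta>] by blast
  show "\<forall>\<^sub>F t in at_top. \<bar>L t - \<psi> t\<bar> \<le> e * h t"
    using K1 K2 C(2) eventually_gt_0 eventually_ge_at_top[of "\<tau> + 1"]
      eventually_ge_mult[of "4 * \<bar>K1\<bar> / e"] eventually_ge_mult[of "4 * \<bar>K2\<bar> / e"]
  proof eventually_elim
    case (elim t)
    have t: "t \<ge> 1" using elim \<tau> by simp
    have lin: "K * (1 + t) \<le> e / 2 * h t" if "4 * \<bar>K\<bar> / e * t \<le> h t" for K
    proof -
      have "K * (1 + t) \<le> \<bar>K\<bar> * (2 * t)" using t by (intro mult_mono) auto
      also have "\<dots> = e / 2 * (4 * \<bar>K\<bar> / e * t)" using e by simp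
      also have "\<dots> \<le> e / 2 * h t" using that e by (intro mult_left_mono) auto
      finally show ?thesis .
    qed
    have "\<psi> (t + \<eta>) - \<psi> t \<le> h (t + \<eta>) * \<eta>" using \<psi>_diff(2)[of t "t + \<eta>"] elim \<eta> by simp
    also have "\<dots> \<le> (C * h t) * \<eta>"
      using mono[of "t + \<eta>" "t + 1"] elim \<eta> \<tau> by (intro mult_right_mono) auto
    also have "\<dots> = (\<eta> * C) * h t" by simp
    also have "\<dots> \<le> e / 2 * h t" using \<eta>C elim by (intro mult_right_mono) auto
    finally have up: "\<psi> (t + \<eta>) - \<psi> t \<le> e / 2 * h t" .
    have "\<psi> t - \<psi> (t - \<eta>) \<le> h t * \<eta>" using \<psi>_diff(2)[of "t - \<eta>" t] elim \<eta> by simp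
    also have "\<dots> \<le> e / 2 * h t" using \<eta>C elim by (simp add: mult.commute mult_right_mono)
    finally have lo: "\<psi> t - \<psi> (t - \<eta>) \<le> e / 2 * h t" .
    show ?case using elim(1,2) up lo lin[OF elim(6)] lin[OF elim(7)] by (simp add: abs_le_iff)
  qed
qed

text \<open>A bounded ratio over unit steps is iterated. This is the source of the finite order of
  \<open>F\<close>.\<close>

lemma h_exponential_bound:
  obtains C where "C > 0" "\<forall>\<^sub>F t in at_top. h t \<le> exp (C * t)"
proof -
  obtain D where D: "D \<ge> 1" "\<forall>\<^sub>F t in at_top. h (t + 1) \<le> D * h t" by (rule shift_bound)
  obtain T where T: "\<And>t. t \<ge> T \<Longrightarrow> h (t + 1) \<le> D * h t"
    using D(2) by (auto simp: eventually_at_top_linorder)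
  define T' where "T' = max T (max \<tau> 1)"
  have iter: "h (T' + real n) \<le> D ^ n * h T'" for n
  proof (induction n)
    case (Suc n)
    have "h (T' + real n + 1) \<le> D * h (T' + real n)" by (rule T) (simp add: T'_def)
    also have "\<dots> \<le> D * (D ^ n * h T')" using Suc D by (intro mult_left_mono) auto
    finally show ?case by (simp add: add_ac mult_ac)
  qed simp
  define C where "C = ln D + \<bar>ln D\<bar> + \<bar>h T'\<bar> + 1"
  have "h t \<le> exp (C * t)" if t: "t \<ge> T'" for t
  proof -
    define n where "n = nat \<lceil>t - T'\<rceil>"
    have n: "t - T' \<le> real n" "real n \<le> t - T' + 1" using t by (auto simp: n_def)
    have T1: "T' \<ge> 1" "0 \<le> T'" by (auto simp: T'_def)
    have "h t \<le> h (T' + real n)" using n t T1 by (intro mono) auto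
    also have "\<dots> \<le> D ^ n * h T'" by (rule iter)
    also have "\<dots> \<le> exp (ln D * t) * exp (\<bar>h T'\<bar> * t)"
    proof (intro mult_mono)
      have "D ^ n = exp (ln D * real n)" using D by (simp add: exp_of_nat2_mult)
      also have "\<dots> \<le> exp (ln D * t)" using D n T1 by (simp add: mult_left_mono)
      finally show "D ^ n \<le> exp (ln D * t)" .
      have "h T' \<le> exp \<bar>h T'\<bar>" using exp_ge_add_one_self[of "\<bar>h T'\<bar>"] by linarith
      also have "\<dots> \<le> exp (\<bar>h T'\<bar> * t)" using T1 t by (simp add: mult_le_cancel_left1)
      finally show "h T' \<le> exp (\<bar>h T'\<bar> * t)" .
    qed (use h_nonneg[of T'] in \<open>auto simp: T'_def\<close>)
    also have "\<dots> \<le> exp (C * t)" using t T1 D unfolding C_def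
      by (simp flip: exp_add add: algebra_simps)
    finally show ?thesis .
  qed
  then have "\<forall>\<^sub>F t in at_top. h t \<le> exp (C * t)"
    by (auto simp: eventually_at_top_linorder)
  moreover have "C > 0" using ln_ge_zero[OF D(1)] unfolding C_def by linarith
  ultimately show ?thesis using that by blast
qed

end

section \<open>The maximum modulus of \<open>F\<close> and of \<open>exp F\<close>\<close>

locale growth_entire = growth_function +
  fixes F :: "complex \<Rightarrow> complex"
  assumes is_f\<^sub>h: "is_f\<^sub>h h F"
begin

lemma coefficients:
  obtains c where "\<And>n. cmod (c n) = exp (- W (real n))" "\<And>z. (\<lambda>n. c n * z ^ n) sums F z"
proof -
  obtain c where c: "\<And>n. c n \<noteq> 0 \<and> ln (cmod (c n)) = - integral {0..real n} hinv"
    "\<And>z. (\<lambda>n. c n * z ^ n) sums F z"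
    using is_f\<^sub>h unfolding is_f\<^sub>h_def by blast
  have "cmod (c n) = exp (- W (real n))" for n
    using c(1)[of n] by (metis W_def exp_ln zero_less_norm_iff)
  then show ?thesis using that c(2) by blast
qed

lemma entire: "F holomorphic_on UNIV"
proof -
  obtain c where c: "\<And>z. (\<lambda>n. c n * z ^ n) sums F z" using coefficients by metis
  have "F holomorphic_on ball 0 r" for r
    using c by (intro power_series_holomorphic[of 0 r c]) simp
  then have "F field_differentiable at z" for z
    using holomorphic_on_imp_differentiable_at[of F "ball 0 (cmod z + 1)" z] by simp
  then show ?thesis by (simp add: holomorphic_on_def)
qed

text \<open>By \<open>legendre\<close> every term is at most
  \<open>exp (\<psi> (t + \<eta>))\<close> at the larger radius, so returning to
  \<open>exp t\<close> leaves a geometric series.\<close>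

lemma max_cball_upper:
  assumes "\<tau> \<le> t" "0 < \<eta>"
  shows "max_cball F (exp t) \<le> exp (\<psi> (t + \<eta>)) / (1 - exp (- \<eta>))"
proof (rule max_cball_le)
  fix z assume z: "cmod z \<le> exp t"
  obtain c where c: "\<And>n. cmod (c n) = exp (- W (real n))" "\<And>z. (\<lambda>n. c n * z ^ n) sums F z"
    using coefficients by metis
  have b: "cmod (c n * z ^ n) \<le> exp (\<psi> (t + \<eta>)) * exp (- \<eta>) ^ n" for n
  proof -
    have "cmod (c n * z ^ n) \<le> exp (- W (real n)) * exp t ^ n"
      unfolding norm_mult norm_power c using z by (intro mult_left_mono power_mono) auto
    also have "\<dots> = exp ((real n * (t + \<eta>) - W (real n)) + real n * (- \<eta>))"
      by (simp add: exp_of_nat_mult[symmetric] algebra_simps flip: exp_add)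
    also have "\<dots> = exp (real n * (t + \<eta>) - W (real n)) * exp (- \<eta>) ^ n"
      by (simp only: exp_add exp_of_nat_mult)
    also have "\<dots> \<le> exp (\<psi> (t + \<eta>)) * exp (- \<eta>) ^ n"
      using legendre[of "real n" "t + \<eta>"] assms by (intro mult_right_mono) auto
    finally show ?thesis .
  qed
  have s: "(\<lambda>n. exp (\<psi> (t + \<eta>)) * exp (- \<eta>) ^ n) sums (exp (\<psi> (t + \<eta>)) * (1 / (1 - exp (- \<eta>))))"
    using assms by (intro sums_mult geometric_sums) auto
  have "cmod (F z) \<le> suminf (\<lambda>n. exp (\<psi> (t + \<eta>)) * exp (- \<eta>) ^ n)"
    unfolding sums_unique[OF c(2)] using b s by (intro norm_suminf_le sums_summable)
  then show "cmod (F z) \<le> exp (\<psi> (t + \<eta>)) / (1 - exp (- \<eta>))"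
    using sums_unique[OF s] by simp
qed simp

text \<open>Cauchy's estimate for a single coefficient, that of a nearly maximal term.\<close>

lemma max_cball_lower:
  assumes "\<tau> \<le> t"
  shows "exp (\<psi> t - t) \<le> max_cball F (exp t)"
proof -
  obtain c where c: "\<And>n. cmod (c n) = exp (- W (real n))" "\<And>z. (\<lambda>n. c n * z ^ n) sums F z"
    using coefficients by metis
  \<comment> \<open>Over real x the expression x * t - W x is maximal at \<open>h t\<close>;
    rounding down costs at most \<open>t\<close>, since \<open>W\<close> increases.\<close>
  define n where "n = nat \<lfloor>h t\<rfloor>"
  have ht: "0 \<le> h t" using h_nonneg assms by simp
  have n: "real n \<le> h t" "h t - real n \<le> 1" using ht unfolding n_def by linarith+
  have "(deriv ^^ n) F 0 / fact n = c n"
  proof -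
    have "(\<lambda>w. suminf (\<lambda>n. c n * w ^ n)) = F" using sums_unique[OF c(2)] by (simp add: fun_eq_iff)
    moreover have "fps_conv_radius (Abs_fps c) > 0"
    proof -
      have "fps_conv_radius (Abs_fps c) \<ge> 1"
        unfolding fps_conv_radius_def
        using conv_radius_geI[of c 1] sums_summable[OF c(2)[of 1]] by (simp add: one_ereal_def)
      then show ?thesis by (rule less_le_trans[rotated]) simp
    qed
    ultimately have "F has_fps_expansion Abs_fps c"
      unfolding has_fps_expansion_def eval_fps_def by auto
    then have "fps_nth (Abs_fps c) n = (deriv ^^ n) F 0 / fact n" by (rule fps_nth_fps_expansion)
    then show ?thesis by simp
  qed
  moreover have "cmod ((deriv ^^ n) F 0) \<le> fact n * max_cball F (exp t) / exp t ^ n"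
    using entire by (intro Cauchy_inequality cmod_le_max_cball holomorphic_on_imp_continuous_on)
      (auto intro: holomorphic_on_subset continuous_on_subset holomorphic_on_imp_continuous_on)
  ultimately have "cmod (c n) \<le> max_cball F (exp t) / exp t ^ n"
    by (metis (no_types, opaque_lifting) fact_gt_zero mult.commute nonzero_mult_div_cancel_right norm_divide norm_fact order_less_irrefl pos_divide_le_eq times_divide_eq_left)
  then have "exp (- W (real n)) * exp t ^ n \<le> max_cball F (exp t)"
    by (simp add: c field_simps)
  moreover have "exp (\<psi> t - t) \<le> exp (- W (real n)) * exp t ^ n"
  proof -
    have "W (real n) \<le> W (h t)"
      using W_diff(1)[of "real n" "h t"] n hinv_nonneg[of "real n"] by (smt (verit) mult_nonneg_nonneg of_nat_0_le_iff)
    moreover have "t * (h t - real n) \<le> t * 1" using n assms \<tau> by (intro mult_left_mono) auto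
    ultimately have "\<psi> t - t \<le> - W (real n) + real n * t" by (simp add: \<psi>_def algebra_simps)
    then show ?thesis by (simp add: exp_of_nat_mult[symmetric] flip: exp_add)
  qed
  ultimately show ?thesis by linarith
qed

lemma max_cball_pos: "\<tau> \<le> t \<Longrightarrow> 0 < max_cball F (exp t)"
  using max_cball_lower exp_gt_zero less_le_trans by blast

lemma approx_ln_max_cball: "approx_\<psi> (\<lambda>t. ln (max_cball F (exp t)))"
proof (rule approx_\<psi>I)
  fix \<eta> :: real assume \<eta>: "0 < \<eta>" "\<eta> < 1"
  define K where "K = \<bar>ln (1 - exp (- \<eta>))\<bar>"
  show "\<exists>K. \<forall>\<^sub>F t in at_top. ln (max_cball F (exp t)) \<le> \<psi> (t + \<eta>) + K * (1 + t)"
  proof (intro exI)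
    show "\<forall>\<^sub>F t in at_top. ln (max_cball F (exp t)) \<le> \<psi> (t + \<eta>) + K * (1 + t)"
      using eventually_ge_at_top[of \<tau>]
    proof eventually_elim
      case (elim t)
      have "ln (max_cball F (exp t)) \<le> ln (exp (\<psi> (t + \<eta>)) / (1 - exp (- \<eta>)))"
        using max_cball_upper[OF elim \<eta>(1)] max_cball_pos[OF elim] by (intro ln_mono) auto
      also have "\<dots> = \<psi> (t + \<eta>) - ln (1 - exp (- \<eta>))" using \<eta> by (simp add: ln_div)
      also have "\<dots> \<le> \<psi> (t + \<eta>) + K * 1" by (simp add: K_def)
      also have "K * 1 \<le> K * (1 + t)" using elim \<tau> by (intro mult_left_mono) (auto simp: K_def)
      finally show ?case by simp
    qed
  qed
  show "\<exists>K. \<forall>\<^sub>F t in at_top. \<psi> (t - \<eta>) - K * (1 + t) \<le> ln (max_cball F (exp t))"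
  proof (intro exI)
    show "\<forall>\<^sub>F t in at_top. \<psi> (t - \<eta>) - 1 * (1 + t) \<le> ln (max_cball F (exp t))"
      using eventually_ge_at_top[of "\<tau> + 1"]
    proof eventually_elim
      case (elim t)
      have "\<psi> t - t \<le> ln (max_cball F (exp t))"
        using max_cball_lower[of t] max_cball_pos[of t] elim by (subst ln_ge_iff) auto
      moreover have "\<psi> (t - \<eta>) \<le> \<psi> t" using elim \<eta> by (intro \<psi>_mono) auto
      ultimately show ?case by simp
    qed
  qed
qed

lemma entire_exp: "(\<lambda>z. exp (F z)) holomorphic_on UNIV"
  by (intro holomorphic_intros entire)

lemma Re_le_ln_max_cball_exp:
  assumes "cmod z \<le> r"
  shows "Re (F z) \<le> ln (max_cball (\<lambda>z. exp (F z)) r)"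
proof -
  have "exp (Re (F z)) \<le> max_cball (\<lambda>z. exp (F z)) r"
    using cmod_le_max_cball[OF holomorphic_on_imp_continuous_on[OF entire_exp] assms] by simp
  then show ?thesis by (metis exp_gt_zero ln_exp ln_mono)
qed

lemma ln_max_cball_exp_le: "0 \<le> r \<Longrightarrow> ln (max_cball (\<lambda>z. exp (F z)) r) \<le> max_cball F r"
proof -
  assume r: "0 \<le> r"
  have cF: "continuous_on UNIV F" using entire holomorphic_on_imp_continuous_on by blast
  have "max_cball (\<lambda>z. exp (F z)) r \<le> exp (max_cball F r)"
  proof (rule max_cball_le[OF r])
    fix z assume "cmod z \<le> r"
    then have "Re (F z) \<le> max_cball F r"
      using cmod_le_max_cball[OF cF, of z r] complex_Re_le_cmod[of "F z"] by linarith
    then show "cmod (exp (F z)) \<le> exp (max_cball F r)" by simp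
  qed
  moreover have "0 < max_cball (\<lambda>z. exp (F z)) r"
  proof -
    have "0 < cmod (exp (F 0))" by simp
    also have "\<dots> \<le> max_cball (\<lambda>z. exp (F z)) r"
      using r by (intro cmod_le_max_cball holomorphic_on_imp_continuous_on entire_exp) auto
    finally show ?thesis .
  qed
  ultimately show ?thesis by (metis exp_gt_zero ln_exp ln_mono)
qed

text \<open>The logarithm on the right is an upper bound for \<open>Re (F z)\<close> on the disc of
  radius \<open>exp t\<close>, from which the modulus of \<open>F\<close> is recovered on a slightly
  smaller one.\<close>

lemma max_cball_le_Re:
  fixes \<eta> :: real
  assumes "\<eta> > 0"
  shows "max_cball F (exp (t - \<eta>)) \<le>
    cmod (F 0) + 2 / (exp \<eta> - 1) * (ln (max_cball (\<lambda>z. exp (F z)) (exp t)) + cmod (F 0))"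
proof (rule max_cball_le)
  fix z assume z: "cmod z \<le> exp (t - \<eta>)"
  define A where "A = ln (max_cball (\<lambda>z. exp (F z)) (exp t))"
  have "cmod (F z - F 0) \<le> 2 * exp (t - \<eta>) / (exp t - exp (t - \<eta>)) * (A - Re (F 0))"
    using z assms by (intro borel_caratheodory[OF entire]) (auto simp: A_def intro!: Re_le_ln_max_cball_exp)
  also have "2 * exp (t - \<eta>) / (exp t - exp (t - \<eta>)) = 2 / (exp \<eta> - 1)"
  proof -
    have "exp t - exp (t - \<eta>) = exp (t - \<eta>) * (exp \<eta> - 1)" by (simp add: algebra_simps flip: exp_add)
    then show ?thesis by simp
  qed
  also have "2 / (exp \<eta> - 1) * (A - Re (F 0)) \<le> 2 / (exp \<eta> - 1) * (A + cmod (F 0))"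
    using assms abs_Re_le_cmod[of "F 0"] by (intro mult_left_mono) auto
  finally have "cmod (F z - F 0) \<le> 2 / (exp \<eta> - 1) * (A + cmod (F 0))" .
  moreover have "cmod (F z) \<le> cmod (F 0) + cmod (F z - F 0)"
    using norm_triangle_sub[of "F z" "F 0"] by simp
  ultimately show "cmod (F z) \<le> cmod (F 0) + 2 / (exp \<eta> - 1) * (A + cmod (F 0))" by linarith
qed simp

lemma eventually_max_cball_ge: "\<forall>\<^sub>F t in at_top. K \<le> max_cball F (exp t)"
proof -
  have "\<forall>\<^sub>F t in at_top. 1 * t \<le> ln (max_cball F (exp t))"
    by (rule approx_\<psi>_superlinear[OF approx_ln_max_cball])
  then show ?thesis using eventually_ge_at_top[of K] eventually_ge_at_top[of \<tau>]
  proof eventually_elim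
    case (elim t)
    have "ln (max_cball F (exp t)) \<le> max_cball F (exp t)"
      using ln_le_minus_one[OF max_cball_pos[OF elim(3)]] by simp
    then show ?case using elim by simp
  qed
qed

lemma max_cball_exp_bound:
  fixes \<eta> :: real
  assumes "\<eta> > 0"
  obtains K where "K > 0" "\<forall>\<^sub>F t in at_top. max_cball F (exp (t - \<eta>)) \<le> K * ln (max_cball (\<lambda>z. exp (F z)) (exp t))"
proof -
  define Q where "Q = 2 / (exp \<eta> - 1)"
  have Q: "Q > 0" using assms by (simp add: Q_def)
  define B where "B = cmod (F 0) + Q * cmod (F 0)"
  \<comment> \<open>The maximum tends to infinity, so the additive constants are absorbed by
    doubling the factor.\<close>
  have "\<forall>\<^sub>F t in at_top. 2 * B \<le> max_cball F (exp (t - \<eta>))"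
    using eventually_at_top_shift[OF eventually_max_cball_ge[of "2 * B"], of "- \<eta>"] by simp
  then have "\<forall>\<^sub>F t in at_top. max_cball F (exp (t - \<eta>)) \<le> (2 * Q) * ln (max_cball (\<lambda>z. exp (F z)) (exp t))"
  proof eventually_elim
    case (elim t)
    then show ?case using max_cball_le_Re[OF assms, of t] unfolding B_def Q_def[symmetric]
      by (simp add: algebra_simps)
  qed
  then show ?thesis using that[of "2 * Q"] Q by simp
qed

text \<open>The constant factor from Borel and Caratheodory becomes a bounded summand after the
  second logarithm, and the loss of \<eta> in the radius is what \<open>approx_\<psi>I\<close>
  permits.\<close>

lemma approx_ln_ln_max_cball_exp: "approx_\<psi> (\<lambda>t. ln (ln (max_cball (\<lambda>z. exp (F z)) (exp t))))"
  and eventually_ln_max_cball_exp_gt_0: "\<forall>\<^sub>F t in at_top. 0 < ln (max_cball (\<lambda>z. exp (F z)) (exp t))"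
proof -
  let ?A = "\<lambda>t. ln (max_cball (\<lambda>z. exp (F z)) (exp t))"
  obtain K1 where K1: "K1 > 0" "\<forall>\<^sub>F t in at_top. max_cball F (exp (t - 1)) \<le> K1 * ?A t"
    using max_cball_exp_bound[of 1] by auto
  show pos: "\<forall>\<^sub>F t in at_top. 0 < ?A t"
    using K1(2) eventually_ge_at_top[of "\<tau> + 1"]
  proof eventually_elim
    case (elim t)
    then have "0 < K1 * ?A t" using max_cball_pos[of "t - 1"] by simp
    then show ?case using K1(1) by (rule zero_less_mult_pos)
  qed
  show "approx_\<psi> (\<lambda>t. ln (?A t))"
  proof (rule approx_\<psi>I)
    fix \<eta> :: real assume \<eta>: "0 < \<eta>" "\<eta> < 1"
    define K where "K = \<bar>ln (1 - exp (- \<eta>))\<bar>"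
    show "\<exists>K. \<forall>\<^sub>F t in at_top. ln (?A t) \<le> \<psi> (t + \<eta>) + K * (1 + t)"
    proof (intro exI)
      show "\<forall>\<^sub>F t in at_top. ln (?A t) \<le> \<psi> (t + \<eta>) + K * (1 + t)"
        using eventually_ge_at_top[of \<tau>] pos
      proof eventually_elim
        case (elim t)
        have "?A t \<le> exp (\<psi> (t + \<eta>)) / (1 - exp (- \<eta>))"
          using max_cball_upper[OF elim(1) \<eta>(1)] ln_max_cball_exp_le[of "exp t"] by simp
        then have "ln (?A t) \<le> ln (exp (\<psi> (t + \<eta>)) / (1 - exp (- \<eta>)))"
          using elim by (intro ln_mono) auto
        also have "\<dots> = \<psi> (t + \<eta>) - ln (1 - exp (- \<eta>))" using \<eta> by (simp add: ln_div)
        also have "\<dots> \<le> \<psi> (t + \<eta>) + K * 1" by (simp add: K_def)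
        also have "K * 1 \<le> K * (1 + t)" using elim \<tau> by (intro mult_left_mono) (auto simp: K_def)
        finally show ?case by simp
      qed
    qed
    obtain Q where Q: "Q > 0" "\<forall>\<^sub>F t in at_top. max_cball F (exp (t - \<eta>)) \<le> Q * ?A t"
      using max_cball_exp_bound[OF \<eta>(1)] by auto
    define K' where "K' = \<bar>ln Q\<bar> + 1"
    show "\<exists>K. \<forall>\<^sub>F t in at_top. \<psi> (t - \<eta>) - K * (1 + t) \<le> ln (?A t)"
    proof (intro exI)
      show "\<forall>\<^sub>F t in at_top. \<psi> (t - \<eta>) - K' * (1 + t) \<le> ln (?A t)"
        using eventually_ge_at_top[of "\<tau> + 1"] pos Q(2)
      proof eventually_elim
        case (elim t)
        have "exp (\<psi> (t - \<eta>) - (t - \<eta>)) \<le> Q * ?A t"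
          using max_cball_lower[of "t - \<eta>"] elim \<eta> by simp
        then have "ln (exp (\<psi> (t - \<eta>) - (t - \<eta>))) \<le> ln (Q * ?A t)" by (intro ln_mono) auto
        then have "\<psi> (t - \<eta>) - (t - \<eta>) \<le> ln Q + ln (?A t)" using elim Q by (simp add: ln_mult)
        moreover have "ln Q + t \<le> K' * (1 + t)"
        proof -
          have "\<bar>ln Q\<bar> * 1 \<le> \<bar>ln Q\<bar> * (1 + t)" using elim \<tau> by (intro mult_left_mono) auto
          moreover have "ln Q \<le> \<bar>ln Q\<bar> * 1" by simp
          ultimately have "ln Q \<le> \<bar>ln Q\<bar> * (1 + t)" by linarith
          then show ?thesis unfolding K'_def distrib_right by simp
        qed
        ultimately show ?case using \<eta> by simp
      qed
    qed
  qed
qed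

end

section \<open>Slopes of polynomials on the graph\<close>


text \<open>A slope bound for \<open>ln (max_cball f (exp t))\<close> at all radii up to
  \<open>exp T\<close>. The multiplicative form includes the zero function.\<close>

definition growth_slope_le :: "(complex \<Rightarrow> complex) \<Rightarrow> real \<Rightarrow> real \<Rightarrow> bool" where
  "growth_slope_le f X T \<longleftrightarrow>
     (\<forall>t t'. t \<le> t' \<longrightarrow> t' \<le> T \<longrightarrow> max_cball f (exp t') \<le> exp (X * (t' - t)) * max_cball f (exp t))"

lemma growth_slope_leD:
  "growth_slope_le f X T \<Longrightarrow> t \<le> t' \<Longrightarrow> t' \<le> T \<Longrightarrow>
     max_cball f (exp t') \<le> exp (X * (t' - t)) * max_cball f (exp t)"
  by (simp add: growth_slope_le_def)

lemma growth_slope_le_mono: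
  assumes "growth_slope_le f X T" "continuous_on UNIV f" "X \<le> X'" "T' \<le> T"
  shows "growth_slope_le f X' T'"
  unfolding growth_slope_le_def
proof (intro allI impI)
  fix t t' assume t: "t \<le> t'" "t' \<le> T'"
  have "max_cball f (exp t') \<le> exp (X * (t' - t)) * max_cball f (exp t)"
    by (rule growth_slope_leD[OF assms(1)]) (use assms t in auto)
  also have "\<dots> \<le> exp (X' * (t' - t)) * max_cball f (exp t)"
    using t assms max_cball_nonneg[of f "exp t"] by (intro mult_right_mono) (auto intro: mult_right_mono)
  finally show "max_cball f (exp t') \<le> exp (X' * (t' - t)) * max_cball f (exp t)" .
qed

text \<open>This is the maximum principle for the reciprocal polynomial.\<close>

lemma poly_growth_slope_le:
  fixes p :: "complex poly"
  assumes "degree p \<le> k"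
  shows "growth_slope_le (poly p) (real k) T"
  unfolding growth_slope_le_def
proof (intro allI impI)
  fix t t' :: real assume t: "t \<le> t'"
  define q where "q w = (\<Sum>i\<le>k. coeff p i * w ^ (k - i))" for w
  have qp: "q (inverse z) * z ^ k = poly p z" if "z \<noteq> 0" for z
  proof -
    have "poly p z = (\<Sum>i\<le>k. coeff p i * z ^ i)" 
      unfolding poly_altdef using assms by (intro sum.mono_neutral_left) (auto simp: coeff_eq_0)
    also have "\<dots> = q (inverse z) * z ^ k"
      unfolding q_def sum_distrib_right
    proof (rule sum.cong)
      fix i assume "i \<in> {..k}"
      then have "z ^ k = z ^ (k - i) * z ^ i" by (simp flip: power_add)
      then show "coeff p i * z ^ i = coeff p i * inverse z ^ (k - i) * z ^ k"
        using that by (simp add: field_simps)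
    qed simp
    finally show ?thesis by simp
  qed
  have cont: "continuous_on UNIV (poly p)" by (intro continuous_intros)
  have qh: "q holomorphic_on UNIV" unfolding q_def by (intro holomorphic_intros)
  have qb: "cmod (q w) \<le> max_cball (poly p) (exp t) / exp t ^ k" if "cmod w \<le> exp (- t)" for w
  proof (rule max_modulus_sphere[OF qh _ _ that])
    fix w assume w: "cmod w = exp (- t)"
    then have "w \<noteq> 0" "cmod (inverse w) = exp t" by (auto simp: norm_inverse exp_minus)
    then show "cmod (q w) \<le> max_cball (poly p) (exp t) / exp t ^ k"
      using qp[of "inverse w"] cmod_le_max_cball[OF cont, of "inverse w" "exp t"]
      by (metis exp_gt_zero norm_mult norm_power order_refl pos_le_divide_eq zero_less_power inverse_inverse_eq inverse_nonzero_iff_nonzero)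
  qed simp
  show "max_cball (poly p) (exp t') \<le> exp (real k * (t' - t)) * max_cball (poly p) (exp t)"
  proof (rule max_cball_le)
    fix w assume w: "cmod w \<le> exp t'"
    show "cmod (poly p w) \<le> exp (real k * (t' - t)) * max_cball (poly p) (exp t)"
    proof (rule max_modulus_sphere[OF _ _ _ w])
      fix z assume z: "cmod z = exp t'"
      then have "z \<noteq> 0" "cmod (inverse z) \<le> exp (- t)" using t by (auto simp: norm_inverse exp_minus)
      then have "cmod (poly p z) \<le> max_cball (poly p) (exp t) / exp t ^ k * exp t' ^ k"
        using mult_right_mono[OF qb, of "inverse z" "exp t' ^ k"] z
        by (simp flip: qp add: norm_mult norm_power)
      also have "\<dots> = exp (real k * (t' - t)) * max_cball (poly p) (exp t)"
        by (simp add: exp_of_nat_mult[symmetric] right_diff_distrib exp_diff)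
      finally show "cmod (poly p z) \<le> exp (real k * (t' - t)) * max_cball (poly p) (exp t)" .
    qed (auto intro: holomorphic_intros)
  qed simp
qed

text \<open>The first numerical condition lets \<open>f\<close> outgrow the coefficients. The second
  one reads off the slope \<open>Y\<close> from the factor in \<open>graph_restriction\<close>,
  which is spread over a shell of logarithmic width \<delta>.\<close>

lemma graph_polynomial_slope:
  fixes \<delta> :: real
  assumes \<delta>: "\<delta> > 0"
  obtains c where "c > 0" "\<And>a f k X Y s.
     f holomorphic_on UNIV \<Longrightarrow> (\<And>i. i \<le> k \<Longrightarrow> a i holomorphic_on UNIV) \<Longrightarrow>
     max_cball f (exp s) > 0 \<Longrightarrow>
     (\<And>i. i \<le> k \<Longrightarrow> growth_slope_le (a i) X (s + 3 * \<delta>)) \<Longrightarrow> 0 \<le> X \<Longrightarrow>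
     c * (ln (max_cball f (exp (s + \<delta>))) - ln (max_cball f (exp s))) > 3 * \<delta> * X + ln (8 * (real k + 1)) \<Longrightarrow>
     ln (2 * (real k + 1)) + 3 * \<delta> * X +
       real k * (ln (max_cball f (exp (s + 3 * \<delta>))) - ln (max_cball f (exp s))) \<le> Y * \<delta> \<Longrightarrow>
     growth_slope_le (\<lambda>z. \<Sum>i\<le>k. a i z * f z ^ i) Y (s + 2 * \<delta>)"
proof -
  obtain c where c: "c > 0" and gr: "\<And>a f k d s.
     f holomorphic_on UNIV \<Longrightarrow> (\<And>i. i \<le> k \<Longrightarrow> a i holomorphic_on UNIV) \<Longrightarrow>
     max_cball f (exp s) > 0 \<Longrightarrow>
     (\<And>i. i \<le> k \<Longrightarrow> max_cball (a i) (exp (s + 3 * \<delta>)) \<le> exp d * max_cball (a i) (exp s)) \<Longrightarrow>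
     0 \<le> d \<Longrightarrow>
     c * ln (max_cball f (exp (s + \<delta>)) / max_cball f (exp s)) > d + ln (8 * (real k + 1)) \<Longrightarrow>
     max_cball (\<lambda>z. \<Sum>i\<le>k. a i z * f z ^ i) (exp (s + 3 * \<delta>)) \<le>
       2 * (real k + 1) * exp d * (max_cball f (exp (s + 3 * \<delta>)) / max_cball f (exp s)) ^ k *
       max_cball (\<lambda>z. \<Sum>i\<le>k. a i z * f z ^ i) (exp (s + 2 * \<delta>))"
  proof -
    from \<delta> show thesis by (rule graph_restriction) (fact that)
  qed
  show ?thesis
  proof (rule that[OF c])
    fix a f k X Y s
    assume f: "f holomorphic_on UNIV" and a: "\<And>i. i \<le> k \<Longrightarrow> a i holomorphic_on UNIV"
      and f0: "max_cball f (exp s) > 0"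
      and sl: "\<And>i. i \<le> k \<Longrightarrow> growth_slope_le (a i) X (s + 3 * \<delta>)" and X: "(0::real) \<le> X"
      and N: "c * (ln (max_cball f (exp (s + \<delta>))) - ln (max_cball f (exp s))) > 3 * \<delta> * X + ln (8 * (real k + 1))"
      and Y: "ln (2 * (real k + 1)) + 3 * \<delta> * X +
        real k * (ln (max_cball f (exp (s + 3 * \<delta>))) - ln (max_cball f (exp s))) \<le> Y * \<delta>"
    define P where "P z = (\<Sum>i\<le>k. a i z * f z ^ i)" for z
    have Ph: "P holomorphic_on UNIV" unfolding P_def using a f by (intro holomorphic_intros) auto
    have cf: "continuous_on UNIV f" using f by (rule entire_imp_continuous)
    have pos: "0 < max_cball f (exp (s + r))" if "r \<ge> 0" for r
      by (rule less_le_trans[OF f0 max_cball_mono[OF cf]]) (use that in auto)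
    have mono: "max_cball f (exp s) \<le> max_cball f (exp (s + r))" if "r \<ge> 0" for r
      using that by (intro max_cball_mono[OF cf]) auto
    have lnd: "ln (max_cball f (exp (s + r)) / max_cball f (exp s)) =
      ln (max_cball f (exp (s + r))) - ln (max_cball f (exp s))" if "r \<ge> 0" for r
      using f0 pos[OF that] by (simp add: ln_div)
    have "max_cball P (exp (s + 3 * \<delta>)) \<le>
       2 * (real k + 1) * exp (3 * \<delta> * X) * (max_cball f (exp (s + 3 * \<delta>)) / max_cball f (exp s)) ^ k *
       max_cball P (exp (s + 2 * \<delta>))"
      unfolding P_def
    proof (rule gr[OF f a f0])
      show "max_cball (a i) (exp (s + 3 * \<delta>)) \<le> exp (3 * \<delta> * X) * max_cball (a i) (exp s)" if "i \<le> k" for i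
        using growth_slope_leD[OF sl[OF that], of s "s + 3 * \<delta>"] \<delta> by (simp add: mult_ac)
      show "c * ln (max_cball f (exp (s + \<delta>)) / max_cball f (exp s)) > 3 * \<delta> * X + ln (8 * (real k + 1))"
        using N lnd[of \<delta>] \<delta> by simp
    qed (use X \<delta> in auto)
    also have "2 * (real k + 1) * exp (3 * \<delta> * X) * (max_cball f (exp (s + 3 * \<delta>)) / max_cball f (exp s)) ^ k =
      exp (ln (2 * (real k + 1)) + 3 * \<delta> * X +
        real k * (ln (max_cball f (exp (s + 3 * \<delta>))) - ln (max_cball f (exp s))))"
    proof -
      have "max_cball f (exp (s + 3 * \<delta>)) / max_cball f (exp s) =
        exp (ln (max_cball f (exp (s + 3 * \<delta>))) - ln (max_cball f (exp s)))"
        using lnd[of "3 * \<delta>"] pos[of "3 * \<delta>"] f0 \<delta> by (metis divide_pos_pos exp_ln less_imp_le mult_pos_pos zero_less_numeral)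
      then show ?thesis by (simp add: exp_add exp_of_nat_mult)
    qed
    also have "\<dots> * max_cball P (exp (s + 2 * \<delta>)) \<le> exp (Y * \<delta>) * max_cball P (exp (s + 2 * \<delta>))"
      using Y by (intro mult_right_mono max_cball_nonneg entire_imp_continuous Ph) auto
    finally have *: "max_cball P (exp (s + 3 * \<delta>)) \<le> exp (Y * \<delta>) * max_cball P (exp (s + 2 * \<delta>))" .
    have "0 \<le> Y * \<delta>"
    proof (rule order_trans[OF _ Y], intro add_nonneg_nonneg mult_nonneg_nonneg)
      show "0 \<le> ln (max_cball f (exp (s + 3 * \<delta>))) - ln (max_cball f (exp s))"
        using mono[of "3 * \<delta>"] f0 \<delta> by simp
    qed (use \<delta> X in auto)
    then have "0 \<le> Y" using \<delta> by (simp add: zero_le_mult_iff)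
    have "growth_slope_le P Y (s + 2 * \<delta>)"
      unfolding growth_slope_le_def
    proof (intro allI impI)
      fix t t' assume t: "t \<le> t'" "t' \<le> s + 2 * \<delta>"
      show "max_cball P (exp t') \<le> exp (Y * (t' - t)) * max_cball P (exp t)"
      proof (rule max_cball_growth_antimono[OF Ph \<open>0 \<le> Y\<close> _ _ t])
        show "s + 2 * \<delta> < s + 3 * \<delta>" using \<delta> by simp
        show "max_cball P (exp (s + 3 * \<delta>)) \<le>
          exp (Y * (s + 3 * \<delta> - (s + 2 * \<delta>))) * max_cball P (exp (s + 2 * \<delta>))" using * by simp
      qed
    qed
    then show "growth_slope_le (\<lambda>z. \<Sum>i\<le>k. a i z * f z ^ i) Y (s + 2 * \<delta>)"
      by (simp add: P_def[abs_def])
  qed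
qed

lemma ln_8_le: "k \<ge> 1 \<Longrightarrow> e \<ge> 1 \<Longrightarrow> ln (8 * (real k + 1)) \<le> 16 * real k ^ e"
proof -
  assume k: "k \<ge> 1" "e \<ge> 1"
  have "ln (8 * (real k + 1)) \<le> 8 * (real k + 1) - 1" by (rule ln_le_minus_one) simp
  also have "\<dots> \<le> 16 * real k" using k by simp
  also have "real k \<le> real k ^ e" using k by (intro self_le_power) auto
  finally show ?thesis by simp
qed

lemma ln_2_le: "k \<ge> 1 \<Longrightarrow> e \<ge> 1 \<Longrightarrow> ln (2 * (real k + 1)) \<le> 16 * real k ^ e"
  by (rule order_trans[OF _ ln_8_le]) auto

lemma eventually_at_top_sequentially:
  fixes u :: "nat \<Rightarrow> real"
  assumes "filterlim u at_top sequentially" "\<forall>\<^sub>F t in at_top. P t"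
  shows "\<forall>\<^sub>F k in sequentially. P (u k)"
  using assms(2,1) by (rule eventually_compose_filterlim)

context growth_function
begin

lemma hinv_at_top: "filterlim hinv at_top at_top"
  unfolding filterlim_at_top
proof
  fix Z :: real
  show "\<forall>\<^sub>F x in at_top. Z \<le> hinv x"
    using eventually_ge_at_top[of "h (max Z \<tau>)"]
  proof eventually_elim
    case (elim x)
    have "hinv (h (max Z \<tau>)) \<le> hinv x"
      using elim h_nonneg[of "max Z \<tau>"] by (intro hinv_mono) auto
    then show ?case using \<tau> by simp
  qed
qed

end

context growth_function
begin

lemma \<psi>_inverse_at_top:
  assumes c: "c > 0" and s: "\<forall>\<^sub>F k in sequentially. \<tau> \<le> s k \<and> \<psi> (s k) = c * ln (real k)"
  shows "filterlim s at_top sequentially"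
  unfolding filterlim_at_top
proof
  fix Z :: real
  have "filterlim (\<lambda>k. c * ln (real k)) at_top sequentially"
    using c by (intro filterlim_tendsto_pos_mult_at_top[OF tendsto_const]
        filterlim_compose[OF ln_at_top filterlim_real_sequentially]) auto
  then have "\<forall>\<^sub>F k in sequentially. \<psi> (max Z \<tau>) < c * ln (real k)"
    by (simp add: filterlim_at_top_dense)
  then show "\<forall>\<^sub>F k in sequentially. Z \<le> s k" using s
  proof eventually_elim
    case (elim k)
    then show ?case using \<psi>_mono[of "s k" "max Z \<tau>"] by (cases "Z \<le> s k") auto
  qed
qed

lemma \<psi>_surj:
  assumes "0 \<le> y"
  obtains s where "\<tau> \<le> s" "\<psi> s = y"
proof -
  have "\<forall>\<^sub>F t in at_top. y \<le> \<psi> t" using \<psi>_at_top by (simp add: filterlim_at_top)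
  then obtain b where b: "\<And>t. b \<le> t \<Longrightarrow> y \<le> \<psi> t" by (auto simp: eventually_at_top_linorder)
  have "\<exists>s\<ge>\<tau>. s \<le> max \<tau> b \<and> \<psi> s = y"
    using assms b[of "max \<tau> b"] \<psi>_\<tau> by (intro IVT' \<psi>_continuous) auto
  then show ?thesis using that by auto
qed

lemma power_level_at_top:
  assumes "B > 0" "n > 0"
  shows "filterlim (\<lambda>k. hinv (B * real k ^ n)) at_top sequentially"
proof (rule filterlim_compose[OF hinv_at_top])
  have "filterlim (\<lambda>k. real k ^ n) at_top sequentially"
    using assms by (intro filterlim_pow_at_top filterlim_real_sequentially) auto
  then show "filterlim (\<lambda>k. B * real k ^ n) at_top sequentially"
    by (rule filterlim_tendsto_pos_mult_at_top[OF tendsto_const assms(1)])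
qed

end

context growth_entire
begin

text \<open>The radius is the one where \<open>h\<close> equals \<open>B * k^e\<close>. There
  \<open>ln M_F\<close> changes over bounded distances by amounts of order \<open>B * k^e\<close>:
  for large \<open>B\<close> this dominates the slopes \<open>A * k^e\<close> of the coefficients,
  and multiplied by the degree it gives the exponent e + 1.\<close>

lemma slope_step:
  fixes \<A> :: "nat \<Rightarrow> (complex \<Rightarrow> complex) set"
  assumes ent: "\<And>k a. a \<in> \<A> k \<Longrightarrow> a holomorphic_on UNIV"
    and A: "A \<ge> 0" "\<forall>\<^sub>F k in sequentially. \<forall>a\<in>\<A> k. growth_slope_le a (A * real k ^ e) (s' k)"
    and e: "e \<ge> 1"
  obtains B0 where "B0 > 0" "\<And>B. B \<ge> B0 \<Longrightarrow> \<forall>\<^sub>F k in sequentially. hinv (B * real k ^ e) + 3 \<le> s' k \<Longrightarrow>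
     \<exists>A'\<ge>0. \<forall>\<^sub>F k in sequentially. \<forall>a. (\<forall>i\<le>k. a i \<in> \<A> k) \<longrightarrow>
       growth_slope_le (\<lambda>z. \<Sum>i\<le>k. a i z * F z ^ i) (A' * real k ^ (e + 1)) (hinv (B * real k ^ e))"
proof -
  obtain c where c: "c > 0" and slope: "\<And>a f k X Y s.
     f holomorphic_on UNIV \<Longrightarrow> (\<And>i. i \<le> k \<Longrightarrow> a i holomorphic_on UNIV) \<Longrightarrow>
     max_cball f (exp s) > 0 \<Longrightarrow>
     (\<And>i. i \<le> k \<Longrightarrow> growth_slope_le (a i) X (s + 3 * 1)) \<Longrightarrow> 0 \<le> X \<Longrightarrow>
     c * (ln (max_cball f (exp (s + 1))) - ln (max_cball f (exp s))) > 3 * 1 * X + ln (8 * (real k + 1)) \<Longrightarrow>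
     ln (2 * (real k + 1)) + 3 * 1 * X +
       real k * (ln (max_cball f (exp (s + 3 * 1))) - ln (max_cball f (exp s))) \<le> Y * 1 \<Longrightarrow>
     growth_slope_le (\<lambda>z. \<Sum>i\<le>k. a i z * f z ^ i) Y (s + 2 * 1)"
  proof -
    from zero_less_one show thesis by (rule graph_polynomial_slope) (fact that)
  qed
  \<comment> \<open>The 2 compensates for the lower bound \<open>1 / 2 * h t\<close> of the
    increments; 16 of the 17 bound the logarithm by \<open>ln_8_le\<close>, and 1 makes the
    inequality strict.\<close>
  define B0 where "B0 = 2 * (3 * A + 17) / c"
  have B0: "B0 > 0" using c A by (simp add: B0_def)
  define L where "L t = ln (max_cball F (exp t))" for t
  have L: "approx_\<psi> L" unfolding L_def by (rule approx_ln_max_cball)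
  obtain K where K: "K > 0" "\<forall>\<^sub>F t in at_top. L (t + real 3) - L t \<le> K * h t"
    by (rule approx_\<psi>_increment_le[OF L])
  have incr: "\<forall>\<^sub>F t in at_top. 1 / 2 * h t \<le> L (t + 1) - L t"
    by (rule approx_\<psi>_increment_ge[OF L]) auto
  show ?thesis
  proof (rule that[OF B0])
    fix B assume B: "B \<ge> B0" and s': "\<forall>\<^sub>F k in sequentially. hinv (B * real k ^ e) + 3 \<le> s' k"
    define s where "s k = hinv (B * real k ^ e)" for k
    have Bp: "B > 0" using B B0 by simp
    have s: "filterlim s at_top sequentially"
      unfolding s_def using e by (intro power_level_at_top Bp) simp
    define A' where "A' = 16 + 3 * A + K * B"
    have A': "A' \<ge> 0" using A K Bp by (simp add: A'_def)
    have "\<forall>\<^sub>F k in sequentially. \<forall>a. (\<forall>i\<le>k. a i \<in> \<A> k) \<longrightarrow>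
       growth_slope_le (\<lambda>z. \<Sum>i\<le>k. a i z * F z ^ i) (A' * real k ^ (e + 1)) (s k)"
      using A(2) s' eventually_at_top_sequentially[OF s K(2)] eventually_at_top_sequentially[OF s incr]
        eventually_at_top_sequentially[OF s eventually_ge_at_top[of \<tau>]] eventually_ge_at_top[of 1]
    proof eventually_elim
      case (elim k)
      have hs: "h (s k) = B * real k ^ e" using Bp by (simp add: s_def h_hinv)
      show ?case
      proof (intro allI impI)
        fix a assume a: "\<forall>i\<le>k. a i \<in> \<A> k"
        have hol: "a i holomorphic_on UNIV" if "i \<le> k" for i using ent a that by blast
        have "growth_slope_le (\<lambda>z. \<Sum>i\<le>k. a i z * F z ^ i) (A' * real k ^ (e + 1)) (s k + 2 * 1)"
        proof (rule slope[OF entire hol])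
          show "max_cball F (exp (s k)) > 0" using elim by (intro max_cball_pos) auto
          show "growth_slope_le (a i) (A * real k ^ e) (s k + 3 * 1)" if "i \<le> k" for i
          proof (rule growth_slope_le_mono[OF _ entire_imp_continuous[OF hol[OF that]] order_refl])
            show "growth_slope_le (a i) (A * real k ^ e) (s' k)" using elim(1) a that by blast
          qed (use elim(2) in \<open>simp add: s_def\<close>)
          show "0 \<le> A * real k ^ e" using A by simp
          have "3 * 1 * (A * real k ^ e) + ln (8 * (real k + 1)) \<le> (3 * A + 16) * real k ^ e"
            using ln_8_le[of k e] e elim by (simp add: algebra_simps)
          also have "\<dots> < (3 * A + 17) * real k ^ e"
            using elim by (intro mult_strict_right_mono) auto
          also have "3 * A + 17 \<le> c * (1 / 2 * B)"
            using B c by (simp add: B0_def field_simps)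
          then have "(3 * A + 17) * real k ^ e \<le> c * (1 / 2 * B) * real k ^ e"
            by (intro mult_right_mono) auto
          also have "\<dots> = c * (1 / 2 * h (s k))" by (simp add: hs)
          also have "\<dots> \<le> c * (L (s k + 1) - L (s k))" using elim c by (intro mult_left_mono) auto
          finally show "c * (ln (max_cball F (exp (s k + 1))) - ln (max_cball F (exp (s k)))) >
            3 * 1 * (A * real k ^ e) + ln (8 * (real k + 1))" by (simp add: L_def)
          have p: "real k ^ e \<le> real k ^ (e + 1)" using elim by (intro power_increasing) auto
          have "ln (2 * (real k + 1)) + 3 * 1 * (A * real k ^ e) + real k * (L (s k + 3 * 1) - L (s k)) \<le>
            16 * real k ^ e + 3 * A * real k ^ e + real k * (K * h (s k))"
            using ln_2_le[of k e] e elim by (intro add_mono mult_left_mono) auto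
          also have "\<dots> \<le> 16 * real k ^ (e + 1) + 3 * A * real k ^ (e + 1) + K * B * real k ^ (e + 1)"
            using p A by (intro add_mono mult_left_mono) (auto simp: hs)
          also have "\<dots> = A' * real k ^ (e + 1) * 1" by (simp add: A'_def algebra_simps)
          finally show "ln (2 * (real k + 1)) + 3 * 1 * (A * real k ^ e) +
            real k * (ln (max_cball F (exp (s k + 3 * 1))) - ln (max_cball F (exp (s k)))) \<le>
            A' * real k ^ (e + 1) * 1" by (simp add: L_def)
        qed
        moreover have "continuous_on UNIV (\<lambda>z. \<Sum>i\<le>k. a i z * F z ^ i)"
          using hol entire by (intro entire_imp_continuous holomorphic_intros) auto
        ultimately show "growth_slope_le (\<lambda>z. \<Sum>i\<le>k. a i z * F z ^ i) (A' * real k ^ (e + 1)) (s k)"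
          by (rule growth_slope_le_mono) auto
      qed
    qed
    then show "\<exists>A'\<ge>0. \<forall>\<^sub>F k in sequentially. \<forall>a. (\<forall>i\<le>k. a i \<in> \<A> k) \<longrightarrow>
       growth_slope_le (\<lambda>z. \<Sum>i\<le>k. a i z * F z ^ i) (A' * real k ^ (e + 1)) (hinv (B * real k ^ e))"
      using A' by (auto simp: s_def)
  qed
qed

text \<open>Since \<open>1 + 3/2 * e \<le> 2 * e\<close> for \<open>e \<ge> 2\<close>, a loss of the factor \<open>3/2\<close> in the exponent is affordable.
  It allows for \<open>ln ln\<close> of the maximum modulus being known only up to a factor close to 1.\<close>

lemma slope_step_exp:
  fixes \<A> :: "nat \<Rightarrow> (complex \<Rightarrow> complex) set"
  assumes ent: "\<And>k a. a \<in> \<A> k \<Longrightarrow> a holomorphic_on UNIV"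
    and A: "A \<ge> 0" "\<forall>\<^sub>F k in sequentially. \<forall>a\<in>\<A> k. growth_slope_le a (A * real k ^ e) (s' k)"
    and e: "e \<ge> 2"
    and s: "\<forall>\<^sub>F k in sequentially. \<tau> \<le> s k \<and> \<psi> (s k) = 5 / 4 * real e * ln (real k)"
    and s': "\<forall>\<^sub>F k in sequentially. s k + 1 \<le> s' k"
  shows "\<exists>A'\<ge>0. \<forall>\<^sub>F k in sequentially. \<forall>a. (\<forall>i\<le>k. a i \<in> \<A> k) \<longrightarrow>
       growth_slope_le (\<lambda>z. \<Sum>i\<le>k. a i z * exp (F z) ^ i) (A' * real k ^ (2 * e)) (s k)"
proof -
  obtain C1 where C1: "C1 \<ge> 1" "\<forall>\<^sub>F t in at_top. h (t + real 1) \<le> C1 * h t"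
    using shift_bound_two_sided by metis
  obtain C2 where C2: "C2 \<ge> 1" "\<forall>\<^sub>F t in at_top. h t \<le> C2 * \<psi> t" by (rule h_le_\<psi>)
  \<comment> \<open>Over a distance of \<open>3 * \<delta>\<close>, \<psi> then increases by at most
    a twentieth; together with the relative error 1/10 of \<open>L\<close> this stays below the
    factor 6/5.\<close>
  define \<delta> where "\<delta> = 1 / (60 * C1 * C2)"
  have \<delta>: "0 < \<delta>" "3 * \<delta> \<le> 1" "3 * \<delta> * (C1 * C2) = 1 / 20"
  proof -
    have "1 * 1 \<le> C1 * C2" using C1 C2 by (intro mult_mono) auto
    then show "0 < \<delta>" "3 * \<delta> \<le> 1" "3 * \<delta> * (C1 * C2) = 1 / 20"
      using C1 C2 by (auto simp: \<delta>_def field_simps)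
  qed
  obtain c where c: "c > 0" and slope: "\<And>a f k X Y s.
     f holomorphic_on UNIV \<Longrightarrow> (\<And>i. i \<le> k \<Longrightarrow> a i holomorphic_on UNIV) \<Longrightarrow>
     max_cball f (exp s) > 0 \<Longrightarrow>
     (\<And>i. i \<le> k \<Longrightarrow> growth_slope_le (a i) X (s + 3 * \<delta>)) \<Longrightarrow> 0 \<le> X \<Longrightarrow>
     c * (ln (max_cball f (exp (s + \<delta>))) - ln (max_cball f (exp s))) > 3 * \<delta> * X + ln (8 * (real k + 1)) \<Longrightarrow>
     ln (2 * (real k + 1)) + 3 * \<delta> * X +
       real k * (ln (max_cball f (exp (s + 3 * \<delta>))) - ln (max_cball f (exp s))) \<le> Y * \<delta> \<Longrightarrow>
     growth_slope_le (\<lambda>z. \<Sum>i\<le>k. a i z * f z ^ i) Y (s + 2 * \<delta>)"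
  proof -
    from \<delta>(1) show thesis by (rule graph_polynomial_slope) (fact that)
  qed
  define f where "f z = exp (F z)" for z
  have f: "f holomorphic_on UNIV" unfolding f_def by (rule entire_exp)
  define m where "m t = ln (max_cball f (exp t))" for t
  define L where "L t = ln (m t)" for t
  have L: "approx_\<psi> L" unfolding L_def m_def f_def by (rule approx_ln_ln_max_cball_exp)
  have mpos: "\<forall>\<^sub>F t in at_top. 0 < m t" unfolding m_def f_def by (rule eventually_ln_max_cball_exp_gt_0)
  have rel: "\<forall>\<^sub>F t in at_top. \<bar>L t - \<psi> t\<bar> \<le> 1 / 10 * \<psi> t" by (rule approx_\<psi>_relative[OF L]) simp
  have incr: "\<forall>\<^sub>F t in at_top. \<delta> / 2 * h t \<le> L (t + \<delta>) - L t"
    by (rule approx_\<psi>_increment_ge[OF L]) (use \<delta> in auto)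
  \<comment> \<open>As \<open>h\<close> tends to infinity, \<open>L\<close> gains at least 1 over
    the distance \<delta>. So \<open>m\<close> is multiplied by at least \<open>exp 1\<close>, and
    its increment exceeds its value.\<close>
  have lower: "\<forall>\<^sub>F t in at_top. exp (9 / 10 * \<psi> t) \<le> m (t + \<delta>) - m t"
    using incr rel mpos eventually_at_top_shift[OF mpos, of \<delta>] eventually_ge[of "2 / \<delta>"]
  proof eventually_elim
    case (elim t)
    have "1 \<le> \<delta> / 2 * h t" using elim(5) \<delta> by (simp add: field_simps)
    then have "L t + 1 \<le> L (t + \<delta>)" using elim(1) by simp
    then have "exp (L t + 1) \<le> exp (L (t + \<delta>))" by simp
    then have "exp 1 * m t \<le> m (t + \<delta>)" using elim(3,4) by (simp add: L_def exp_add mult.commute)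
    moreover have "2 * m t \<le> exp 1 * m t" using elim(3) exp_ge_add_one_self[of 1] by (intro mult_right_mono) auto
    moreover have "exp (9 / 10 * \<psi> t) \<le> exp (L t)" using elim(2) unfolding exp_le_cancel_iff by linarith
    moreover have "exp (L t) = m t" using elim(3) by (simp add: L_def)
    ultimately show ?case by linarith
  qed
  have upper: "\<forall>\<^sub>F t in at_top. m (t + 3 * \<delta>) - m t \<le> exp (6 / 5 * \<psi> t)"
    using eventually_at_top_shift[OF rel, of "3 * \<delta>"] mpos eventually_at_top_shift[OF mpos, of "3 * \<delta>"]
      C1(2) C2(2) eventually_ge_at_top[of \<tau>]
  proof eventually_elim
    case (elim t)
    have p: "0 \<le> \<psi> t" using elim \<psi>_nonneg by simp
    have "\<psi> (t + 3 * \<delta>) - \<psi> t \<le> h (t + 3 * \<delta>) * (3 * \<delta>)"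
      using \<psi>_diff(2)[of t "t + 3 * \<delta>"] elim \<delta> by simp
    also have "\<dots> \<le> (C1 * (C2 * \<psi> t)) * (3 * \<delta>)"
    proof (rule mult_right_mono)
      have "h (t + 3 * \<delta>) \<le> h (t + 1)" using elim \<delta> \<tau> by (intro mono) auto
      also have "\<dots> \<le> C1 * h t" using elim by simp
      also have "\<dots> \<le> C1 * (C2 * \<psi> t)" using elim C1 by (intro mult_left_mono) auto
      finally show "h (t + 3 * \<delta>) \<le> C1 * (C2 * \<psi> t)" .
    qed (use \<delta> in simp)
    also have "\<dots> = (3 * \<delta> * (C1 * C2)) * \<psi> t" by (simp add: mult_ac)
    also have "\<dots> = 1 / 20 * \<psi> t" by (simp add: \<delta>(3))
    finally have "\<psi> (t + 3 * \<delta>) \<le> 21 / 20 * \<psi> t" by simp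
    then have "L (t + 3 * \<delta>) \<le> 6 / 5 * \<psi> t" using elim(1) p by linarith
    then have "exp (L (t + 3 * \<delta>)) \<le> exp (6 / 5 * \<psi> t)" by simp
    then show ?case using elim(2,3) by (simp add: L_def)
  qed
  have s_top: "filterlim s at_top sequentially" using e by (intro \<psi>_inverse_at_top[OF _ s]) simp
  have large: "\<forall>\<^sub>F k in sequentially. (3 * \<delta> * A + 17) / c \<le> real k powr (real e / 8)"
  proof -
    have "filterlim (\<lambda>k. exp (real e / 8 * ln (real k))) at_top sequentially"
      using e by (intro filterlim_compose[OF exp_at_top] filterlim_tendsto_pos_mult_at_top[OF tendsto_const]
          filterlim_compose[OF ln_at_top filterlim_real_sequentially]) auto
    then have "\<forall>\<^sub>F k in sequentially. (3 * \<delta> * A + 17) / c \<le> exp (real e / 8 * ln (real k))"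
      by (simp add: filterlim_at_top)
    then show ?thesis using eventually_ge_at_top[of 1]
      by eventually_elim (simp add: powr_def)
  qed
  define A' where "A' = (16 + 3 * \<delta> * A + 1) / \<delta>"
  have A': "A' \<ge> 0" using A \<delta> by (simp add: A'_def)
  have "\<forall>\<^sub>F k in sequentially. \<forall>a. (\<forall>i\<le>k. a i \<in> \<A> k) \<longrightarrow>
       growth_slope_le (\<lambda>z. \<Sum>i\<le>k. a i z * f z ^ i) (A' * real k ^ (2 * e)) (s k)"
    using A(2) s s' eventually_at_top_sequentially[OF s_top lower] eventually_at_top_sequentially[OF s_top upper]
      eventually_at_top_sequentially[OF s_top mpos] large eventually_ge_at_top[of 1]
  proof eventually_elim
    case (elim k)
    have k: "real k \<ge> 1" using elim by simp
    have pw: "real k powr real e = real k ^ e" using k by (simp add: powr_realpow)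
    have pw2: "real k powr (2 * real e) = real k ^ (2 * e)" using k by (simp flip: powr_realpow)
    \<comment> \<open>Used with x = 9/10 and x = 6/5. The exponent 9/8 * e leaves a surplus
      \<open>k powr (e / 8)\<close> over the slopes of the coefficients, and 3/2 * e is the loss
      that can be afforded.\<close>
    have \<psi>s: "exp (x * \<psi> (s k)) = real k powr (x * (5 / 4 * real e))" for x
      using elim k by (simp add: powr_def mult_ac)
    show ?case
    proof (intro allI impI)
      fix a assume a: "\<forall>i\<le>k. a i \<in> \<A> k"
      have hol: "a i holomorphic_on UNIV" if "i \<le> k" for i using ent a that by blast
      have "growth_slope_le (\<lambda>z. \<Sum>i\<le>k. a i z * f z ^ i) (A' * real k ^ (2 * e)) (s k + 2 * \<delta>)"
      proof (rule slope[OF f hol])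
        have "max_cball f (exp (s k)) \<ge> 0"
          by (intro max_cball_nonneg entire_imp_continuous f) auto
        then show "max_cball f (exp (s k)) > 0" using elim(6)
          by (cases "max_cball f (exp (s k)) = 0") (auto simp: m_def)
        show "growth_slope_le (a i) (A * real k ^ e) (s k + 3 * \<delta>)" if "i \<le> k" for i
        proof (rule growth_slope_le_mono[OF _ entire_imp_continuous[OF hol[OF that]] order_refl])
          show "growth_slope_le (a i) (A * real k ^ e) (s' k)" using elim(1) a that by blast
        qed (use elim(3) \<delta> in simp)
        show "0 \<le> A * real k ^ e" using A by simp
        have "3 * \<delta> * (A * real k ^ e) + ln (8 * (real k + 1)) \<le> (3 * \<delta> * A + 16) * real k ^ e"
          using ln_8_le[of k e] e k by (simp add: algebra_simps)
        also have "\<dots> < (3 * \<delta> * A + 17) * real k ^ e"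
          using k by (intro mult_strict_right_mono) auto
        also have "\<dots> \<le> (c * real k powr (real e / 8)) * real k ^ e"
          using elim(7) c by (intro mult_right_mono) (auto simp: field_simps)
        also have "\<dots> = c * exp (9 / 10 * \<psi> (s k))"
          unfolding \<psi>s pw[symmetric] mult.assoc powr_add[symmetric] by (simp add: field_simps)
        also have "\<dots> \<le> c * (m (s k + \<delta>) - m (s k))" using elim c by (intro mult_left_mono) auto
        finally show "c * (ln (max_cball f (exp (s k + \<delta>))) - ln (max_cball f (exp (s k)))) >
          3 * \<delta> * (A * real k ^ e) + ln (8 * (real k + 1))" by (simp add: m_def)
        have p: "real k ^ e \<le> real k ^ (2 * e)" using k by (intro power_increasing) auto
        have "ln (2 * (real k + 1)) + 3 * \<delta> * (A * real k ^ e) + real k * (m (s k + 3 * \<delta>) - m (s k)) \<le>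
          16 * real k ^ (2 * e) + 3 * \<delta> * A * real k ^ (2 * e) + real k ^ (2 * e)"
        proof (intro add_mono)
          show "ln (2 * (real k + 1)) \<le> 16 * real k ^ (2 * e)" using e k by (intro ln_2_le) auto
          show "3 * \<delta> * (A * real k ^ e) \<le> 3 * \<delta> * A * real k ^ (2 * e)"
            using p A \<delta> by (simp add: mult_left_mono)
          have "real k * (m (s k + 3 * \<delta>) - m (s k)) \<le> real k * exp (6 / 5 * \<psi> (s k))"
            using elim by (intro mult_left_mono) auto
          also have "\<dots> = real k powr (1 + 3 / 2 * real e)"
            unfolding \<psi>s using k by (simp add: powr_add)
          also have "\<dots> \<le> real k powr (2 * real e)" using e k by (intro powr_mono) auto
          also have "\<dots> = real k ^ (2 * e)" by (rule pw2)
          finally show "real k * (m (s k + 3 * \<delta>) - m (s k)) \<le> real k ^ (2 * e)" .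
        qed
        also have "\<dots> = A' * real k ^ (2 * e) * \<delta>"
        proof -
          have "A' * \<delta> = 16 + 3 * \<delta> * A + 1" using \<delta> by (simp add: A'_def)
          then have "A' * real k ^ (2 * e) * \<delta> = (16 + 3 * \<delta> * A + 1) * real k ^ (2 * e)"
            by (metis mult.commute mult.left_commute)
          then show ?thesis by (simp add: algebra_simps)
        qed
        finally show "ln (2 * (real k + 1)) + 3 * \<delta> * (A * real k ^ e) +
          real k * (ln (max_cball f (exp (s k + 3 * \<delta>))) - ln (max_cball f (exp (s k)))) \<le>
          A' * real k ^ (2 * e) * \<delta>" by (simp add: m_def)
      qed
      moreover have "continuous_on UNIV (\<lambda>z. \<Sum>i\<le>k. a i z * f z ^ i)"
        using hol f by (intro entire_imp_continuous holomorphic_intros) auto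
      ultimately show "growth_slope_le (\<lambda>z. \<Sum>i\<le>k. a i z * f z ^ i) (A' * real k ^ (2 * e)) (s k)"
        by (rule growth_slope_le_mono) (use \<delta> in auto)
    qed
  qed
  then show ?thesis using A' by (auto simp: f_def)
qed

end

section \<open>Orders and the class C\<close>


lemma log_max_modulus_eq:
  assumes "f holomorphic_on UNIV" "r > 0"
  shows "log_max_modulus f r = ln (max_cball f r)"
  using assms by (simp add: log_max_modulus_def max_modulus_eq_max_cball entire_imp_continuous)

lemma growth_phi_eq:
  assumes "f holomorphic_on UNIV"
  shows "growth_phi f t = ln (max_cball f (exp t))"
  using assms by (simp add: growth_phi_def log_max_modulus_eq)

lemma eventually_at_top_ln:
  assumes "\<forall>\<^sub>F t in at_top. P (t::real)"
  shows "\<forall>\<^sub>F r in at_top. P (ln r)"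
  using assms ln_at_top by (rule eventually_compose_filterlim)

lemma growth_order_le:
  assumes f: "f holomorphic_on UNIV" and le: "\<forall>\<^sub>F t in at_top. ln (ln (max_cball f (exp t))) \<le> C * t"
  shows "growth_order f \<le> ereal C"
  unfolding growth_order_def
proof (rule Limsup_bounded)
  show "\<forall>\<^sub>F r in at_top. ereal (ln (log_max_modulus f r) / ln r) \<le> ereal C"
    using eventually_at_top_ln[OF le] eventually_gt_at_top[of 1]
    by eventually_elim (simp add: log_max_modulus_eq f field_simps)
qed

lemma growth_order_ge:
  assumes f: "f holomorphic_on UNIV" and ge: "\<forall>\<^sub>F t in at_top. C * t \<le> ln (ln (max_cball f (exp t)))"
  shows "ereal C \<le> growth_order f"
  unfolding growth_order_def
proof (rule le_Limsup)
  show "\<forall>\<^sub>F r in at_top. ereal C \<le> ereal (ln (log_max_modulus f r) / ln r)"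
    using eventually_at_top_ln[OF ge] eventually_gt_at_top[of 1]
    by eventually_elim (simp add: log_max_modulus_eq f field_simps)
qed simp

lemma growth_order_mono:
  assumes f: "f holomorphic_on UNIV" "g holomorphic_on UNIV"
    and le: "\<forall>\<^sub>F t in at_top. 0 < ln (max_cball f (exp t)) \<and> ln (max_cball f (exp t)) \<le> ln (max_cball g (exp t))"
  shows "growth_order f \<le> growth_order g"
  unfolding growth_order_def
proof (rule Limsup_mono)
  show "\<forall>\<^sub>F r in at_top. ereal (ln (log_max_modulus f r) / ln r) \<le> ereal (ln (log_max_modulus g r) / ln r)"
    using eventually_at_top_ln[OF le] eventually_gt_at_top[of 1]
  proof eventually_elim
    case (elim r)
    then have "ln (log_max_modulus f r) \<le> ln (log_max_modulus g r)"
      by (intro ln_mono) (auto simp: log_max_modulus_eq f)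
    then show ?case using elim by (simp add: divide_right_mono)
  qed
qed

text \<open>For a polynomial of degree k the left side with K = k + 1 would exceed the slope bound k
  as soon as \<open>t\<close> exceeds the logarithm of the maximum modulus at radius 1.\<close>

lemma nonpolynomial_entireI:
  assumes f: "f holomorphic_on UNIV" and ge: "\<And>K. \<forall>\<^sub>F t in at_top. K * t \<le> ln (max_cball f (exp t))"
  shows "nonpolynomial_entire f"
  unfolding nonpolynomial_entire_def
proof (intro conjI f notI)
  assume "\<exists>p. \<forall>z. f z = poly p z"
  then obtain p where p: "f = poly p" by auto
  define k where "k = degree p"
  have "\<forall>\<^sub>F t in at_top. (real k + 1) * t \<le> ln (max_cball f (exp t)) \<and> t > \<bar>ln (max_cball f 1)\<bar>"
    by (intro eventually_conj ge eventually_gt_at_top)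
  then obtain t where t: "(real k + 1) * t \<le> ln (max_cball f (exp t))" "t > \<bar>ln (max_cball f 1)\<bar>"
    using eventually_happens'[OF trivial_limit_at_top_linorder] by blast
  have t0: "t > 0" using t(2) by linarith
  have nn: "0 \<le> max_cball f (exp t)" by (intro max_cball_nonneg entire_imp_continuous f) auto
  have "0 < (real k + 1) * t" using t0 by simp
  then have pos: "0 < max_cball f (exp t)"
    using t(1) nn by (cases "max_cball f (exp t) = 0") auto
  have sl: "max_cball f (exp t) \<le> exp (real k * t) * max_cball f 1"
    using growth_slope_leD[OF poly_growth_slope_le[of p k t], of 0 t] t0 by (simp add: p k_def)
  have pos1: "0 < max_cball f 1"
  proof -
    have "0 < exp (real k * t) * max_cball f 1" using pos sl by linarith
    then show ?thesis by (simp add: zero_less_mult_iff)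
  qed
  have "ln (max_cball f (exp t)) \<le> ln (exp (real k * t) * max_cball f 1)"
    using sl pos by (intro ln_mono) auto
  also have "\<dots> = real k * t + ln (max_cball f 1)" using pos1 by (simp add: ln_mult)
  finally show False using t by (simp add: algebra_simps)
qed

context growth_entire
begin

lemma exp_superlinear: "\<forall>\<^sub>F t in at_top. K * t \<le> ln (max_cball (\<lambda>z. exp (F z)) (exp t))"
  using approx_\<psi>_superlinear[OF approx_ln_ln_max_cball_exp, of K] eventually_ln_max_cball_exp_gt_0
proof eventually_elim
  case (elim t)
  then show ?case using ln_le_minus_one[OF elim(2)] by linarith
qed

lemma nonpolynomial: "nonpolynomial_entire F"
  by (intro nonpolynomial_entireI entire approx_\<psi>_superlinear approx_ln_max_cball)

lemma nonpolynomial_exp: "nonpolynomial_entire (\<lambda>z. exp (F z))"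
  by (intro nonpolynomial_entireI entire_exp exp_superlinear)

lemma \<psi>_le: "\<tau> \<le> t \<Longrightarrow> \<psi> t \<le> t * h t"
proof -
  assume t: "\<tau> \<le> t"
  have "\<psi> t \<le> h t * (t - \<tau>)" using \<psi>_diff(2)[of \<tau> t] t \<psi>_\<tau> by simp
  also have "\<dots> \<le> h t * t" using \<tau> h_nonneg[OF t] by (intro mult_left_mono) auto
  finally show ?thesis by (simp add: mult.commute)
qed

lemma ln_max_cball_le_\<psi>: "\<forall>\<^sub>F t in at_top. 0 < ln (max_cball F (exp t)) \<and> ln (max_cball F (exp t)) \<le> 2 * \<psi> t
    \<and> \<psi> t \<le> 2 * ln (max_cball F (exp t))"
proof -
  have "\<forall>\<^sub>F t in at_top. \<bar>ln (max_cball F (exp t)) - \<psi> t\<bar> \<le> 1 / 2 * \<psi> t"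
    by (rule approx_\<psi>_relative[OF approx_ln_max_cball]) simp
  then show ?thesis using eventually_\<psi>_gt_0
  proof eventually_elim
    case (elim t)
    then show ?case by linarith
  qed
qed

lemma growth_order_finite: "growth_order F < \<infinity>"
proof -
  obtain C where C: "C > 0" "\<forall>\<^sub>F t in at_top. h t \<le> exp (C * t)" by (rule h_exponential_bound)
  have "growth_order F \<le> ereal (C + 2)"
  proof (rule growth_order_le[OF entire])
    show "\<forall>\<^sub>F t in at_top. ln (ln (max_cball F (exp t))) \<le> (C + 2) * t"
      using ln_max_cball_le_\<psi> C(2) eventually_ge_at_top[of \<tau>] eventually_ge_at_top[of 0]
    proof eventually_elim
      case (elim t)
      have "ln (max_cball F (exp t)) \<le> 2 * (t * h t)" using elim \<psi>_le[of t] by linarith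
      also have "\<dots> = (2 * t) * h t" by simp
      also have "\<dots> \<le> exp (2 * t) * exp (C * t)"
      proof (rule mult_mono)
        show "2 * t \<le> exp (2 * t)" using exp_ge_add_one_self[of "2 * t"] by linarith
      qed (use elim h_nonneg[of t] in auto)
      also have "\<dots> = exp ((C + 2) * t)" by (simp add: algebra_simps flip: exp_add)
      finally have "ln (ln (max_cball F (exp t))) \<le> ln (exp ((C + 2) * t))"
        using elim by (intro ln_mono) auto
      then show ?case by simp
    qed
  qed
  then show ?thesis by (rule le_less_trans) simp
qed

lemma growth_order_exp: "growth_order (\<lambda>z. exp (F z)) = \<infinity>"
proof (rule ereal_top)
  show "ereal B \<le> growth_order (\<lambda>z. exp (F z))" for B
    by (intro growth_order_ge entire_exp approx_\<psi>_superlinear approx_ln_ln_max_cball_exp)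
qed

text \<open>The numerator is at most of order \<open>h t\<close> and the denominator at least of
  order \<open>h (t - 1)\<close>.\<close>

lemma class_C_finite: "class_C_finite F"
  unfolding class_C_finite_def
proof (intro conjI growth_order_finite)
  define L where "L t = ln (max_cball F (exp t))" for t
  have L: "approx_\<psi> L" unfolding L_def by (rule approx_ln_max_cball)
  obtain K where K: "K > 0" "\<forall>\<^sub>F t in at_top. L (t + real 1) - L t \<le> K * h t"
    by (rule approx_\<psi>_increment_le[OF L])
  have incr: "\<forall>\<^sub>F t in at_top. 1 / 2 * h t \<le> L (t + 1) - L t"
    by (rule approx_\<psi>_increment_ge[OF L]) auto
  obtain C where C: "C \<ge> 1" "\<forall>\<^sub>F t in at_top. h t \<le> C * h (t - real 1)"
    using shift_bound_two_sided by metis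
  have "\<forall>\<^sub>F t in at_top. (L (t + 1) - L t) / (L t - L (t - 1)) \<le> 2 * K * C"
    using K(2) eventually_at_top_shift[OF incr, of "-1"] C(2) eventually_at_top_shift[OF eventually_gt_0, of "- 1"]
  proof eventually_elim
    case (elim t)
    have d: "1 / 2 * h (t - 1) \<le> L t - L (t - 1)" "0 < h (t - 1)" using elim by auto
    have "L (t + 1) - L t \<le> K * h t" using elim by simp
    also have "\<dots> \<le> K * (C * h (t - 1))" using elim K by (intro mult_left_mono) auto
    also have "\<dots> = 2 * K * C * (1 / 2 * h (t - 1))" by simp
    also have "\<dots> \<le> 2 * K * C * (L t - L (t - 1))" using d K C by (intro mult_left_mono) auto
    finally show ?case using d by (subst pos_divide_le_eq) auto
  qed
  then have "Limsup at_top (\<lambda>t. ereal ((growth_phi F (t + 1) - growth_phi F t) /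
      (growth_phi F t - growth_phi F (t - 1)))) \<le> ereal (2 * K * C)"
    by (intro Limsup_bounded) (simp add: growth_phi_eq[OF entire] L_def)
  then show "Limsup at_top (\<lambda>t. ereal ((growth_phi F (t + 1) - growth_phi F t) /
      (growth_phi F t - growth_phi F (t - 1)))) < \<infinity>"
    by (rule le_less_trans) simp
qed

text \<open>The convex function required by the class is \<open>exp \<circ> \<psi>\<close>, where \<open>\<psi>\<close> is continued linearly to the left.\<close>

lemma class_C_infinite: "class_C_infinite (\<lambda>z. exp (F z))"
proof -
  \<comment> \<open>At \<tau> the slope \<open>h\<close> vanishes; one unit further it is positive,
    so that the linear continuation is strictly increasing.\<close>
  define b where "b = \<tau> + 1"
  have b: "\<tau> < b" "0 < h b" using less[of \<tau> b] \<tau> by (auto simp: b_def)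
  define k where "k t = h (max t b)" for t
  define \<Psi> where "\<Psi> t = (if t \<le> b then \<psi> b + h b * (t - b) else \<psi> t)" for t
  have kb: "k t \<ge> h b" for t unfolding k_def using b \<tau> by (intro mono) auto
  then have kpos: "k t > 0" for t using b(2) by (meson less_le_trans)
  have kmono: "x \<le> y \<Longrightarrow> k x \<le> k y" for x y unfolding k_def using b \<tau> by (intro mono) auto
  have slopes: "k x * (y - x) \<le> \<Psi> y - \<Psi> x \<and> \<Psi> y - \<Psi> x \<le> k y * (y - x)" if xy: "x < y" for x y
  proof (cases "y \<le> b")
    case True
    then show ?thesis using xy by (simp add: \<Psi>_def k_def algebra_simps max_def)
  next
    case yb: False
    show ?thesis
    proof (cases "x \<le> b")
      case True
      have 1: "h b * (y - b) \<le> \<psi> y - \<psi> b" "\<psi> y - \<psi> b \<le> h y * (y - b)" using \<psi>_diff[of b y] b yb by auto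
      have 2: "h b * (b - x) \<le> h y * (b - x)" using True kb[of y] yb by (intro mult_right_mono) (auto simp: k_def)
      have eq: "\<Psi> y - \<Psi> x = (\<psi> y - \<psi> b) + h b * (b - x)" using yb True by (simp add: \<Psi>_def algebra_simps)
      have "k x = h b" "k y = h y" using True yb by (auto simp: k_def max_def)
      then show ?thesis using 1 2 eq by (simp add: algebra_simps)
    next
      case False
      then show ?thesis using \<psi>_diff[of x y] b xy yb by (simp add: \<Psi>_def k_def max_def)
    qed
  qed
  have deriv\<Psi>: "(\<Psi> has_real_derivative k t) (at t)" for t
  proof (rule deriv_from_slopes[of UNIV])
    have "continuous_on UNIV k"
      unfolding k_def using b \<tau> by (intro continuous_on_compose2[OF cont]) (auto intro!: continuous_intros)
    then show "isCont k t" by (simp add: continuous_on_eq_continuous_at)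
  qed (use slopes in auto)
  have \<Psi>mono: "\<Psi> x < \<Psi> y" if "x < y" for x y
    using slopes[OF that] mult_pos_pos[OF kpos[of x], of "y - x"] that by simp
  have deriv_exp: "((\<lambda>t. exp (\<Psi> t)) has_real_derivative exp (\<Psi> t) * k t) (at t)" for t
    by (rule DERIV_fun_exp[OF deriv\<Psi>])
  have ev: "\<forall>\<^sub>F t in at_top. \<Psi> t = \<psi> t"
    using eventually_gt_at_top[of b] by eventually_elim (simp add: \<Psi>_def)
  show ?thesis
    unfolding class_C_infinite_def
  proof (intro conjI growth_order_exp exI[of _ "\<lambda>t. exp (\<Psi> t)"])
    show "continuous_on UNIV (\<lambda>t. exp (\<Psi> t))"
      using deriv_exp DERIV_isCont by (intro continuous_at_imp_continuous_on) blast
    show "convex_on UNIV (\<lambda>t. exp (\<Psi> t))"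
    proof (rule convex_on_realI[where f' = "\<lambda>t. exp (\<Psi> t) * k t"])
      show "exp (\<Psi> x) * k x \<le> exp (\<Psi> y) * k y" if "x \<le> y" for x y
        using that \<Psi>mono[of x y] kmono[OF that] kpos[of x] less_imp_le
        by (intro mult_mono) (cases "x = y"; auto intro: less_imp_le)+
    qed (use deriv_exp in auto)
    show "strict_mono (\<lambda>t. exp (\<Psi> t))" using \<Psi>mono by (simp add: strict_mono_def)
    have "((\<lambda>t. inverse (ln (ln (max_cball (\<lambda>z. exp (F z)) (exp t))) / \<psi> t)) \<longlongrightarrow> inverse 1) at_top"
      by (intro tendsto_inverse approx_\<psi>_ratio approx_ln_ln_max_cball_exp) simp
    then have "((\<lambda>t. \<psi> t / ln (ln (max_cball (\<lambda>z. exp (F z)) (exp t)))) \<longlongrightarrow> 1) at_top"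
      by (simp add: inverse_eq_divide)
    then show "((\<lambda>t. ln (exp (\<Psi> t)) / ln (growth_phi (\<lambda>z. exp (F z)) t)) \<longlongrightarrow> 1) at_top"
      by (rule Lim_transform_eventually)
        (use ev in \<open>eventually_elim, simp add: growth_phi_eq[OF entire_exp]\<close>)
    \<comment> \<open>The expression is \<open>- t^2 * h t / (\<psi> t)^2\<close> eventually. As
      \<open>h\<close> is at most a multiple of \<psi>, it is at most of order
      \<open>t^2 / \<psi> t\<close>, and \<psi> is superquadratic.\<close>
    have "((\<lambda>t. t\<^sup>2 * deriv (\<lambda>s. 1 / ln (exp (\<Psi> s))) t) \<longlongrightarrow> 0) at_top"
    proof (rule tendstoI)
      fix e :: real assume e: "e > 0"
      obtain C where C: "C \<ge> 1" "\<forall>\<^sub>F t in at_top. h t \<le> C * \<psi> t" by (rule h_le_\<psi>)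
      show "\<forall>\<^sub>F t in at_top. dist (t\<^sup>2 * deriv (\<lambda>s. 1 / ln (exp (\<Psi> s))) t) 0 < e"
        using C(2) eventually_\<psi>_gt_0 \<psi>_superquadratic[of "2 * C / e"] eventually_gt_at_top[of b]
      proof eventually_elim
        case (elim t)
        have \<Psi>t: "\<Psi> t = \<psi> t" "k t = h t" using elim by (auto simp: \<Psi>_def k_def)
        have "((\<lambda>s. 1 / ln (exp (\<Psi> s))) has_real_derivative - (k t / (\<Psi> t)\<^sup>2)) (at t)"
          using elim \<Psi>t by (auto intro!: derivative_eq_intros deriv\<Psi> simp: power2_eq_square)
        then have "deriv (\<lambda>s. 1 / ln (exp (\<Psi> s))) t = - (h t / (\<psi> t)\<^sup>2)"
          by (simp only: DERIV_imp_deriv \<Psi>t)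
        then have "dist (t\<^sup>2 * deriv (\<lambda>s. 1 / ln (exp (\<Psi> s))) t) 0 = t\<^sup>2 * (\<bar>h t\<bar> / (\<psi> t)\<^sup>2)"
          by (simp add: dist_real_def abs_mult)
        also have "\<bar>h t\<bar> = h t" using h_nonneg[of t] elim b by simp
        also have "t\<^sup>2 * (h t / (\<psi> t)\<^sup>2) \<le> t\<^sup>2 * (C * \<psi> t / (\<psi> t)\<^sup>2)"
          using elim by (intro mult_left_mono divide_right_mono) auto
        also have "\<dots> = C * t\<^sup>2 / \<psi> t" using elim by (simp add: power2_eq_square)
        also have "\<dots> \<le> e / 2" using elim e C by (simp add: field_simps)
        also have "\<dots> < e" using e by simp
        finally show ?case .
      qed
    qed
    then show "((\<lambda>t. t\<^sup>2 * deriv (\<lambda>s. 1 / ln (exp (\<Psi> s))) t) \<longlongrightarrow> 0)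
          (inf at_top (principal {t. (\<lambda>t. exp (\<Psi> t)) differentiable at t}))"
      by (rule tendsto_mono[OF inf_le1])
  qed
qed

lemma in_class_C: "F \<in> class_C" "(\<lambda>z. exp (F z)) \<in> class_C"
  by (simp_all add: class_C_def nonpolynomial nonpolynomial_exp class_C_finite class_C_infinite)

end

section \<open>Comparison of two consecutive functions\<close>

locale growth_pair =
  A: growth_entire h1 F1 + B: growth_entire h2 F2
  for h1 F1 h2 F2
begin

lemma square_root_domination:
  assumes lim: "((\<lambda>t. h1 t / sqrt (h2 t)) \<longlongrightarrow> 0) at_top" and e: "e > 0"
  shows "\<forall>\<^sub>F t in at_top. (h1 t)\<^sup>2 \<le> e * h2 t"
proof -
  have "\<forall>\<^sub>F t in at_top. dist (h1 t / sqrt (h2 t)) 0 < sqrt e" using lim e by (intro tendstoD) auto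
  then show ?thesis using A.eventually_gt_0 B.eventually_gt_0
  proof eventually_elim
    case (elim t)
    then have "h1 t \<le> sqrt e * sqrt (h2 t)" by (simp add: dist_real_def field_simps)
    then have "(h1 t)\<^sup>2 \<le> (sqrt e * sqrt (h2 t))\<^sup>2" using elim by (intro power_mono) auto
    then show ?case using e elim by (simp add: power_mult_distrib)
  qed
qed

text \<open>The linear factor in \<open>\<psi> t \<le> t * h1 t\<close> is absorbed by a second
  factor \<open>h1 t\<close>. The constant \<open>1 / (4 * C)\<close> pays for the two factors 2
  between \<psi> and the logarithms of the maximum moduli.\<close>

lemma growth_order_le_if_square_root:
  assumes lim: "((\<lambda>t. h1 t / sqrt (h2 t)) \<longlongrightarrow> 0) at_top"
  shows "growth_order F1 \<le> growth_order F2"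
proof (rule growth_order_mono[OF A.entire B.entire])
  obtain C where C: "C \<ge> 1" "\<forall>\<^sub>F t in at_top. h2 t \<le> C * B.\<psi> t" by (rule B.h_le_\<psi>)
  have sq: "\<forall>\<^sub>F t in at_top. (h1 t)\<^sup>2 \<le> (1 / (4 * C)) * h2 t"
    using C by (intro square_root_domination lim) auto
  show "\<forall>\<^sub>F t in at_top. 0 < ln (max_cball F1 (exp t)) \<and> ln (max_cball F1 (exp t)) \<le> ln (max_cball F2 (exp t))"
    using A.ln_max_cball_le_\<psi> B.ln_max_cball_le_\<psi> sq C(2) A.eventually_ge_mult[of 1] eventually_ge_at_top[of A.\<tau>]
      A.eventually_gt_0
  proof eventually_elim
    case (elim t)
    have "A.\<psi> t \<le> t * h1 t" using A.\<psi>_le elim by simp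
    also have "\<dots> \<le> h1 t * h1 t" using elim by (intro mult_right_mono) auto
    also have "\<dots> \<le> (1 / (4 * C)) * h2 t" using elim by (simp add: power2_eq_square)
    also have "\<dots> \<le> (1 / (4 * C)) * (C * B.\<psi> t)" using elim C by (intro mult_left_mono) auto
    also have "\<dots> = B.\<psi> t / 4" using C by simp
    finally show ?case using elim(1,2) by linarith
  qed
qed

text \<open>Up to constant factors the numerator is at most \<open>h1 t\<close> and the denominator
  at least \<open>sqrt (h2 t)\<close>.\<close>

lemma increment_ratio_tendsto_0:
  assumes lim: "((\<lambda>t. h1 t / sqrt (h2 t)) \<longlongrightarrow> 0) at_top"
  shows "((\<lambda>r. (log_max_modulus F1 r - log_max_modulus F1 (r / exp 1)) /
               sqrt (log_max_modulus F2 r - log_max_modulus F2 (r / exp 1))) \<longlongrightarrow> 0) at_top"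
proof -
  define L1 where "L1 t = ln (max_cball F1 (exp t))" for t
  define L2 where "L2 t = ln (max_cball F2 (exp t))" for t
  have L1: "A.approx_\<psi> L1" unfolding L1_def by (rule A.approx_ln_max_cball)
  have L2: "B.approx_\<psi> L2" unfolding L2_def by (rule B.approx_ln_max_cball)
  obtain K where K: "K > 0" "\<forall>\<^sub>F t in at_top. L1 (t + real 1) - L1 t \<le> K * h1 t"
    by (rule A.approx_\<psi>_increment_le[OF L1])
  have incr: "\<forall>\<^sub>F t in at_top. 1 / 2 * h2 t \<le> L2 (t + 1) - L2 t"
    by (rule B.approx_\<psi>_increment_ge[OF L2]) auto
  obtain C where C: "C \<ge> 1" "\<forall>\<^sub>F t in at_top. h2 t \<le> C * h2 (t - real 1)"
    using B.shift_bound_two_sided by metis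
  have bound: "\<forall>\<^sub>F t in at_top. 0 \<le> (L1 t - L1 (t - 1)) / sqrt (L2 t - L2 (t - 1)) \<and>
    (L1 t - L1 (t - 1)) / sqrt (L2 t - L2 (t - 1)) \<le> (K * sqrt (2 * C)) * (h1 t / sqrt (h2 t))"
    using eventually_at_top_shift[OF K(2), of "-1"] eventually_at_top_shift[OF incr, of "-1"] C(2)
      B.eventually_gt_0 eventually_ge_at_top[of "A.\<tau> + 1"]
  proof eventually_elim
    case (elim t)
    have t1: "A.\<tau> \<le> t - 1" using elim by simp
    have "max_cball F1 (exp (t - 1)) \<le> max_cball F1 (exp t)"
      by (intro max_cball_mono entire_imp_continuous A.entire) auto
    then have nn: "0 \<le> L1 t - L1 (t - 1)"
      using A.max_cball_pos[OF t1] unfolding L1_def by (simp add: ln_mono)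
    have "L1 t - L1 (t - 1) \<le> K * h1 (t - 1)" using elim by simp
    also have "\<dots> \<le> K * h1 t" using K t1 A.\<tau> by (intro mult_left_mono A.mono) auto
    finally have num: "L1 t - L1 (t - 1) \<le> K * h1 t" .
    have "h2 t / (2 * C) \<le> 1 / 2 * h2 (t - 1)" using elim C by (simp add: field_simps)
    also have "\<dots> \<le> L2 t - L2 (t - 1)" using elim by simp
    finally have den: "sqrt (h2 t / (2 * C)) \<le> sqrt (L2 t - L2 (t - 1))" by simp
    have denpos: "0 < sqrt (h2 t / (2 * C))" using elim C by simp
    have "(L1 t - L1 (t - 1)) / sqrt (L2 t - L2 (t - 1)) \<le> (K * h1 t) / sqrt (h2 t / (2 * C))"
      using nn num den denpos by (intro frac_le) auto
    also have "\<dots> = (K * sqrt (2 * C)) * (h1 t / sqrt (h2 t))"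
      by (simp add: real_sqrt_divide)
    finally show ?case using nn den denpos by (intro conjI divide_nonneg_nonneg) auto
  qed
  have "((\<lambda>t. (L1 t - L1 (t - 1)) / sqrt (L2 t - L2 (t - 1))) \<longlongrightarrow> 0) at_top"
  proof (rule tendsto_sandwich[OF _ _ tendsto_const])
    show "((\<lambda>t. (K * sqrt (2 * C)) * (h1 t / sqrt (h2 t))) \<longlongrightarrow> 0) at_top"
      using tendsto_mult_left[OF lim, of "K * sqrt (2 * C)"] by simp
  qed (use bound in \<open>auto elim: eventually_mono\<close>)
  then have "((\<lambda>r. (L1 (ln r) - L1 (ln r - 1)) / sqrt (L2 (ln r) - L2 (ln r - 1))) \<longlongrightarrow> 0) at_top"
    by (rule filterlim_compose[OF _ ln_at_top])
  then show ?thesis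
  proof (rule Lim_transform_eventually)
    show "\<forall>\<^sub>F r in at_top. (L1 (ln r) - L1 (ln r - 1)) / sqrt (L2 (ln r) - L2 (ln r - 1)) =
      (log_max_modulus F1 r - log_max_modulus F1 (r / exp 1)) /
               sqrt (log_max_modulus F2 r - log_max_modulus F2 (r / exp 1))"
      using eventually_gt_at_top[of 0]
    proof eventually_elim
      case (elim r)
      then show ?case
        by (simp add: L1_def L2_def log_max_modulus_eq A.entire B.entire exp_diff)
    qed
  qed
qed

lemma \<psi>_domination:
  assumes M: "A.\<tau> \<le> M" "B.\<tau> \<le> M"
    and lim: "Limsup at_top (\<lambda>t. ereal (integral {M..t} h1 / integral {M..t - 1} h2)) < ereal (1 / 2)"
  obtains q where "0 < q" "q < 1 / 2" "\<forall>\<^sub>F t in at_top. A.\<psi> t \<le> q * B.\<psi> (t - 1)"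
proof -
  obtain x where x: "Limsup at_top (\<lambda>t. ereal (integral {M..t} h1 / integral {M..t - 1} h2)) < ereal x" "x < 1 / 2"
    using ereal_dense2[OF lim] by auto
  \<comment> \<open>Positive also if the limit superior is not. The gap between \<open>p\<close> and
    \<open>q\<close> absorbs the constant \<open>A.\<psi> M\<close> left over by the integral from
    \<open>M\<close>.\<close>
  define p where "p = max x (1 / 4)"
  define q where "q = (p + 1 / 2) / 2"
  have p: "0 < p" "p < q" "q < 1 / 2" using x(2) by (auto simp: p_def q_def)
  have "\<forall>\<^sub>F t in at_top. ereal (integral {M..t} h1 / integral {M..t - 1} h2) < ereal x"
    using x(1) by (rule Limsup_lessD)
  moreover have "\<forall>\<^sub>F t in at_top. B.\<psi> M < B.\<psi> (t - 1)"
    using eventually_at_top_shift[OF filterlim_at_top_dense[THEN iffD1, OF B.\<psi>_at_top, rule_format, of "B.\<psi> M"], of "- 1"] by simp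
  moreover have "\<forall>\<^sub>F t in at_top. A.\<psi> M / (q - p) \<le> B.\<psi> (t - 1)"
    using eventually_at_top_shift[OF filterlim_at_top[THEN iffD1, OF B.\<psi>_at_top, rule_format, of "A.\<psi> M / (q - p)"], of "- 1"] by simp
  ultimately have "\<forall>\<^sub>F t in at_top. A.\<psi> t \<le> q * B.\<psi> (t - 1)"
    using eventually_ge_at_top[of "M + 1"]
  proof eventually_elim
    case (elim t)
    have i: "integral {M..t} h1 = A.\<psi> t - A.\<psi> M" "integral {M..t - 1} h2 = B.\<psi> (t - 1) - B.\<psi> M"
      using elim M by (auto intro!: A.integral_h B.integral_h)
    have "A.\<psi> t - A.\<psi> M \<le> x * (B.\<psi> (t - 1) - B.\<psi> M)" using elim by (simp add: i field_simps)
    also have "\<dots> \<le> p * (B.\<psi> (t - 1) - B.\<psi> M)" using elim by (intro mult_right_mono) (auto simp: p_def)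
    also have "\<dots> \<le> p * B.\<psi> (t - 1)" using B.\<psi>_nonneg[OF M(2)] p by (intro mult_left_mono) auto
    finally have "A.\<psi> t \<le> A.\<psi> M + p * B.\<psi> (t - 1)" by simp
    also have "A.\<psi> M \<le> (q - p) * B.\<psi> (t - 1)" using elim p by (simp add: field_simps)
    finally show ?case by (simp add: algebra_simps)
  qed
  then show ?thesis using that[of q] p by auto
qed

lemma ln_ratio_Limsup:
  assumes M: "A.\<tau> \<le> M" "B.\<tau> \<le> M"
    and lim: "Limsup at_top (\<lambda>t. ereal (integral {M..t} h1 / integral {M..t - 1} h2)) < ereal (1 / 2)"
  shows "Limsup at_top (\<lambda>r. ereal (ln (log_max_modulus (\<lambda>z. exp (F1 z)) r) /
            ln (log_max_modulus (\<lambda>z. exp (F2 z)) (r / exp 1)))) < ereal (1 / 2)"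
proof -
  obtain q where q: "0 < q" "q < 1 / 2" "\<forall>\<^sub>F t in at_top. A.\<psi> t \<le> q * B.\<psi> (t - 1)"
    using \<psi>_domination[OF assms] by metis
  define p where "p = (q + 1 / 2) / 2"
  have p: "q < p" "p < 1 / 2" using q by (auto simp: p_def)
  \<comment> \<open>The relative error for which the factor \<open>q\<close> between the two \<psi>
    becomes the factor \<open>p\<close> between the approximating functions.\<close>
  define e where "e = (p - q) / (p + q)"
  have e: "0 < e" "e < 1" "(1 + e) * q = p * (1 - e)" using p q by (auto simp: e_def field_simps)
  define L1 where "L1 t = ln (ln (max_cball (\<lambda>z. exp (F1 z)) (exp t)))" for t
  define L2 where "L2 t = ln (ln (max_cball (\<lambda>z. exp (F2 z)) (exp t)))" for t
  have 1: "\<forall>\<^sub>F t in at_top. \<bar>L1 t - A.\<psi> t\<bar> \<le> e * A.\<psi> t"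
    unfolding L1_def by (intro A.approx_\<psi>_relative A.approx_ln_ln_max_cball_exp e)
  have 2: "\<forall>\<^sub>F t in at_top. \<bar>L2 t - B.\<psi> t\<bar> \<le> e * B.\<psi> t"
    unfolding L2_def by (intro B.approx_\<psi>_relative B.approx_ln_ln_max_cball_exp e)
  have "\<forall>\<^sub>F t in at_top. L1 t / L2 (t - 1) \<le> p"
    using 1 eventually_at_top_shift[OF 2, of "-1"] q(3) eventually_at_top_shift[OF B.eventually_\<psi>_gt_0, of "-1"]
  proof eventually_elim
    case (elim t)
    have "L1 t \<le> (1 + e) * A.\<psi> t" using elim(1) unfolding abs_le_iff by (simp add: algebra_simps)
    also have "\<dots> \<le> (1 + e) * (q * B.\<psi> (t - 1))" using elim e by (intro mult_left_mono) auto
    also have "\<dots> = p * ((1 - e) * B.\<psi> (t - 1))" using e(3) by (metis mult.assoc)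
    also have "\<dots> \<le> p * L2 (t - 1)"
      using elim(2) p q unfolding abs_le_iff by (intro mult_left_mono) (auto simp: algebra_simps)
    finally have "L1 t \<le> p * L2 (t - 1)" .
    moreover have "0 < L2 (t - 1)"
    proof -
      have "0 < (1 - e) * B.\<psi> (t - 1)" using e elim by simp
      also have "\<dots> \<le> L2 (t - 1)" using elim(2) unfolding abs_le_iff by (simp add: algebra_simps)
      finally show ?thesis .
    qed
    ultimately show ?case by (simp add: field_simps)
  qed
  then have "\<forall>\<^sub>F r in at_top. L1 (ln r) / L2 (ln r - 1) \<le> p" by (rule eventually_at_top_ln)
  then have "\<forall>\<^sub>F r in at_top. ereal (ln (log_max_modulus (\<lambda>z. exp (F1 z)) r) /
            ln (log_max_modulus (\<lambda>z. exp (F2 z)) (r / exp 1))) \<le> ereal p"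
    using eventually_gt_at_top[of 0]
    by eventually_elim (simp add: L1_def L2_def log_max_modulus_eq A.entire_exp B.entire_exp exp_diff)
  then have "Limsup at_top (\<lambda>r. ereal (ln (log_max_modulus (\<lambda>z. exp (F1 z)) r) /
            ln (log_max_modulus (\<lambda>z. exp (F2 z)) (r / exp 1)))) \<le> ereal p"
    by (rule Limsup_bounded)
  also have "ereal p < ereal (1 / 2)" using p by simp
  finally show ?thesis .
qed

end

section \<open>Polynomials in several entire functions\<close>


text \<open>The degree is bounded in every variable separately, which is harmless as only its order of growth matters.\<close>

primrec graph_polys :: "(nat \<Rightarrow> complex \<Rightarrow> complex) \<Rightarrow> nat \<Rightarrow> nat \<Rightarrow> (complex \<Rightarrow> complex) set" where
  "graph_polys g k 0 = {poly p | p. degree p \<le> k}"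
| "graph_polys g k (Suc j) = {\<lambda>z. \<Sum>i\<le>k. a i z * g (Suc j) z ^ i | a. \<forall>i\<le>k. a i \<in> graph_polys g k j}"

lemma graph_polys_holomorphic:
  assumes "\<And>i. i \<in> {1..j} \<Longrightarrow> g i holomorphic_on UNIV" "P \<in> graph_polys g k j"
  shows "P holomorphic_on UNIV"
  using assms
proof (induction j arbitrary: P)
  case 0
  then show ?case by (auto intro: holomorphic_intros)
next
  case (Suc j)
  obtain a where a: "P = (\<lambda>z. \<Sum>i\<le>k. a i z * g (Suc j) z ^ i)" "\<And>i. i \<le> k \<Longrightarrow> a i \<in> graph_polys g k j"
    using Suc.prems(2) by auto
  have "a i holomorphic_on UNIV" if "i \<le> k" for i
    by (rule Suc.IH[OF Suc.prems(1) a(2)[OF that]]) auto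
  then show ?case unfolding a(1) using Suc.prems(1)[of "Suc j"] by (intro holomorphic_intros) auto
qed

lemma graph_polys_0: "(\<lambda>z. 0) \<in> graph_polys g k j"
proof (induction j)
  case 0
  show ?case by (auto intro!: exI[of _ 0])
next
  case (Suc j)
  then show ?case by (auto intro!: exI[of _ "\<lambda>i z. 0"])
qed

lemma graph_polys_add:
  assumes "P \<in> graph_polys g k j" "Q \<in> graph_polys g k j"
  shows "(\<lambda>z. P z + Q z) \<in> graph_polys g k j"
  using assms
proof (induction j arbitrary: P Q)
  case 0
  then obtain p q where "P = poly p" "Q = poly q" "degree p \<le> k" "degree q \<le> k" by auto
  then show ?case by (auto intro!: exI[of _ "p + q"] degree_add_le)
next
  case (Suc j)
  obtain a where a: "P = (\<lambda>z. \<Sum>i\<le>k. a i z * g (Suc j) z ^ i)" "\<And>i. i \<le> k \<Longrightarrow> a i \<in> graph_polys g k j"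
    using Suc.prems(1) by auto
  obtain b where b: "Q = (\<lambda>z. \<Sum>i\<le>k. b i z * g (Suc j) z ^ i)" "\<And>i. i \<le> k \<Longrightarrow> b i \<in> graph_polys g k j"
    using Suc.prems(2) by auto
  show ?case
    using Suc.IH[OF a(2) b(2)]
    by (auto simp: a(1) b(1) algebra_simps sum.distrib intro!: exI[of _ "\<lambda>i z. a i z + b i z"])
qed

lemma graph_polys_sum:
  assumes "finite S" "\<And>x. x \<in> S \<Longrightarrow> P x \<in> graph_polys g k j"
  shows "(\<lambda>z. \<Sum>x\<in>S. P x z) \<in> graph_polys g k j"
  using assms
proof (induction S)
  case empty
  then show ?case by (simp add: graph_polys_0)
next
  case (insert x S)
  then show ?case by (auto intro!: graph_polys_add)
qed

lemma graph_polys_monomial: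
  assumes "\<And>i. i \<le> j \<Longrightarrow> \<alpha> i \<le> k"
  shows "(\<lambda>z. c * (\<Prod>i\<le>j. graph_point g z i ^ \<alpha> i)) \<in> graph_polys g k j"
  using assms
proof (induction j)
  case 0
  then have "degree (monom c (\<alpha> 0)) \<le> k" by (intro order_trans[OF degree_monom_le]) simp
  then show ?case by (auto simp: graph_point_def poly_monom intro!: exI[of _ "monom c (\<alpha> 0)"])
next
  case (Suc j)
  define a where "a i = (if i = \<alpha> (Suc j) then (\<lambda>z. c * (\<Prod>i\<le>j. graph_point g z i ^ \<alpha> i)) else (\<lambda>z. 0))" for i
  have a: "a i \<in> graph_polys g k j" for i
    using Suc.IH Suc.prems by (simp add: a_def graph_polys_0)
  have "(\<Sum>i\<le>k. a i z * g (Suc j) z ^ i) = c * (\<Prod>i\<le>Suc j. graph_point g z i ^ \<alpha> i)" for z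
  proof -
    have "(\<Sum>i\<le>k. a i z * g (Suc j) z ^ i) =
      (\<Sum>i\<le>k. if i = \<alpha> (Suc j) then c * (\<Prod>i\<le>j. graph_point g z i ^ \<alpha> i) * g (Suc j) z ^ i else 0)"
      by (intro sum.cong) (auto simp: a_def)
    also have "\<dots> = c * (\<Prod>i\<le>j. graph_point g z i ^ \<alpha> i) * g (Suc j) z ^ \<alpha> (Suc j)"
      using Suc.prems[of "Suc j"] by (simp add: sum.delta)
    also have "\<dots> = c * (\<Prod>i\<le>Suc j. graph_point g z i ^ \<alpha> i)"
      by (simp add: graph_point_def[of g z "Suc j"] mult_ac)
    finally show ?thesis .
  qed
  then have "(\<lambda>z. c * (\<Prod>i\<le>Suc j. graph_point g z i ^ \<alpha> i)) = (\<lambda>z. \<Sum>i\<le>k. a i z * g (Suc j) z ^ i)"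
    by (simp add: fun_eq_iff)
  then show ?case using a by auto
qed

lemma keys_degree_le_poly_deg:
  assumes "\<alpha> \<in> Poly_Mapping.keys p"
  shows "(\<Sum>i\<in>Poly_Mapping.keys \<alpha>. Poly_Mapping.lookup \<alpha> i) \<le> poly_deg p"
  unfolding poly_deg_def using assms by (intro Max_ge) auto

lemma eval_poly_in_graph_polys:
  assumes p: "p \<in> polys_upto m" "poly_deg p \<le> k"
  shows "(\<lambda>z. eval_poly p (graph_point g z)) \<in> graph_polys g k m"
  unfolding eval_poly_def
proof (rule graph_polys_sum)
  fix \<alpha> assume \<alpha>: "\<alpha> \<in> Poly_Mapping.keys p"
  have keys: "Poly_Mapping.keys \<alpha> \<subseteq> {..m}" using p(1) \<alpha> by (fastforce simp: polys_upto_def)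
  have le: "Poly_Mapping.lookup \<alpha> i \<le> k" for i
  proof (cases "i \<in> Poly_Mapping.keys \<alpha>")
    case True
    then have "Poly_Mapping.lookup \<alpha> i \<le> (\<Sum>i\<in>Poly_Mapping.keys \<alpha>. Poly_Mapping.lookup \<alpha> i)"
      by (intro member_le_sum) auto
    then show ?thesis using keys_degree_le_poly_deg[OF \<alpha>] p(2) by simp
  qed (simp add: in_keys_iff)
  have "(\<Prod>i\<in>Poly_Mapping.keys \<alpha>. graph_point g z i ^ Poly_Mapping.lookup \<alpha> i) =
      (\<Prod>i\<le>m. graph_point g z i ^ Poly_Mapping.lookup \<alpha> i)" for z
    using keys by (intro prod.mono_neutral_left) (auto simp: in_keys_iff)
  then show "(\<lambda>z. Poly_Mapping.lookup p \<alpha> *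
      (\<Prod>i\<in>Poly_Mapping.keys \<alpha>. graph_point g z i ^ Poly_Mapping.lookup \<alpha> i)) \<in> graph_polys g k m"
    using graph_polys_monomial[of m "Poly_Mapping.lookup \<alpha>" k "Poly_Mapping.lookup p \<alpha>" g] le by simp
qed simp

text \<open>In degree 0 the exponent vanishes, so the Bernstein inequality has to hold with factor
  1.\<close>

lemma eval_poly_degree_0:
  assumes "poly_deg p = 0"
  shows "eval_poly p x = eval_poly p y"
  unfolding eval_poly_def
proof (rule sum.cong)
  fix \<alpha> assume "\<alpha> \<in> Poly_Mapping.keys p"
  then have "\<forall>i\<in>Poly_Mapping.keys \<alpha>. Poly_Mapping.lookup \<alpha> i = 0"
    using keys_degree_le_poly_deg[of \<alpha> p] assms by simp
  then have "Poly_Mapping.keys \<alpha> = {}" by (metis equals0I in_keys_iff)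
  then show "Poly_Mapping.lookup p \<alpha> * (\<Prod>i\<in>Poly_Mapping.keys \<alpha>. x i ^ Poly_Mapping.lookup \<alpha> i) =
    Poly_Mapping.lookup p \<alpha> * (\<Prod>i\<in>Poly_Mapping.keys \<alpha>. y i ^ Poly_Mapping.lookup \<alpha> i)" by simp
qed simp

text \<open>For given \<open>r\<close> and all large \<open>k\<close>, the interval from
  \<open>ln r\<close> to \<open>ln r + 1\<close> lies below \<open>s k\<close>, and the slope bound
  over it is the inequality.\<close>

lemma graph_admits_Bernstein_if_slope:
  assumes hol: "\<And>i. i \<in> {1..m} \<Longrightarrow> g i holomorphic_on UNIV"
    and A: "A \<ge> 0" "\<forall>\<^sub>F k in sequentially. \<forall>P\<in>graph_polys g k m. growth_slope_le P (A * real k ^ n) (s k)"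
    and s: "filterlim s at_top sequentially" and n: "n > 0"
  shows "graph_admits_Bernstein m g (\<lambda>k. real k powr real n)"
  unfolding graph_admits_Bernstein_def
proof (intro conjI ballI allI impI)
  show "g j holomorphic_on UNIV" if "j \<in> {1..m}" for j using hol that .
  show "0 \<le> real k powr real n" for k by simp
  fix r :: real assume r: "r > 0"
  have "\<forall>\<^sub>F k in sequentially. (\<forall>P\<in>graph_polys g k m. growth_slope_le P (A * real k ^ n) (s k)) \<and> ln r + 1 \<le> s k"
    using A(2) s by (auto simp: filterlim_at_top intro: eventually_conj)
  then obtain k0 where k0: "\<And>k. k \<ge> k0 \<Longrightarrow>
      (\<forall>P\<in>graph_polys g k m. growth_slope_le P (A * real k ^ n) (s k)) \<and> ln r + 1 \<le> s k"
    by (auto simp: eventually_sequentially)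
  define k1 where "k1 = max k0 1"
  define C where "C = exp (A * real k1 ^ n)"
  show "\<exists>C\<ge>0. \<forall>p\<in>polys_upto m. (SUP z\<in>cball 0 (exp 1 * r). cmod (eval_poly p (graph_point g z)))
          \<le> C powr (real (poly_deg p) powr real n) * (SUP z\<in>cball 0 r. cmod (eval_poly p (graph_point g z)))"
  proof (intro exI[of _ C] conjI ballI)
    show "0 \<le> C" by (simp add: C_def)
    fix p assume p: "p \<in> polys_upto m"
    define P where "P z = eval_poly p (graph_point g z)" for z
    define d where "d = poly_deg p"
    have "max_cball P (exp 1 * r) \<le> C powr (real d powr real n) * max_cball P r"
    proof (cases "d = 0")
      case True
      then have const: "P z = P 0" for z
        unfolding P_def d_def by (rule eval_poly_degree_0)
      have "max_cball P t = cmod (P 0)" if "t \<ge> 0" for t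
      proof (rule antisym)
        show "max_cball P t \<le> cmod (P 0)" by (rule max_cball_le[OF that]) (metis const order_refl)
        have "continuous_on UNIV P" by (subst const[abs_def]) simp
        then show "cmod (P 0) \<le> max_cball P t" using that by (intro cmod_le_max_cball) auto
      qed
      then show ?thesis using r True by (simp add: C_def)
    next
      case False
      \<comment> \<open>Polynomials of small degree are treated as having degree \<open>k1\<close>.
        As \<open>k \<le> k1 * d\<close>, the factor \<open>k1 ^ n\<close> can be put into
        \<open>C\<close>.\<close>
      define k where "k = max d k1"
      have P: "P \<in> graph_polys g k m"
        unfolding P_def using p by (intro eval_poly_in_graph_polys) (auto simp: k_def d_def)
      have cont: "continuous_on UNIV P"
        using graph_polys_holomorphic[OF hol P] by (intro entire_imp_continuous) auto
      have k: "growth_slope_le P (A * real k ^ n) (s k)" "ln r + 1 \<le> s k"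
        using k0[of k] P by (auto simp: k_def k1_def)
      have "max_cball P (exp (ln r + 1)) \<le> exp (A * real k ^ n * (ln r + 1 - ln r)) * max_cball P (exp (ln r))"
        by (rule growth_slope_leD[OF k(1) _ k(2)]) simp
      then have "max_cball P (exp 1 * r) \<le> exp (A * real k ^ n) * max_cball P r"
        using r by (simp add: exp_add mult.commute)
      also have "\<dots> \<le> C powr (real d powr real n) * max_cball P r"
      proof (rule mult_right_mono)
        have "1 * d \<le> k1 * d" by (rule mult_le_mono1) (simp add: k1_def)
        moreover have "k1 * 1 \<le> k1 * d" using False by (intro mult_le_mono2) simp
        ultimately have "k \<le> k1 * d" by (simp add: k_def)
        then have "real k ^ n \<le> real (k1 * d) ^ n" by (intro power_mono of_nat_mono) auto
        then have "A * real k ^ n \<le> A * real k1 ^ n * real d ^ n"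
          using A(1) by (simp add: power_mult_distrib mult_left_mono mult.assoc)
        also have "real d ^ n = real d powr real n" using False by (simp add: powr_realpow)
        finally show "exp (A * real k ^ n) \<le> C powr (real d powr real n)"
          by (simp add: C_def powr_def mult.commute)
      qed (use r cont max_cball_nonneg in auto)
      finally show ?thesis .
    qed
    then show "(SUP z\<in>cball 0 (exp 1 * r). cmod (eval_poly p (graph_point g z)))
          \<le> C powr (real (poly_deg p) powr real n) * (SUP z\<in>cball 0 r. cmod (eval_poly p (graph_point g z)))"
      by (simp add: max_cball_def P_def d_def)
  qed
qed

section \<open>Order of the radii chosen for consecutive functions\<close>

context growth_pair
begin

text \<open>Where \<open>h1\<close> has the value \<open>B * k^n\<close>, \<open>h2\<close> exceeds
  every multiple of its square, even at a point smaller by 3.\<close>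

lemma level_order_square_root:
  assumes lim: "((\<lambda>t. h1 t / sqrt (h2 t)) \<longlongrightarrow> 0) at_top" and B: "B > 0" "B' > 0" and n: "n > 0"
  shows "\<forall>\<^sub>F k in sequentially. B.hinv (B' * real k ^ (2 * n)) + 3 \<le> A.hinv (B * real k ^ n)"
proof -
  obtain C where C: "C \<ge> 1" "\<forall>\<^sub>F t in at_top. h2 t \<le> C * h2 (t - real 3)"
    using B.shift_bound_two_sided by metis
  define s where "s k = A.hinv (B * real k ^ n)" for k
  have s: "filterlim s at_top sequentially" unfolding s_def by (intro A.power_level_at_top B n)
  define e where "e = B\<^sup>2 / (C * B')"
  have e: "e > 0" using B C by (simp add: e_def)
  have "\<forall>\<^sub>F t in at_top. B' * (h1 t)\<^sup>2 \<le> B\<^sup>2 * h2 (t - 3) \<and> B.\<tau> \<le> t - 3"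
    using square_root_domination[OF lim e] C(2) eventually_ge_at_top[of "B.\<tau> + 3"]
  proof eventually_elim
    case (elim t)
    have "(h1 t)\<^sup>2 \<le> e * (C * h2 (t - 3))" using elim e by (intro order_trans[OF elim(1)] mult_left_mono) auto
    then have "B' * (h1 t)\<^sup>2 \<le> B' * (e * (C * h2 (t - 3)))" using B by (intro mult_left_mono) auto
    also have "\<dots> = B\<^sup>2 * h2 (t - 3)" using B C by (simp add: e_def)
    finally show ?case using elim by simp
  qed
  then have "\<forall>\<^sub>F k in sequentially. B' * (h1 (s k))\<^sup>2 \<le> B\<^sup>2 * h2 (s k - 3) \<and> B.\<tau> \<le> s k - 3"
    by (rule eventually_at_top_sequentially[OF s])
  then have "\<forall>\<^sub>F k in sequentially. B.hinv (B' * real k ^ (2 * n)) + 3 \<le> s k"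
  proof eventually_elim
    case (elim k)
    have "h1 (s k) = B * real k ^ n" unfolding s_def using B by (intro A.h_hinv) simp
    then have "B\<^sup>2 * (B' * real k ^ (2 * n)) \<le> B\<^sup>2 * h2 (s k - 3)"
      using elim by (simp add: power_mult_distrib power_mult[symmetric] mult_ac)
    then have "B' * real k ^ (2 * n) \<le> h2 (s k - 3)" using B by simp
    then have "B.hinv (B' * real k ^ (2 * n)) \<le> B.hinv (h2 (s k - 3))" using B by (intro B.hinv_mono) auto
    then show ?case using elim B.\<tau> by simp
  qed
  then show ?thesis by (simp add: s_def)
qed

text \<open>Since \<open>h1\<close> grows at most exponentially, its level \<open>B * k^n\<close> is
  reached no earlier than at a multiple of ln k. There \<psi> of the second function is
  superquadratic in ln k and has long passed the level \<open>c * ln k\<close>.\<close>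

lemma level_order_exp:
  assumes B: "B > 0" and n: "n > 0" and c: "c > 0"
    and s: "\<forall>\<^sub>F k in sequentially. B.\<tau> \<le> s k \<and> B.\<psi> (s k) = c * ln (real k)"
  shows "\<forall>\<^sub>F k in sequentially. s k + 1 \<le> A.hinv (B * real k ^ n)"
proof -
  obtain C where C: "C > 0" "\<forall>\<^sub>F t in at_top. h1 t \<le> exp (C * t)" by (rule A.h_exponential_bound)
  define u where "u k = A.hinv (B * real k ^ n)" for k
  have u: "filterlim u at_top sequentially" unfolding u_def by (intro A.power_level_at_top B n)
  \<comment> \<open>With ln k at most \<open>2 * C * u k\<close>, the level is below
    \<open>K * (u k / 2)\<close>, and thus below \<open>K * (u k - 1)^2\<close> because
    \<open>u k \<ge> 2\<close>.\<close>
  define K where "K = 4 * C * (c + 1)"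
  have K: "K > 0" using C c by (simp add: K_def)
  have ln: "\<forall>\<^sub>F k in sequentially. Z \<le> ln (real k)" for Z
    using filterlim_compose[OF ln_at_top filterlim_real_sequentially] by (simp add: filterlim_at_top)
  have "\<forall>\<^sub>F t in at_top. K * t\<^sup>2 \<le> B.\<psi> t" by (rule B.\<psi>_superquadratic)
  then have "\<forall>\<^sub>F t in at_top. K * (t + -1)\<^sup>2 \<le> B.\<psi> (t + -1)" by (rule eventually_at_top_shift)
  from eventually_at_top_sequentially[OF u this] eventually_at_top_sequentially[OF u C(2)]
    eventually_at_top_sequentially[OF u eventually_ge_at_top[of "2 + B.\<tau>"]]
    ln[of "1"] ln[of "- 2 * ln B"] s eventually_ge_at_top[of 1]
  have "\<forall>\<^sub>F k in sequentially. s k + 1 \<le> u k"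
  proof eventually_elim
    case (elim k)
    have u2: "u k \<ge> 2" using elim B.\<tau> by simp
    have "h1 (u k) = B * real k ^ n" unfolding u_def using B by (intro A.h_hinv) simp
    then have "B * real k ^ n \<le> exp (C * u k)" using elim by simp
    then have "ln (B * real k ^ n) \<le> C * u k" using B elim by (subst (asm) ln_le_cancel_iff[symmetric]) auto
    then have "ln B + real n * ln (real k) \<le> C * u k" using B elim by (simp add: ln_mult ln_realpow)
    moreover have "1 * ln (real k) \<le> real n * ln (real k)" using n elim by (intro mult_right_mono) auto
    ultimately have "ln (real k) / 2 \<le> C * u k" using elim(5) by linarith
    then have lnk: "ln (real k) \<le> 2 * C * u k" by simp
    have "0 < ln (real k)" using elim(4) by linarith
    then have "c * ln (real k) < (c + 1) * ln (real k)" by (intro mult_strict_right_mono) auto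
    also have "\<dots> \<le> (c + 1) * (2 * C * u k)" using lnk c by (intro mult_left_mono) auto
    also have "\<dots> = K * (u k / 2)" by (simp add: K_def)
    also have "\<dots> \<le> K * (u k - 1)" using u2 K by (intro mult_left_mono) auto
    also have "\<dots> \<le> K * (u k - 1)\<^sup>2" using u2 K by (intro mult_left_mono self_le_power) auto
    also have "\<dots> \<le> B.\<psi> (u k - 1)" using elim by simp
    finally have "B.\<psi> (s k) < B.\<psi> (u k - 1)" using elim by simp
    then show ?case using B.\<psi>_mono[of "u k - 1" "s k"] elim by (cases "s k + 1 \<le> u k") auto
  qed
  then show ?thesis by (simp add: u_def)
qed

text \<open>The level doubles from \<open>s\<close> to \<open>s'\<close>; as q < 1/2, the second
  \<psi> has passed the doubled level already at \<open>s k - 1\<close>.\<close>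

lemma level_order_exp_exp:
  assumes M: "A.\<tau> \<le> M" "B.\<tau> \<le> M"
    and lim: "Limsup at_top (\<lambda>t. ereal (integral {M..t} h1 / integral {M..t - 1} h2)) < ereal (1 / 2)"
    and c: "c > 0"
    and s: "\<forall>\<^sub>F k in sequentially. A.\<tau> \<le> s k \<and> A.\<psi> (s k) = c * ln (real k)"
    and s': "\<forall>\<^sub>F k in sequentially. B.\<tau> \<le> s' k \<and> B.\<psi> (s' k) = 2 * c * ln (real k)"
  shows "\<forall>\<^sub>F k in sequentially. s' k + 1 \<le> s k"
proof -
  obtain q where q: "0 < q" "q < 1 / 2" "\<forall>\<^sub>F t in at_top. A.\<psi> t \<le> q * B.\<psi> (t - 1)"
    using \<psi>_domination[OF M lim] by metis
  have top: "filterlim s at_top sequentially" by (rule A.\<psi>_inverse_at_top[OF c s])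
  show ?thesis
    using eventually_at_top_sequentially[OF top q(3)] s s' eventually_gt_at_top[of 1]
      eventually_at_top_sequentially[OF top eventually_ge_at_top[of "B.\<tau> + 1"]]
  proof eventually_elim
    case (elim k)
    have "0 < c * ln (real k)" using c elim by simp
    also have "\<dots> \<le> q * B.\<psi> (s k - 1)" using elim by simp
    finally have pos: "0 < B.\<psi> (s k - 1)" using q(1) by (simp add: zero_less_mult_iff)
    have "c * ln (real k) \<le> q * B.\<psi> (s k - 1)" using elim by simp
    also have "\<dots> < 1 / 2 * B.\<psi> (s k - 1)" using q pos by (intro mult_strict_right_mono) auto
    finally have "B.\<psi> (s' k) < B.\<psi> (s k - 1)" using elim by simp
    then show ?case using B.\<psi>_mono[of "s k - 1" "s' k"] elim by (cases "s' k + 1 \<le> s k") auto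
  qed
qed

end



section \<open>Induction over the functions, and the statement itself\<close>

theorem corollary1p21:
  fixes h :: "nat \<Rightarrow> real \<Rightarrow> real"
    and F g :: "nat \<Rightarrow> complex \<Rightarrow> complex"
    and l m :: nat
    and M :: real
  assumes l_m: "1 \<le> l" "l \<le> m"
    and h_cont: "\<And>j. j \<in> {1..m} \<Longrightarrow> continuous_on {0..} (h j)"
    and h_mono: "\<And>j. j \<in> {1..m} \<Longrightarrow> strict_mono_on {0..} (h j)"
    and h_0: "\<And>j. j \<in> {1..m} \<Longrightarrow> h j 0 \<le> 0"
    and h_superlinear: "\<And>j. j \<in> {1..m} \<Longrightarrow> filterlim (\<lambda>t. h j t / t) at_top at_top"
    and h_shift: "\<And>j. j \<in> {1..m} \<Longrightarrow>
           Limsup at_top (\<lambda>t. ereal (h j (t + 1) / h j t)) < \<infinity>"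
    and h_ratio: "\<And>j. j \<in> {1..l - 1} \<Longrightarrow>
           ((\<lambda>t. h j t / sqrt (h (j + 1) t)) \<longlongrightarrow> 0) at_top"
    and M: "M = Max ((\<lambda>j. half_line_inv (h j) 0) ` {l + 1..m})"
    and h_int: "\<And>j. j \<in> {l + 1..m - 1} \<Longrightarrow>
           Limsup at_top (\<lambda>t. ereal (integral {M..t} (h j) / integral {M..t - 1} (h (j + 1))))
             < ereal (1 / 2)"
    and F: "\<And>j. j \<in> {1..m} \<Longrightarrow> is_f\<^sub>h (h j) (F j)"
    and g: "\<And>j z. j \<in> {1..m} \<Longrightarrow> g j z = (if j \<le> l then F j z else exp (F j z))"
  shows "((\<forall>j\<in>{1..m}. nonpolynomial_entire (g j) \<and> g j \<in> class_C) \<and>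
          (\<forall>j\<in>{1..m - 1}. growth_order (g j) \<le> growth_order (g (j + 1))) \<and>
          (\<forall>j\<in>{1..m - 1}.
             (growth_order (g (j + 1)) < \<infinity> \<longrightarrow>
                ((\<lambda>r. (log_max_modulus (g j) r - log_max_modulus (g j) (r / exp 1)) /
                      sqrt (log_max_modulus (g (j + 1)) r
                            - log_max_modulus (g (j + 1)) (r / exp 1))) \<longlongrightarrow> 0) at_top) \<and>
             (growth_order (g j) = \<infinity> \<longrightarrow>
                Limsup at_top (\<lambda>r. ereal (ln (log_max_modulus (g j) r) /
                                          ln (log_max_modulus (g (j + 1)) (r / exp 1))))
                  < ereal (1 / 2))))
         \<and>
         (\<exists>\<epsilon> :: nat \<Rightarrow> real.
            (\<forall>k. \<epsilon> k \<ge> 0) \<and> decseq \<epsilon> \<and> \<epsilon> \<longlonglongrightarrow> 0 \<and>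
            (l = m \<longrightarrow> (\<forall>k. \<epsilon> k = 0)) \<and>
            graph_admits_Bernstein m g (\<lambda>k. real k powr (2 ^ m + \<epsilon> k)))"
proof -
  have G: "growth_entire (h j) (F j)" if "j \<in> {1..m}" for j
    using that h_cont h_mono h_0 h_superlinear h_shift F
    by (intro growth_entire.intro growth_function.intro growth_entire_axioms.intro) auto
  have pair: "growth_pair (h j) (F j) (h (j + 1)) (F (j + 1))" if "j \<in> {1..m - 1}" for j
    using that by (intro growth_pair.intro G) auto
  have gF: "g j = F j" if "j \<in> {1..l}" for j
    using that g l_m by (auto simp: fun_eq_iff)
  have gE: "g j = (\<lambda>z. exp (F j z))" if "j \<in> {l + 1..m}" for j
    using that g l_m by (auto simp: fun_eq_iff)
  have ord_fin: "growth_order (g j) < \<infinity>" if "j \<in> {1..l}" for j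
    using growth_entire.growth_order_finite[OF G, of j] gF[OF that] that l_m by simp
  have ord_inf: "growth_order (g j) = \<infinity>" if "j \<in> {l + 1..m}" for j
    using growth_entire.growth_order_exp[OF G, of j] gE[OF that] that by simp
  have cases: "j \<in> {1..l} \<or> j \<in> {l + 1..m}" if "j \<in> {1..m}" for j using that by auto
  have hol: "g j holomorphic_on UNIV" if "j \<in> {1..m}" for j
    using cases[OF that] growth_entire.entire[OF G[OF that]] growth_entire.entire_exp[OF G[OF that]]
    by (auto simp: gF gE)
  have M_ge: "growth_function.\<tau> (h j) \<le> M" if "j \<in> {l + 1..m}" for j
  proof -
    interpret growth_entire "h j" "F j" using that by (intro G) auto
    show ?thesis unfolding \<tau>_def M using that by (intro Max_ge) auto
  qed
  \<comment> \<open>The exponent in the slope bound for polynomials in the \<open>j - 1\<close>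
    preceding functions.\<close>
  define N where "N j = (2::nat) ^ (j - 1)" for j
  \<comment> \<open>The radius at which \<open>h j\<close>, or the exponential of its \<psi> up to
    the margin 5/4, reaches the order k^(N j). The constant \<open>B\<close> is left open because
    \<open>slope_step\<close> makes it depend on the preceding slope bound; hence radii have to be
    compared for every \<open>B\<close>.\<close>
  define good where "good j s \<longleftrightarrow>
    (if j \<le> l then \<exists>B>0. s = (\<lambda>k. half_line_inv (h j) (B * real k ^ N j))
     else \<forall>\<^sub>F k in sequentially. growth_function.\<tau> (h j) \<le> s k \<and>
       growth_function.\<psi> (h j) (s k) = 5 / 4 * real (N j) * ln (real k))" for j s
  define claim where "claim j s \<longleftrightarrow> (\<exists>A\<ge>0. \<forall>\<^sub>F k in sequentially.
    \<forall>P\<in>graph_polys g k j. growth_slope_le P (A * real k ^ (2 ^ j)) (s k))" for j s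
  have N_Suc: "N (Suc j) = 2 ^ j" for j by (simp add: N_def)
  have good_top: "filterlim s at_top sequentially" if "good j s" "j \<in> {1..m}" for j s
  proof -
    interpret growth_entire "h j" "F j" by (rule G[OF that(2)])
    show ?thesis
      using that(1) power_level_at_top[of _ "N j"] \<psi>_inverse_at_top[of "5 / 4 * real (N j)" s]
      by (auto simp: good_def N_def split: if_splits)
  qed
  have unfold_Suc: "\<forall>P\<in>graph_polys g k (Suc j). growth_slope_le P X T"
    if "\<forall>a. (\<forall>i\<le>k. a i \<in> graph_polys g k j) \<longrightarrow> growth_slope_le (\<lambda>z. \<Sum>i\<le>k. a i z * g (Suc j) z ^ i) X T"
    for k j X T
    using that by auto
  have hol_polys: "P holomorphic_on UNIV" if "P \<in> graph_polys g k j" "j \<le> m" for P k j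
    by (rule graph_polys_holomorphic[OF _ that(1)]) (use hol that(2) in auto)
  have step_fin: "\<exists>s. good (Suc j) s \<and> claim (Suc j) s"
    if j: "Suc j \<le> l" and s': "claim j s'"
      and order: "\<And>B. B > 0 \<Longrightarrow> \<forall>\<^sub>F k in sequentially. half_line_inv (h (Suc j)) (B * real k ^ 2 ^ j) + 3 \<le> s' k"
    for j s'
  proof -
    have jm: "Suc j \<in> {1..m}" using j l_m by auto
    interpret growth_entire "h (Suc j)" "F (Suc j)" by (rule G[OF jm])
    have gj: "g (Suc j) = F (Suc j)" using j by (intro gF) auto
    obtain A where A: "A \<ge> 0" "\<forall>\<^sub>F k in sequentially.
      \<forall>P\<in>graph_polys g k j. growth_slope_le P (A * real k ^ (2 ^ j)) (s' k)"
      using s' by (auto simp: claim_def)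
    obtain B where B: "B > 0" and ex: "\<exists>A'\<ge>0. \<forall>\<^sub>F k in sequentially. \<forall>a. (\<forall>i\<le>k. a i \<in> graph_polys g k j) \<longrightarrow>
       growth_slope_le (\<lambda>z. \<Sum>i\<le>k. a i z * F (Suc j) z ^ i) (A' * real k ^ (2 ^ j + 1)) (hinv (B * real k ^ 2 ^ j))"
    proof -
      have h: "\<And>k a. a \<in> graph_polys g k j \<Longrightarrow> a holomorphic_on UNIV" using hol_polys jm by auto
      show thesis
        by (rule slope_step[OF h A]) (use that order in auto)
    qed
    then obtain A' where A': "A' \<ge> 0" "\<forall>\<^sub>F k in sequentially. \<forall>a. (\<forall>i\<le>k. a i \<in> graph_polys g k j) \<longrightarrow>
       growth_slope_le (\<lambda>z. \<Sum>i\<le>k. a i z * F (Suc j) z ^ i) (A' * real k ^ (2 ^ j + 1)) (hinv (B * real k ^ 2 ^ j))"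
      by blast
    have "\<forall>\<^sub>F k in sequentially. \<forall>P\<in>graph_polys g k (Suc j).
      growth_slope_le P (A' * real k ^ (2 ^ Suc j)) (hinv (B * real k ^ 2 ^ j))"
      using A'(2) eventually_ge_at_top[of 1]
    proof eventually_elim
      case (elim k)
      have "\<forall>P\<in>graph_polys g k (Suc j). growth_slope_le P (A' * real k ^ (2 ^ j + 1)) (hinv (B * real k ^ 2 ^ j))"
        using elim(1) by (intro unfold_Suc) (simp add: gj)
      moreover have "A' * real k ^ (2 ^ j + 1) \<le> A' * real k ^ (2 ^ Suc j)"
        using A'(1) elim(2) by (intro mult_left_mono power_increasing) auto
      ultimately show ?case
        using growth_slope_le_mono[OF _ entire_imp_continuous[OF hol_polys]] jm by (meson atLeastAtMost_iff order_refl)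
    qed
    then have "claim (Suc j) (\<lambda>k. hinv (B * real k ^ 2 ^ j))" using A'(1) by (auto simp: claim_def)
    moreover have "good (Suc j) (\<lambda>k. hinv (B * real k ^ 2 ^ j))" using j B by (auto simp: good_def N_Suc)
    ultimately show ?thesis by blast
  qed
  have step_inf: "\<exists>s. good (Suc j) s \<and> claim (Suc j) s"
    if j: "1 \<le> j" "l \<le> j" "Suc j \<le> m" and s': "claim j s'" "good j s'" for j s'
  proof -
    interpret growth_pair "h j" "F j" "h (Suc j)" "F (Suc j)" using pair[of j] j by auto
    have gj: "g (Suc j) = (\<lambda>z. exp (F (Suc j) z))" using j by (intro gE) auto
    have "\<exists>s. \<forall>k. k \<ge> 1 \<longrightarrow> B.\<tau> \<le> s k \<and> B.\<psi> (s k) = 5 / 4 * real (2 ^ j) * ln (real k)"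
    proof (intro choice allI)
      fix k :: nat
      show "\<exists>t. k \<ge> 1 \<longrightarrow> B.\<tau> \<le> t \<and> B.\<psi> t = 5 / 4 * real (2 ^ j) * ln (real k)"
      proof (cases "k \<ge> 1")
        case True
        then have "0 \<le> 5 / 4 * real (2 ^ j) * ln (real k)" by simp
        then show ?thesis by (rule B.\<psi>_surj) blast
      qed simp
    qed
    then obtain s where "\<And>k. k \<ge> 1 \<Longrightarrow> B.\<tau> \<le> s k \<and> B.\<psi> (s k) = 5 / 4 * real (2 ^ j) * ln (real k)" by blast
    then have s: "\<forall>\<^sub>F k in sequentially. B.\<tau> \<le> s k \<and> B.\<psi> (s k) = 5 / 4 * real (2 ^ j) * ln (real k)"
      by (auto simp: eventually_sequentially)
    \<comment> \<open>For j = l the preceding radius is a level of \<open>h\<close>, afterwards it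
      is a level of \<psi>, and the hypothesis on integrals applies.\<close>
    have order: "\<forall>\<^sub>F k in sequentially. s k + 1 \<le> s' k"
    proof (cases "j = l")
      case True
      then obtain B where "B > 0" "s' = (\<lambda>k. A.hinv (B * real k ^ N j))" using s'(2) by (auto simp: good_def)
      then show ?thesis using level_order_exp[where B = B and n = "N j", OF _ _ _ s] by (simp add: N_def)
    next
      case False
      have N2: "2 * real (N j) = 2 ^ j" using j by (cases j) (auto simp: N_def)
      show ?thesis
      proof (rule level_order_exp_exp[of M "5 / 4 * real (N j)"])
        show "A.\<tau> \<le> M" "B.\<tau> \<le> M" using False j by (auto intro!: M_ge)
        show "Limsup at_top (\<lambda>t. ereal (integral {M..t} (h j) / integral {M..t - 1} (h (Suc j)))) < ereal (1 / 2)"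
          using h_int[of j] False j by simp
        show "\<forall>\<^sub>F k in sequentially. A.\<tau> \<le> s' k \<and> A.\<psi> (s' k) = 5 / 4 * real (N j) * ln (real k)"
          using s'(2) False j by (simp add: good_def)
        have c_eq: "2 * (5 / 4 * real (N j)) = 5 / 4 * real (2 ^ j)" using N2 by simp
        show "\<forall>\<^sub>F k in sequentially. B.\<tau> \<le> s k \<and> B.\<psi> (s k) = 2 * (5 / 4 * real (N j)) * ln (real k)"
          unfolding c_eq by (rule s)
      qed (simp add: N_def)
    qed
    obtain A where A: "A \<ge> 0" "\<forall>\<^sub>F k in sequentially.
      \<forall>P\<in>graph_polys g k j. growth_slope_le P (A * real k ^ (2 ^ j)) (s' k)"
      using s' by (auto simp: claim_def)
    have "\<exists>A'\<ge>0. \<forall>\<^sub>F k in sequentially. \<forall>a. (\<forall>i\<le>k. a i \<in> graph_polys g k j) \<longrightarrow>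
       growth_slope_le (\<lambda>z. \<Sum>i\<le>k. a i z * exp (F (Suc j) z) ^ i) (A' * real k ^ (2 * 2 ^ j)) (s k)"
    proof (rule B.slope_step_exp[OF _ A _ s order])
      show "a holomorphic_on UNIV" if "a \<in> graph_polys g k j" for k a using hol_polys[OF that] j by simp
      \<comment> \<open>An exponential is never the first function, so the exponent 2 required by
        \<open>slope_step_exp\<close> is available.\<close>
      show "2 \<le> (2::nat) ^ j" using j by (intro self_le_power) auto
    qed
    then obtain A' where A': "A' \<ge> 0" "\<forall>\<^sub>F k in sequentially. \<forall>a. (\<forall>i\<le>k. a i \<in> graph_polys g k j) \<longrightarrow>
       growth_slope_le (\<lambda>z. \<Sum>i\<le>k. a i z * exp (F (Suc j) z) ^ i) (A' * real k ^ (2 * 2 ^ j)) (s k)"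
      by blast
    have "\<forall>\<^sub>F k in sequentially. \<forall>P\<in>graph_polys g k (Suc j). growth_slope_le P (A' * real k ^ (2 ^ Suc j)) (s k)"
      using A'(2)
    proof eventually_elim
      case (elim k)
      then show ?case by (intro unfold_Suc) (simp add: gj)
    qed
    then have "claim (Suc j) s" using A'(1) by (auto simp: claim_def)
    moreover have "good (Suc j) s" using s j by (simp add: good_def N_Suc)
    ultimately show ?thesis by blast
  qed
  have claims: "\<exists>s. good j s \<and> claim j s" if "1 \<le> j" "j \<le> m" for j
    using that
  proof (induction j rule: dec_induct)
    case base
    interpret growth_entire "h 1" "F 1" using l_m by (intro G) auto
    \<comment> \<open>Polynomials have slope at most k at all radii, so the initial radius is free;
      k^2 exceeds \<open>B * k\<close> eventually, whatever \<open>B\<close> is.\<close>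
    define s' where "s' k = hinv (real k ^ 2) + 3" for k :: nat
    have "growth_slope_le P (1 * real k ^ (2 ^ 0)) (s' k)" if "P \<in> graph_polys g k 0" for P k
      using that poly_growth_slope_le by auto
    then have "claim 0 s'" unfolding claim_def by (intro exI[of _ 1]) auto
    moreover have "\<forall>\<^sub>F k in sequentially. half_line_inv (h (Suc 0)) (B * real k ^ 2 ^ 0) + 3 \<le> s' k"
      if B: "B > 0" for B
      using eventually_ge_at_top[of "nat \<lceil>B\<rceil>"]
    proof eventually_elim
      case (elim k)
      then have "B * real k \<le> real k * real k" by (intro mult_right_mono) linarith+
      then have "hinv (B * real k) \<le> hinv (real k ^ 2)"
        using B by (intro hinv_mono) (auto simp: power2_eq_square)
      then show ?case by (simp add: s'_def)
    qed
    ultimately show ?case using step_fin[of 0 s'] l_m by simp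
  next
    case (step j)
    then obtain s' where s': "good j s'" "claim j s'" by auto
    show ?case
    proof (cases "Suc j \<le> l")
      case True
      show ?thesis
      proof (rule step_fin[OF True s'(2)])
        fix B :: real assume B: "B > 0"
        interpret growth_pair "h j" "F j" "h (Suc j)" "F (Suc j)" using pair[of j] step by auto
        obtain B' where B': "B' > 0" "s' = (\<lambda>k. A.hinv (B' * real k ^ N j))"
          using s'(1) True by (auto simp: good_def)
        have "2 * N j = 2 ^ j" using step by (cases j) (auto simp: N_def)
        moreover have "((\<lambda>t. h j t / sqrt (h (Suc j) t)) \<longlongrightarrow> 0) at_top"
          using h_ratio[of j] True step by simp
        ultimately show "\<forall>\<^sub>F k in sequentially. half_line_inv (h (Suc j)) (B * real k ^ 2 ^ j) + 3 \<le> s' k"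
          using level_order_square_root[of B' B "N j"] B B' by (simp add: N_def)
      qed
    next
      case False
      then show ?thesis using step s' by (intro step_inf) auto
    qed
  qed
  obtain s A where s: "good m s" and A: "A \<ge> 0"
    "\<forall>\<^sub>F k in sequentially. \<forall>P\<in>graph_polys g k m. growth_slope_le P (A * real k ^ (2 ^ m)) (s k)"
    using claims[of m] l_m by (auto simp: claim_def)
  have "graph_admits_Bernstein m g (\<lambda>k. real k powr real (2 ^ m))"
    using l_m by (intro graph_admits_Bernstein_if_slope[OF hol A] good_top[OF s]) auto
  then have bernstein: "graph_admits_Bernstein m g (\<lambda>k. real k powr (2 ^ m + 0))" by simp
  show ?thesis
  proof (intro conjI ballI impI)
    fix j assume j: "j \<in> {1..m}"
    interpret growth_entire "h j" "F j" by (rule G[OF j])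
    show "nonpolynomial_entire (g j)" "g j \<in> class_C"
      using cases[OF j] nonpolynomial nonpolynomial_exp in_class_C by (auto simp: gF gE)
  next
    fix j assume j: "j \<in> {1..m - 1}"
    interpret growth_pair "h j" "F j" "h (j + 1)" "F (j + 1)" by (rule pair[OF j])
    show "growth_order (g j) \<le> growth_order (g (j + 1))"
    proof (cases "j + 1 \<le> l")
      case True
      then show ?thesis using growth_order_le_if_square_root[OF h_ratio] j by (simp add: gF)
    next
      case False
      then show ?thesis using ord_inf[of "j + 1"] j by auto
    qed
  next
    fix j assume j: "j \<in> {1..m - 1}" and fin: "growth_order (g (j + 1)) < \<infinity>"
    interpret growth_pair "h j" "F j" "h (j + 1)" "F (j + 1)" by (rule pair[OF j])
    have "j + 1 \<le> m" using j by auto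
    then have "j + 1 \<le> l" using ord_inf[of "j + 1"] fin by (cases "j + 1 \<le> l") auto
    then show "((\<lambda>r. (log_max_modulus (g j) r - log_max_modulus (g j) (r / exp 1)) /
                      sqrt (log_max_modulus (g (j + 1)) r
                            - log_max_modulus (g (j + 1)) (r / exp 1))) \<longlongrightarrow> 0) at_top"
      using increment_ratio_tendsto_0[OF h_ratio] j by (simp add: gF)
  next
    fix j assume j: "j \<in> {1..m - 1}" and inf: "growth_order (g j) = \<infinity>"
    interpret growth_pair "h j" "F j" "h (j + 1)" "F (j + 1)" by (rule pair[OF j])
    have "l < j" using ord_fin[of j] inf j by (cases "l < j") auto
    then have "j \<in> {l + 1..m - 1}" "j \<in> {l + 1..m}" "j + 1 \<in> {l + 1..m}" using j by auto
    then show "Limsup at_top (\<lambda>r. ereal (ln (log_max_modulus (g j) r) /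
                                          ln (log_max_modulus (g (j + 1)) (r / exp 1))))
                  < ereal (1 / 2)"
      using ln_ratio_Limsup[OF M_ge M_ge h_int] by (simp add: gE)
  next
    show "\<exists>\<epsilon> :: nat \<Rightarrow> real.
            (\<forall>k. \<epsilon> k \<ge> 0) \<and> decseq \<epsilon> \<and> \<epsilon> \<longlonglongrightarrow> 0 \<and>
            (l = m \<longrightarrow> (\<forall>k. \<epsilon> k = 0)) \<and>
            graph_admits_Bernstein m g (\<lambda>k. real k powr (2 ^ m + \<epsilon> k))"
      using bernstein by (intro exI[of _ "\<lambda>_. 0"]) (auto simp: decseq_def)
  qed
qed

end
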